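(* i) For any $N\in\mathbb{N}$ there exists a $V\in L_1(\mathbb{R}^2)$, $V\ge0$, such that $N_-(\mathcal{E}_V)=N$ and $N_-(\mathcal{E}_{\alpha V})=\infty$ for all $\alpha>1$. ii) For any strictly increasing sequence $(\alpha_k)_{k\in\mathbb{N}}$ of positive numbers converging to $1$ and any $N_k\in\mathbb{N}$, $k\in\mathbb{N}$, there exists a $V\in L_1(\mathbb{R}^2)$, $V\ge0$, such that $$N_k\le N_-(\mathcal{E}_{\alpha_{k+1}V})-N_-(\mathcal{E}_{\alpha_kV})<\infty,\qquad k\in\mathbb{N}.$$ iii) For any strictly increasing sequence $(\alpha_k)_{k\in\mathbb{N}}$ of positive numbers converging to $1$ and satisfying $$\sum_{k=1}^\infty\frac{1-\alpha_{k+1}}{\alpha_{k+1}-\alpha_k}<\infty,$$ there exist a $V\in L_1(\mathbb{R}^2)$, $V\ge0$, and a $k_0\in\mathbb{N}$ such that $N_-(\mathcal{E}_{\alpha_{k+1}V})-N_-(\mathcal{E}_{\alpha_kV})=1$ for all $k\ge k_0$.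
   Context: $\mathbb{N}=\{1,2,\dots\}$. For a Hermitian form $\mathbf{q}$ with domain $\mathrm{Dom}(\mathbf{q})$ in a Hilbert space, $N_-(\mathbf{q}) := \sup\{\dim\mathcal{L} : \mathcal{L}\subseteq \mathrm{Dom}(\mathbf{q}) \text{ a linear subspace},\ \mathbf{q}[u]<0\ \forall u\in\mathcal{L}\setminus\{0\}\}\in\{0,1,2,\dots\}\cup\{\infty\}$. For locally integrable $V\ge 0$ on $\mathbb{R}^2$, $\mathcal{E}_V[w] := \int_{\mathbb{R}^2}|\nabla w(x)|^2dx - \int_{\mathbb{R}^2}V(x)|w(x)|^2dx$ with $\mathrm{Dom}(\mathcal{E}_V) := W^1_2(\mathbb{R}^2)\cap L_2(\mathbb{R}^2,V(x)dx)$, where $W^1_2$ is the Sobolev space of $L_2$ functions with $L_2$ first-order weak derivatives. *)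

theory Defs
  imports "HOL-Analysis.Analysis" "HOL-Library.Extended_Nat"
begin

section \<open>The complex Hilbert space of square integrable functions on the plane\<close>

definition sq_integrable :: "(real^2 \<Rightarrow> complex) \<Rightarrow> bool" where
  "sq_integrable f \<longleftrightarrow>
     f \<in> borel_measurable lebesgue \<and> integrable lebesgue (\<lambda>x. (cmod (f x))\<^sup>2)"

lemma sq_integrable_zero: "sq_integrable (\<lambda>x. 0)"
  by (simp add: sq_integrable_def)

lemma sq_integrable_add:
  assumes "sq_integrable f" "sq_integrable g"
  shows "sq_integrable (\<lambda>x. f x + g x)"
proof -
  have [measurable]: "f \<in> borel_measurable lebesgue" "g \<in> borel_measurable lebesgue"
    using assms by (auto simp: sq_integrable_def)
  have bound: "(cmod (a + b))\<^sup>2 \<le> 2 * (cmod a)\<^sup>2 + 2 * (cmod b)\<^sup>2" for a b :: complex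
  proof -
    have "(cmod (a + b))\<^sup>2 \<le> (cmod a + cmod b)\<^sup>2"
      by (intro power_mono norm_triangle_ineq) auto
    also have "\<dots> \<le> 2 * (cmod a)\<^sup>2 + 2 * (cmod b)\<^sup>2"
      using zero_le_power2[of "cmod a - cmod b"]
      by (simp add: power2_sum power2_diff)
    finally show ?thesis .
  qed
  have "integrable lebesgue (\<lambda>x. 2 * (cmod (f x))\<^sup>2 + 2 * (cmod (g x))\<^sup>2)"
    using assms by (auto simp: sq_integrable_def)
  then have "integrable lebesgue (\<lambda>x. (cmod (f x + g x))\<^sup>2)"
    by (rule Bochner_Integration.integrable_bound) (auto intro!: AE_I2 simp: bound)
  then show ?thesis
    by (simp add: sq_integrable_def)
qed

lemma sq_integrable_scale:
  assumes "sq_integrable f"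
  shows "sq_integrable (\<lambda>x. c * f x)"
  using assms by (auto simp: sq_integrable_def norm_mult power_mult_distrib)

lemma sq_integrable_uminus:
  assumes "sq_integrable f"
  shows "sq_integrable (\<lambda>x. - f x)"
  using sq_integrable_scale[OF assms, of "-1"] by simp

definition ae_equal :: "(real^2 \<Rightarrow> complex) \<Rightarrow> (real^2 \<Rightarrow> complex) \<Rightarrow> bool" where
  "ae_equal f g \<longleftrightarrow> sq_integrable f \<and> sq_integrable g \<and> (AE x in lebesgue. f x = g x)"

quotient_type L2 = "real^2 \<Rightarrow> complex" / partial: ae_equal
proof (rule part_equivpI)
  show "\<exists>f. ae_equal f f"
    using sq_integrable_zero by (auto simp: ae_equal_def)
  show "symp ae_equal"
    by (auto simp: symp_def ae_equal_def)
  show "transp ae_equal"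
  proof (rule transpI)
    fix f g h assume "ae_equal f g" "ae_equal g h"
    then have "AE x in lebesgue. f x = g x" "AE x in lebesgue. g x = h x"
      and "sq_integrable f" "sq_integrable h"
      by (auto simp: ae_equal_def)
    moreover from this(1,2) have "AE x in lebesgue. f x = h x"
      by eventually_elim simp
    ultimately show "ae_equal f h"
      by (simp add: ae_equal_def)
  qed
qed

instantiation L2 :: ab_group_add
begin

lift_definition zero_L2 :: L2 is "\<lambda>x. 0"
  by (simp add: ae_equal_def sq_integrable_zero)

lift_definition plus_L2 :: "L2 \<Rightarrow> L2 \<Rightarrow> L2" is "\<lambda>f g x. f x + g x"
  by (auto simp: ae_equal_def intro: sq_integrable_add)

lift_definition uminus_L2 :: "L2 \<Rightarrow> L2" is "\<lambda>f x. - f x"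
  by (auto simp: ae_equal_def intro: sq_integrable_uminus)

definition minus_L2 :: "L2 \<Rightarrow> L2 \<Rightarrow> L2" where
  "minus_L2 u v = u + (- v)"

instance
proof
  fix a b c :: L2
  show "a + b + c = a + (b + c)"
    by transfer (auto simp: ae_equal_def add.assoc intro!: sq_integrable_add)
  show "a + b = b + a"
    by transfer (auto simp: ae_equal_def add.commute intro!: sq_integrable_add)
  show "0 + a = a"
    by transfer (auto simp: ae_equal_def)
  show "- a + a = 0"
    by transfer (auto simp: ae_equal_def sq_integrable_zero)
  show "a - b = a + - b"
    by (simp add: minus_L2_def)
qed

end

lift_definition scale_L2 :: "complex \<Rightarrow> L2 \<Rightarrow> L2" is "\<lambda>c f x. c * f x"
  by (auto simp: ae_equal_def intro: sq_integrable_scale)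


section \<open>Dimension and negative index\<close>

text \<open>
  The constant \<^const>\<open>vector_space.dim\<close> is a natural number and takes the junk value 0 on
  infinite-dimensional subspaces, hence the extended version.
\<close>

context vector_space
begin

definition edim :: "'b set \<Rightarrow> enat" where
  "edim L = (if \<exists>B. finite B \<and> L \<subseteq> local.span B then enat (local.dim L) else \<infinity>)"

text \<open>
  \<open>neg_index D q\<close> is \<open>N\<^sub>-\<close> of the Hermitian form with domain \<open>D\<close> and quadratic form \<open>q\<close>;
  the values of \<open>q\<close> outside \<open>D\<close> are irrelevant.
\<close>

definition neg_index :: "'b set \<Rightarrow> ('b \<Rightarrow> real) \<Rightarrow> enat" where
  "neg_index D q = (SUP L \<in> {L. local.subspace L \<and> L \<subseteq> D \<and> (\<forall>u \<in> L - {0}. q u < 0)}. local.edim L)"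

end

global_interpretation L2: vector_space scale_L2
proof
  fix a b :: complex and x y :: L2
  show "scale_L2 a (x + y) = scale_L2 a x + scale_L2 a y"
    by transfer
      (auto simp: ae_equal_def distrib_left intro!: sq_integrable_add sq_integrable_scale)
  show "scale_L2 (a + b) x = scale_L2 a x + scale_L2 b x"
    by transfer
      (auto simp: ae_equal_def distrib_right intro!: sq_integrable_add sq_integrable_scale)
  show "scale_L2 a (scale_L2 b x) = scale_L2 (a * b) x"
    by transfer (auto simp: ae_equal_def mult.assoc intro!: sq_integrable_scale)
  show "scale_L2 1 x = x"
    by transfer (auto simp: ae_equal_def)
qed


section \<open>Weak derivatives and the Sobolev space\<close>

definition partial_deriv :: "2 \<Rightarrow> (real^2 \<Rightarrow> real) \<Rightarrow> real^2 \<Rightarrow> real" where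
  "partial_deriv i \<phi> x = frechet_derivative \<phi> (at x) (axis i 1)"

primrec C_k :: "nat \<Rightarrow> (real^2 \<Rightarrow> real) \<Rightarrow> bool" where
  "C_k 0 \<phi> \<longleftrightarrow> continuous_on UNIV \<phi>"
| "C_k (Suc k) \<phi> \<longleftrightarrow> \<phi> differentiable_on UNIV \<and> (\<forall>i. C_k k (partial_deriv i \<phi>))"

definition test_function :: "(real^2 \<Rightarrow> real) \<Rightarrow> bool" where
  "test_function \<phi> \<longleftrightarrow> (\<forall>k. C_k k \<phi>) \<and> compact (closure {x. \<phi> x \<noteq> 0})"

text \<open>
  An element of \<^typ>\<open>L2\<close> is a class of functions; \<^const>\<open>rep_L2\<close> picks a representative.
  It occurs below only inside Lebesgue integrals and integrability conditions, which do not depend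
  on the choice.
\<close>

definition weak_deriv :: "2 \<Rightarrow> L2 \<Rightarrow> L2 \<Rightarrow> bool" where
  "weak_deriv i u g \<longleftrightarrow> (\<forall>\<phi>. test_function \<phi> \<longrightarrow>
     (\<integral>x. complex_of_real (partial_deriv i \<phi> x) * rep_L2 u x \<partial>lebesgue) =
     - (\<integral>x. complex_of_real (\<phi> x) * rep_L2 g x \<partial>lebesgue))"

definition W12 :: "L2 set" where
  "W12 = {u. \<forall>i. \<exists>g. weak_deriv i u g}"

text \<open>The weak derivative is unique as an element of \<^typ>\<open>L2\<close>, which justifies \<open>THE\<close>.\<close>

definition weak_partial :: "2 \<Rightarrow> L2 \<Rightarrow> L2" where
  "weak_partial i u = (THE g. weak_deriv i u g)"


section \<open>The energy form of a two-dimensional Schroedinger operator\<close>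

definition energy :: "(real^2 \<Rightarrow> real) \<Rightarrow> L2 \<Rightarrow> real" where
  "energy V w =
     (\<integral>x. (\<Sum>i\<in>UNIV. (cmod (rep_L2 (weak_partial i w) x))\<^sup>2) \<partial>lebesgue)
     - (\<integral>x. V x * (cmod (rep_L2 w x))\<^sup>2 \<partial>lebesgue)"

definition energy_dom :: "(real^2 \<Rightarrow> real) \<Rightarrow> L2 set" where
  "energy_dom V = W12 \<inter> {w. integrable lebesgue (\<lambda>x. V x * (cmod (rep_L2 w x))\<^sup>2)}"

definition N_minus :: "(real^2 \<Rightarrow> real) \<Rightarrow> enat" where
  "N_minus V = L2.neg_index (energy_dom V) (energy V)"

text \<open>
  Differences of values of \<^const>\<open>N_minus\<close> are taken in \<^typ>\<open>enat\<close>, where \<open>\<infinity> - n = \<infinity>\<close> for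
  every \<open>n\<close> (also \<open>n = \<infinity>\<close>) and subtraction is otherwise truncated at 0. Hence a difference that
  is positive and finite is a genuine difference of two finite values.
\<close>

lemma positive_finite_enat_diff:
  fixes a b :: enat
  assumes "0 < a - b" "a - b < \<infinity>"
  shows "a < \<infinity>" "b < a"
  using assms by (cases a; cases b; simp add: zero_enat_def)+

end

theory Submission
  imports Defs "HOL-Real_Asymp.Real_Asymp"
begin

text \<open>
  The potential is a sum \<open>V = (\<Sum>j. gam j * ring_weight (R j))\<close> of bumps of mass one, spread over
  the rings \<open>R j \<le> norm x \<le> 2 * R j\<close> whose radii grow extremely fast. In the variable \<open>ln (norm x)\<close>
  the lowest angular mode sees a sequence of point wells at huge mutual distances, and the
  \<open>j\<close>-th well becomes critical when the coupling \<open>\<alpha>\<close> satisfies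
  \<open>\<alpha> * gam j * ln (2 * R j / q j) = 2 * pi\<close>, up to an error as small as one likes, where \<open>q j\<close> is a
  radius that separates the \<open>j\<close>-th ring from the previous ones. Hence for any prescribed windows
  \<open>a j < b j\<close> the sizes \<open>gam j\<close> can be chosen such that well \<open>j\<close> contributes exactly one
  negative direction if \<open>b j \<le> \<alpha>\<close> and none if \<open>\<alpha> \<le> a j\<close>, and all three claims
  reduce to a choice of windows.

  Lower bounds for the index come from logarithmic tents with disjoint supports. For upper bounds, let
  the ring means of \<open>w\<close> vanish at all wells with \<open>a j < \<alpha>\<close>. The difference of two ring means is
  the integral of \<open>\<nabla>w\<close> against an explicit radial test field, which bounds it by the Dirichlet
  energy with the sharp constant, and the deviation from the mean on a ring costs only a fixed
  multiple of the energy by a Poincare inequality, which is negligible as \<open>gam j\<close> is tiny.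
\<close>

section \<open>Smooth functions on the line and on the plane\<close>

text \<open>The plane is the borderline case: a logarithmic rise from radius \<open>q\<close> to
  radius \<open>R\<close> costs about \<open>2 * pi / ln (R / q)\<close>. Falling back to 0 across a
  very long outer annulus is therefore almost free, and only the rise from \<open>q j\<close> fixes
  the threshold of well \<open>j\<close>. For the same reason the Dirichlet energy controls a
  function only once its value is fixed somewhere. This is the role of well 0: upper bounds are
  claimed for couplings above \<open>a 0\<close>, where the mean over ring 0 is required to vanish,
  and the mean over any inactive ring is compared with that one. The path from ring 0 is cut at
  \<open>q j\<close>: beyond it lies the sharp cost, before it a loss proportional to
  \<open>ln (q j)\<close>, negligible because \<open>R j\<close> is chosen after \<open>q j\<close>.
  Infinitely many inactive wells share one energy. Each is charged to its own annulus between
  \<open>q j\<close> and \<open>q (Suc j)\<close>, with losses so small that a positive fraction of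
  the energy inside every \<open>q n\<close> survives. The width of the windows leaves room for all
  errors; nothing is claimed about whether a well is active while the coupling lies inside its
  window.\<close>

primrec smooth_upto :: "nat \<Rightarrow> (real \<Rightarrow> real) \<Rightarrow> bool" where
  "smooth_upto 0 h \<longleftrightarrow> continuous_on UNIV h"
| "smooth_upto (Suc k) h \<longleftrightarrow> (\<exists>h'. (\<forall>x. (h has_real_derivative h' x) (at x)) \<and> smooth_upto k h')"

lemma smooth_uptoI:
  assumes "\<And>x. (h has_real_derivative h' x) (at x)" "smooth_upto k h'"
  shows "smooth_upto (Suc k) h"
  using assms by auto

lemma smooth_upto_Suc_imp: "smooth_upto (Suc k) h \<Longrightarrow> smooth_upto k h"
proof (induction k arbitrary: h)
  case 0
  then show ?case
    by (auto intro!: continuous_at_imp_continuous_on intro: DERIV_isCont)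
next
  case (Suc k)
  from Suc.prems obtain h' where "\<And>x. (h has_real_derivative h' x) (at x)" "smooth_upto (Suc k) h'"
    by auto
  with Suc.IH[of h'] show ?case by auto
qed

lemma smooth_upto_const: "smooth_upto k (\<lambda>x. c)"
  by (induction k arbitrary: c) (auto intro!: exI[of _ "\<lambda>x. 0"])

lemma smooth_upto_add:
  "smooth_upto k f \<Longrightarrow> smooth_upto k g \<Longrightarrow> smooth_upto k (\<lambda>x. f x + g x)"
proof (induction k arbitrary: f g)
  case 0
  then show ?case by (auto intro: continuous_on_add)
next
  case (Suc k)
  from Suc.prems obtain f' g' where
    "\<And>x. (f has_real_derivative f' x) (at x)" "smooth_upto k f'"
    "\<And>x. (g has_real_derivative g' x) (at x)" "smooth_upto k g'" by auto
  then show ?case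
    by (intro smooth_uptoI[where h'="\<lambda>x. f' x + g' x"] Suc.IH) (auto intro!: DERIV_add)
qed

lemma smooth_upto_mult:
  "smooth_upto k f \<Longrightarrow> smooth_upto k g \<Longrightarrow> smooth_upto k (\<lambda>x. f x * g x)"
proof (induction k arbitrary: f g)
  case 0
  then show ?case by (auto intro: continuous_on_mult)
next
  case (Suc k)
  from Suc.prems obtain f' g' where d:
    "\<And>x. (f has_real_derivative f' x) (at x)" "smooth_upto k f'"
    "\<And>x. (g has_real_derivative g' x) (at x)" "smooth_upto k g'" by auto
  have "smooth_upto k f" "smooth_upto k g"
    using Suc.prems smooth_upto_Suc_imp by blast+
  with d show ?case
    by (intro smooth_uptoI[where h'="\<lambda>x. f' x * g x + g' x * f x"] smooth_upto_add Suc.IH)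
      (auto intro!: DERIV_mult)
qed

lemma smooth_upto_affine: "smooth_upto k h \<Longrightarrow> smooth_upto k (\<lambda>x. h (a * x + b))"
proof (induction k arbitrary: h)
  case 0
  then show ?case
    by (auto intro!: continuous_intros elim!: continuous_on_compose2)
next
  case (Suc k)
  from Suc.prems obtain h' where d: "\<And>x. (h has_real_derivative h' x) (at x)" "smooth_upto k h'"
    by auto
  have "((\<lambda>x. h (a * x + b)) has_real_derivative a * h' (a * x + b)) (at x)" for x
  proof -
    have "((\<lambda>x. a * x + b) has_real_derivative a) (at x)"
      by (auto intro!: derivative_eq_intros)
    from DERIV_chain2[where f=h and g="\<lambda>x. a * x + b", OF d(1) this] show ?thesis
      by (simp add: mult.commute)
  qed
  with d(2) show ?case
    by (intro smooth_uptoI[where h'="\<lambda>x. a * h' (a * x + b)"] smooth_upto_mult smooth_upto_const Suc.IH) auto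
qed

lemma has_derivative_zero_below:
  fixes f :: "real \<Rightarrow> real"
  assumes "x < a" "\<And>y. y < a \<Longrightarrow> f y = 0"
  shows "(f has_real_derivative 0) (at x)"
  by (rule has_field_derivative_transform_within_open[of "\<lambda>_. 0" 0 x "{..<a}"]) (use assms in auto)

lemma inverse_power_has_derivative:
  fixes x :: real
  assumes "x \<noteq> 0"
  shows "((\<lambda>x. 1 / x ^ m) has_real_derivative - real m / x ^ Suc m) (at x)"
proof (cases m)
  case (Suc n)
  have "((\<lambda>x. inverse (x ^ m)) has_real_derivative
      - (inverse (x ^ m) * (real m * x ^ (m - Suc 0)) * inverse (x ^ m))) (at x)"
    using assms by (intro DERIV_inverse' DERIV_pow) auto
  moreover have "- (inverse (x ^ m) * (real m * x ^ (m - Suc 0)) * inverse (x ^ m)) = - real m / x ^ Suc m"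
    using assms by (simp add: Suc field_simps)
  ultimately show ?thesis by (simp add: inverse_eq_divide)
qed auto

text \<open>Since \<open>f\<close> vanishes below \<open>a > 0\<close>, the singularity at 0 is
  never met and the default value of division by 0 is harmless. The derivative is a combination of
  two quotients of the same shape, one with \<open>f'\<close> over \<open>x ^ m\<close> and one with
  \<open>f\<close> over \<open>x ^ Suc m\<close>, so the induction on \<open>k\<close> has to run
  over all \<open>f\<close> and \<open>m\<close>.\<close>

lemma smooth_upto_div_power:
  assumes "\<And>k. smooth_upto k f" "0 < a" "\<And>x. x < a \<Longrightarrow> f x = 0"
  shows "smooth_upto k (\<lambda>x. f x / x ^ m)"
  using assms(1,3)
proof (induction k arbitrary: f m)
  case 0
  have "isCont (\<lambda>x. f x / x ^ m) x" for x
  proof (cases "x < a")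
    case True
    then have "((\<lambda>x. f x / x ^ m) has_real_derivative 0) (at x)"
      by (rule has_derivative_zero_below) (simp add: 0)
    then show ?thesis by (rule DERIV_isCont)
  next
    case False
    have "isCont f x"
      using 0(1)[of 0] by (auto simp: continuous_on_eq_continuous_at)
    with False show ?thesis using assms(2) by (intro continuous_intros) auto
  qed
  then show ?case by (auto intro: continuous_at_imp_continuous_on)
next
  case (Suc k)
  \<comment> \<open>\<open>smooth_upto\<close> provides a derivative for each order separately; by
    uniqueness they all coincide with this one.\<close>
  define f' where "f' x = deriv f x" for x
  have d: "(f has_real_derivative f' x) (at x)" for x
    using Suc.prems(1)[of "Suc 0"] unfolding f'_def smooth_upto.simps by (metis DERIV_imp_deriv)
  have s: "smooth_upto n f'" for n
  proof -
    obtain g where g: "\<And>x. (f has_real_derivative g x) (at x)" "smooth_upto n g"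
      using Suc.prems(1)[of "Suc n"] by auto
    have "g = f'" using g d DERIV_unique by blast
    then show ?thesis using g by simp
  qed
  have z: "f' x = 0" if "x < a" for x
  proof -
    have "(f has_real_derivative 0) (at x)"
      by (rule has_derivative_zero_below[OF that Suc.prems(2)])
    then show ?thesis using d DERIV_unique by blast
  qed
  have "((\<lambda>x. f x / x ^ m) has_real_derivative f' x / x ^ m + (- real m) * (f x / x ^ Suc m)) (at x)" for x
  proof (cases "x < a")
    case True
    then have "((\<lambda>x. f x / x ^ m) has_real_derivative 0) (at x)"
      by (rule has_derivative_zero_below) (simp add: Suc.prems)
    then show ?thesis using True z Suc.prems by simp
  next
    case False
    then have "x \<noteq> 0" using assms(2) by auto
    from DERIV_mult[OF d inverse_power_has_derivative[OF this]] show ?thesis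
      by (simp add: algebra_simps)
  qed
  moreover have "smooth_upto k (\<lambda>x. f' x / x ^ m + (- real m) * (f x / x ^ Suc m))"
    by (intro smooth_upto_add smooth_upto_mult smooth_upto_const Suc.IH s z Suc.prems)
  ultimately show ?case by (rule smooth_uptoI)
qed

section \<open>The flat function \<open>exp (- 1 / s)\<close> and a smooth step\<close>

definition flat :: "nat \<Rightarrow> real \<Rightarrow> real" where
  "flat m s = (if s \<le> 0 then 0 else exp (- 1 / s) / s ^ m)"

lemma flat_tendsto_0: "(flat m \<longlongrightarrow> 0) (at 0)"
proof -
  have "((\<lambda>x::real. x ^ m / exp x) \<longlongrightarrow> 0) at_top"
    by (rule tendsto_power_div_exp_0)
  then have "((\<lambda>s::real. inverse s ^ m / exp (inverse s)) \<longlongrightarrow> 0) (at_right 0)"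
    by (rule filterlim_compose[OF _ filterlim_inverse_at_top_right])
  then have "(flat m \<longlongrightarrow> 0) (at_right 0)"
    by (rule Lim_transform_eventually)
      (auto simp: flat_def eventually_at_filter exp_minus divide_inverse power_inverse mult.commute)
  moreover have "(flat m \<longlongrightarrow> 0) (at_left 0)"
    by (rule Lim_transform_eventually[of "\<lambda>_. 0"]) (auto simp: flat_def eventually_at_filter)
  ultimately show ?thesis
    by (simp add: filterlim_split_at)
qed

text \<open>The powers in the denominator are carried along because this formula closes the family
  under differentiation; all \<open>flat m\<close> then become smooth by one induction.\<close>

lemma flat_has_derivative:
  "(flat m has_real_derivative flat (m + 2) s + - real m * flat (Suc m) s) (at s)"
proof -
  consider "s < 0" | "s = 0" | "s > 0" by linarith
  then show ?thesis
  proof cases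
    case 1
    then have "(flat m has_real_derivative 0) (at s)"
      by (rule has_derivative_zero_below) (simp add: flat_def)
    then show ?thesis using 1 by (simp add: flat_def)
  next
    case 2
    \<comment> \<open>Dividing \<open>flat m\<close> by its argument gives
      \<open>flat (Suc m)\<close>, so the limit of the difference quotient at 0 is already
      known.\<close>
    have "((\<lambda>h. (flat m (0 + h) - flat m 0) / h) \<longlongrightarrow> 0) (at 0)"
      by (rule Lim_transform_eventually[OF flat_tendsto_0[of "Suc m"]])
        (auto simp: flat_def eventually_at_filter field_simps)
    then show ?thesis using 2 by (simp add: DERIV_def) (simp add: flat_def)
  next
    case 3
    then have "eventually (\<lambda>y. y > 0) (nhds s)"
      by (intro eventually_nhds_in_open[of "{0<..}", simplified]) auto
    then have ev: "eventually (\<lambda>y. flat m y = exp (- 1 / y) / y ^ m) (nhds s)"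
      by eventually_elim (auto simp: flat_def)
    have "((\<lambda>y. exp (- 1 / y) / y ^ m) has_real_derivative
        exp (- 1 / s) / s ^ (m + 2) + - real m * (exp (- 1 / s) / s ^ Suc m)) (at s)"
    proof -
      have "((\<lambda>y. exp (- 1 / y)) has_real_derivative exp (- 1 / s) * (1 / s\<^sup>2)) (at s)"
        using 3 by (auto intro!: derivative_eq_intros simp: power2_eq_square)
      from DERIV_mult[OF this inverse_power_has_derivative[of s m]] 3 show ?thesis
        by (simp add: algebra_simps power_add power2_eq_square)
    qed
    then show ?thesis using 3 by (subst DERIV_cong_ev[OF refl ev refl]) (simp add: flat_def)
  qed
qed

lemma smooth_upto_flat: "smooth_upto k (flat m)"
proof (induction k arbitrary: m)
  case 0
  then show ?case
    using flat_has_derivative by (auto intro!: continuous_at_imp_continuous_on intro: DERIV_isCont)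
next
  case (Suc k)
  show ?case
    by (intro smooth_uptoI[OF flat_has_derivative] smooth_upto_add smooth_upto_mult smooth_upto_const Suc)
qed

lemma antiderivative_exists:
  fixes h :: "real \<Rightarrow> real"
  assumes "continuous_on UNIV h" and a: "0 < a" and zero: "\<And>s. s \<le> a \<Longrightarrow> h s = 0"
  obtains E where "\<And>s. (E has_real_derivative h s) (at s)" "\<And>s. s \<le> a \<Longrightarrow> E s = 0"
proof
  \<comment> \<open>For \<open>s < 0\<close> the interval is empty and the integral is 0, which is
    the correct value because \<open>h\<close> vanishes up to \<open>a > 0\<close>.\<close>
  define E where "E s = integral {0..s} h" for s
  show E0: "E s = 0" if "s \<le> a" for s
  proof -
    have "E s = integral {0..s} (\<lambda>_. 0)"
      unfolding E_def by (intro integral_cong) (use that zero in auto)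
    then show ?thesis by simp
  qed
  show "(E has_real_derivative h s) (at s)" for s
  proof (cases "s < a")
    case True
    then have "(E has_real_derivative 0) (at s)"
      by (rule has_derivative_zero_below) (simp add: E0)
    then show ?thesis using True zero by simp
  next
    case False
    have "((\<lambda>u. integral {0..u} h) has_real_derivative h s) (at s within {0..s+1})"
      using False a by (intro integral_has_real_derivative continuous_on_subset[OF assms(1)]) auto
    moreover have "at s within {0..s+1} = at s"
      using False a by (intro at_within_interior) (auto simp: interior_atLeastAtMost_real)
    ultimately show ?thesis by (simp add: E_def[abs_def])
  qed
qed

text \<open>The transition runs over [1, 4] because the argument will be the squared norm divided by
  \<open>R\<^sup>2\<close>: the derivative then lives on the ring of radii between \<open>R\<close>
  and \<open>2 * R\<close>. The step is the normalised primitive of a product of two flat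
  functions.\<close>

lemma smooth_step_exists:
  "\<exists>\<sigma> \<eta>. (\<forall>k. smooth_upto k \<sigma>) \<and> (\<forall>k. smooth_upto k \<eta>) \<and>
     (\<forall>s. (\<sigma> has_real_derivative \<eta> s) (at s)) \<and> (\<forall>s. 0 \<le> \<eta> s) \<and>
     (\<forall>s. s \<le> 1 \<or> 4 \<le> s \<longrightarrow> \<eta> s = 0) \<and> (\<forall>s\<le>1. \<sigma> s = 0) \<and> (\<forall>s\<ge>4. \<sigma> s = 1)"
proof -
  define e where "e s = flat 0 (1 * s + (-1)) * flat 0 ((-1) * s + 4)" for s
  have e_smooth: "smooth_upto k e" for k
    unfolding e_def by (intro smooth_upto_mult smooth_upto_affine smooth_upto_flat)
  have e_nonneg: "0 \<le> e s" for s by (simp add: e_def flat_def)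
  have e_zero: "e s = 0" if "s \<le> 1 \<or> 4 \<le> s" for s using that by (auto simp: e_def flat_def)
  have e_pos: "0 < e 2" by (simp add: e_def flat_def)
  have e_cont: "continuous_on A e" for A
    using e_smooth[of 0] continuous_on_subset by auto
  obtain E where E_deriv: "\<And>s. (E has_real_derivative e s) (at s)" and E0: "\<And>s. s \<le> 1 \<Longrightarrow> E s = 0"
    using antiderivative_exists[OF e_cont, of 1] e_zero by auto
  have E4: "E s = E 4" if "4 \<le> s" for s
  proof (cases "s = 4")
    case False
    then have "4 < s" using that by simp
    then have "\<exists>z. 4 < z \<and> z < s \<and> E s - E 4 = (s - 4) * e z"
      by (intro MVT2 E_deriv)
    then show ?thesis using e_zero by auto
  qed auto
  \<comment> \<open>Otherwise the monotone \<open>E\<close> would be constant between 1 and 4,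
    against its positive derivative at 2.\<close>
  have "E 4 > 0"
  proof (rule ccontr)
    assume "\<not> E 4 > 0"
    have mono: "E x \<le> E y" if "x \<le> y" for x y
      using that by (intro DERIV_nonneg_imp_nondecreasing[of x y E]) (auto intro: E_deriv e_nonneg)
    have "E y = 0" if "1 \<le> y" "y \<le> 4" for y
      using mono[of 1 y] mono[of y 4] E0[of 1] that \<open>\<not> E 4 > 0\<close> by auto
    then have "eventually (\<lambda>y. E y = 0) (nhds 2)"
      using eventually_nhds_in_open[of "{1<..<4}" "2::real"] by (auto elim!: eventually_mono)
    then have "(E has_real_derivative 0) (at 2)"
      by (subst DERIV_cong_ev[OF refl _ refl, of _ "\<lambda>_. 0"]) auto
    then have "e 2 = 0" using E_deriv DERIV_unique by blast
    then show False using e_pos by simp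
  qed
  define \<sigma> where "\<sigma> s = inverse (E 4) * E s" for s
  define \<eta> where "\<eta> s = inverse (E 4) * e s" for s
  have d: "(\<sigma> has_real_derivative \<eta> s) (at s)" for s
    unfolding \<sigma>_def \<eta>_def by (intro DERIV_cmult E_deriv)
  have "smooth_upto k \<eta>" for k
    unfolding \<eta>_def by (intro smooth_upto_mult smooth_upto_const e_smooth)
  moreover from this have "smooth_upto k \<sigma>" for k
    by (rule smooth_upto_Suc_imp[OF smooth_uptoI[OF d]])
  moreover have "0 \<le> \<eta> s" "s \<le> 1 \<or> 4 \<le> s \<Longrightarrow> \<eta> s = 0" for s
    using e_nonneg e_zero \<open>E 4 > 0\<close> by (simp_all add: \<eta>_def)
  moreover have "s \<le> 1 \<Longrightarrow> \<sigma> s = 0" "4 \<le> s \<Longrightarrow> \<sigma> s = 1" for s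
    using E0[of s] E4[of s] \<open>E 4 > 0\<close> by (simp_all add: \<sigma>_def)
  ultimately show ?thesis
    using d by blast
qed

section \<open>Differentiability classes on the plane\<close>

lemma C_k_Suc_imp: "C_k (Suc k) \<phi> \<Longrightarrow> C_k k \<phi>"
  by (induction k arbitrary: \<phi>) (auto intro: differentiable_imp_continuous_on)

lemma partial_deriv_eq: "(\<phi> has_derivative D) (at x) \<Longrightarrow> partial_deriv i \<phi> x = D (axis i 1)"
  unfolding partial_deriv_def by (metis frechet_derivative_at)

lemma C_k_SucI:
  assumes "\<And>x. (\<phi> has_derivative D x) (at x)" "\<And>i. C_k k (\<lambda>x. D x (axis i 1))"
  shows "C_k (Suc k) \<phi>"
proof -
  have "partial_deriv i \<phi> = (\<lambda>x. D x (axis i 1))" for i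
    using assms(1) by (auto intro: partial_deriv_eq)
  with assms show ?thesis
    by (auto simp: differentiable_on_def intro: differentiableI differentiable_at_withinI)
qed

lemma C_k_Suc_has_derivative:
  "C_k (Suc k) \<phi> \<Longrightarrow> (\<phi> has_derivative frechet_derivative \<phi> (at x)) (at x)"
  by (auto simp: differentiable_on_def frechet_derivative_works)

lemma C_k_const: "C_k k (\<lambda>x. c)"
proof (induction k arbitrary: c)
  case (Suc k)
  then show ?case by (intro C_k_SucI[where D="\<lambda>x h. 0"]) auto
qed auto

lemma C_k_component: "C_k k (\<lambda>x. x $ j)"
proof (cases k)
  case 0
  then show ?thesis by (auto intro: continuous_intros)
next
  case (Suc n)
  show ?thesis unfolding Suc
    by (rule C_k_SucI[where D="\<lambda>x h. h $ j"])
      (auto intro!: bounded_linear_imp_has_derivative bounded_linear_vec_nth C_k_const)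
qed

lemma C_k_add: "C_k k f \<Longrightarrow> C_k k g \<Longrightarrow> C_k k (\<lambda>x. f x + g x)"
proof (induction k arbitrary: f g)
  case 0
  then show ?case by (auto intro: continuous_on_add)
next
  case (Suc k)
  show ?case
    by (rule C_k_SucI[OF has_derivative_add[OF C_k_Suc_has_derivative[OF Suc.prems(1)]
            C_k_Suc_has_derivative[OF Suc.prems(2)]]])
      (use Suc in \<open>auto simp: partial_deriv_def[abs_def]\<close>)
qed

lemma C_k_mult: "C_k k f \<Longrightarrow> C_k k g \<Longrightarrow> C_k k (\<lambda>x. f x * g x)"
proof (induction k arbitrary: f g)
  case 0
  then show ?case by (auto intro: continuous_on_mult)
next
  case (Suc k)
  have *: "C_k k f" "C_k k g" using Suc.prems by (auto intro: C_k_Suc_imp simp del: C_k.simps)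
  show ?case
    by (rule C_k_SucI[OF has_derivative_mult[OF C_k_Suc_has_derivative[OF Suc.prems(1)]
            C_k_Suc_has_derivative[OF Suc.prems(2)]]])
      (use Suc * in \<open>auto simp: partial_deriv_def[abs_def] intro!: C_k_add Suc.IH\<close>)
qed

lemma C_k_compose: "smooth_upto k h \<Longrightarrow> C_k k f \<Longrightarrow> C_k k (\<lambda>x. h (f x))"
proof (induction k arbitrary: h f)
  case 0
  then show ?case by (auto elim: continuous_on_compose2)
next
  case (Suc k)
  from Suc.prems obtain h' where d: "\<And>x. (h has_real_derivative h' x) (at x)" "smooth_upto k h'"
    by auto
  have *: "C_k k f" using Suc.prems by (auto intro: C_k_Suc_imp simp del: C_k.simps)
  have D: "((\<lambda>x. h (f x)) has_derivative (\<lambda>v. h' (f x) * frechet_derivative f (at x) v)) (at x)" for x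
    by (rule has_derivative_compose[OF C_k_Suc_has_derivative[OF Suc.prems(2)]
            d(1)[unfolded has_field_derivative_def]])
  have "C_k k (\<lambda>x. partial_deriv i f x)" for i using Suc.prems by auto
  then have "C_k k (\<lambda>x. h' (f x) * frechet_derivative f (at x) (axis i 1))" for i
    using C_k_mult[OF Suc.IH[OF d(2) *]] by (simp add: partial_deriv_def[abs_def])
  then show ?case by (rule C_k_SucI[OF D])
qed

section \<open>Test functions and the fundamental lemma\<close>

definition smooth_step :: "real \<Rightarrow> real" where
  "smooth_step = (SOME \<sigma>. \<exists>\<eta>. (\<forall>k. smooth_upto k \<sigma>) \<and> (\<forall>k. smooth_upto k \<eta>) \<and>
     (\<forall>s. (\<sigma> has_real_derivative \<eta> s) (at s)) \<and> (\<forall>s. 0 \<le> \<eta> s) \<and>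
     (\<forall>s. s \<le> 1 \<or> 4 \<le> s \<longrightarrow> \<eta> s = 0) \<and> (\<forall>s\<le>1. \<sigma> s = 0) \<and> (\<forall>s\<ge>4. \<sigma> s = 1))"

definition smooth_bump :: "real \<Rightarrow> real" where
  "smooth_bump = deriv smooth_step"

lemma smooth_step:
  shows smooth_upto_step: "smooth_upto k smooth_step"
    and smooth_upto_bump: "smooth_upto k smooth_bump"
    and smooth_step_has_derivative: "(smooth_step has_real_derivative smooth_bump s) (at s)"
    and smooth_bump_nonneg: "0 \<le> smooth_bump s"
    and smooth_bump_eq_0: "s \<le> 1 \<or> 4 \<le> s \<Longrightarrow> smooth_bump s = 0"
    and smooth_step_eq_0: "s \<le> 1 \<Longrightarrow> smooth_step s = 0"
    and smooth_step_eq_1: "4 \<le> s \<Longrightarrow> smooth_step s = 1"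
proof -
  obtain \<eta> where *: "\<forall>k. smooth_upto k smooth_step" "\<forall>k. smooth_upto k \<eta>"
    "\<forall>s. (smooth_step has_real_derivative \<eta> s) (at s)" "\<forall>s. 0 \<le> \<eta> s"
    "\<forall>s. s \<le> 1 \<or> 4 \<le> s \<longrightarrow> \<eta> s = 0" "\<forall>s\<le>1. smooth_step s = 0" "\<forall>s\<ge>4. smooth_step s = 1"
    using someI_ex[OF smooth_step_exists, folded smooth_step_def] by (elim exE conjE)
  have "smooth_bump = \<eta>"
    using *(3) by (auto simp: smooth_bump_def intro: DERIV_imp_deriv)
  with * show "smooth_upto k smooth_step" "smooth_upto k smooth_bump"
    "(smooth_step has_real_derivative smooth_bump s) (at s)" "0 \<le> smooth_bump s"
    "s \<le> 1 \<or> 4 \<le> s \<Longrightarrow> smooth_bump s = 0" "s \<le> 1 \<Longrightarrow> smooth_step s = 0"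
    "4 \<le> s \<Longrightarrow> smooth_step s = 1"
    by blast+
qed

lemma smooth_step_mono: "x \<le> y \<Longrightarrow> smooth_step x \<le> smooth_step y"
  by (intro DERIV_nonneg_imp_nondecreasing[of x y smooth_step])
    (auto intro: smooth_step_has_derivative smooth_bump_nonneg)

lemma smooth_step_nonneg: "0 \<le> smooth_step s"
  using smooth_step_mono[of "min s 1" s] smooth_step_eq_0[of "min s 1"] by simp

lemma smooth_step_le_1: "smooth_step s \<le> 1"
  using smooth_step_mono[of s "max s 4"] smooth_step_eq_1[of "max s 4"] by simp

section \<open>Translation invariance and basic properties of test functions\<close>

lemma lborel_integral_translate:
  fixes f :: "'a::euclidean_space \<Rightarrow> 'b::{banach, second_countable_topology}"
  assumes [measurable]: "f \<in> borel_measurable borel"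
  shows "(\<integral>x. f (x + h) \<partial>lborel) = (\<integral>x. f x \<partial>lborel)"
proof -
  have "(\<integral>x. f x \<partial>lborel) = (\<integral>x. f x \<partial>distr lborel borel ((+) h))"
    by (simp add: lborel_distr_plus)
  also have "\<dots> = (\<integral>x. f (x + h) \<partial>lborel)"
    by (subst integral_distr) (auto simp: add.commute)
  finally show ?thesis ..
qed

lemma lborel_integrable_translate:
  fixes f :: "'a::euclidean_space \<Rightarrow> 'b::{banach, second_countable_topology}"
  assumes "integrable lborel f"
  shows "integrable lborel (\<lambda>x. f (x + h))"
proof -
  have "integrable (distr lborel borel ((+) h)) f"
    using assms by (simp add: lborel_distr_plus)
  then have "integrable lborel (\<lambda>x. f (h + x))"
    by (subst (asm) integrable_distr_eq) (use assms in auto)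
  then show ?thesis by (simp add: add.commute)
qed

lemma lborel_nn_integral_translate:
  fixes f :: "'a::euclidean_space \<Rightarrow> ennreal"
  assumes [measurable]: "f \<in> borel_measurable borel"
  shows "(\<integral>\<^sup>+x. f (x + h) \<partial>lborel) = (\<integral>\<^sup>+x. f x \<partial>lborel)"
proof -
  have "(\<integral>\<^sup>+x. f x \<partial>lborel) = (\<integral>\<^sup>+x. f x \<partial>distr lborel borel ((+) h))"
    by (simp add: lborel_distr_plus)
  also have "\<dots> = (\<integral>\<^sup>+x. f (x + h) \<partial>lborel)"
    by (subst nn_integral_distr) (auto simp: add.commute)
  finally show ?thesis ..
qed

lemma test_functionI:
  assumes "\<And>k. C_k k \<phi>" "\<And>x. r < norm x \<Longrightarrow> \<phi> x = 0"
  shows "test_function \<phi>"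
proof -
  have "{x. \<phi> x \<noteq> 0} \<subseteq> cball 0 r" using assms(2) by (force simp: dist_norm)
  then show ?thesis
    using assms(1) bounded_subset[OF bounded_cball, of "{x. \<phi> x \<noteq> 0}" 0 r]
    by (auto simp: test_function_def compact_closure)
qed

lemma test_function_support:
  assumes "test_function \<phi>"
  obtains r where "0 < r" "\<And>x. r < norm x \<Longrightarrow> \<phi> x = 0"
proof -
  have "bounded {x. \<phi> x \<noteq> 0}"
    using assms by (auto simp: test_function_def compact_closure)
  then obtain r where "0 < r" "\<forall>x\<in>{x. \<phi> x \<noteq> 0}. norm x \<le> r"
    by (auto simp: bounded_pos)
  then show thesis by (intro that[of r]) force+
qed

lemma test_function_C_k: "test_function \<phi> \<Longrightarrow> C_k k \<phi>"
  by (simp add: test_function_def)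

lemma test_function_continuous: "test_function \<phi> \<Longrightarrow> continuous_on A \<phi>"
  using test_function_C_k[of \<phi> 0] continuous_on_subset by auto

lemma test_function_has_derivative:
  "test_function \<phi> \<Longrightarrow> (\<phi> has_derivative frechet_derivative \<phi> (at x)) (at x)"
  by (metis C_k_Suc_has_derivative test_function_C_k)

lemma test_function_partial_deriv:
  assumes "test_function \<phi>"
  shows "test_function (partial_deriv i \<phi>)"
proof -
  obtain r where r: "\<And>x. r < norm x \<Longrightarrow> \<phi> x = 0"
    using test_function_support[OF assms] by blast
  have "partial_deriv i \<phi> x = 0" if "r < norm x" for x
  proof -
    have "open {y :: real^2. r < norm y}"
      by (intro open_Collect_less continuous_intros)
    then have "(\<phi> has_derivative (\<lambda>_. 0)) (at x)"
      using that r by (intro has_derivative_transform_within_open[OF has_derivative_const]) auto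
    from partial_deriv_eq[OF this] show ?thesis by simp
  qed
  moreover have "C_k k (partial_deriv i \<phi>)" for k
    using test_function_C_k[OF assms, of "Suc k"] by simp
  ultimately show ?thesis by (intro test_functionI) auto
qed

lemma continuous_compact_support_bounded:
  fixes f :: "'a::euclidean_space \<Rightarrow> 'b::real_normed_vector"
  assumes "continuous_on UNIV f" "\<And>x. r < norm x \<Longrightarrow> f x = 0"
  obtains M where "0 < M" "\<And>x. norm (f x) \<le> M"
proof -
  have "compact (f ` cball 0 r)"
    by (intro compact_continuous_image compact_cball continuous_on_subset[OF assms(1)]) auto
  then obtain M where M: "0 < M" "\<And>x. x \<in> cball 0 r \<Longrightarrow> norm (f x) \<le> M"
    by (auto dest!: compact_imp_bounded simp: bounded_pos)
  have "norm (f x) \<le> M" for x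
    using M assms(2)[of x] by (cases "r < norm x") (auto simp: not_less)
  with M(1) show thesis by (rule that)
qed

lemma test_function_translate:
  assumes "test_function \<phi>"
  shows "test_function (\<lambda>x. \<phi> (x + h))" "partial_deriv i (\<lambda>x. \<phi> (x + h)) x = partial_deriv i \<phi> (x + h)"
proof -
  have D: "((\<lambda>x. \<phi> (x + h)) has_derivative D) (at x)"
    if "(\<phi> has_derivative D) (at (x + h))" for D \<phi> and x :: "real^2"
  proof -
    have "((\<lambda>x. x + h) has_derivative (\<lambda>v. v)) (at x)"
      by (auto intro!: derivative_eq_intros)
    from has_derivative_compose[where g=\<phi> and f="\<lambda>x. x + h", OF this that] show ?thesis .
  qed
  have C: "C_k k (\<lambda>x. \<phi> (x + h))" if "C_k k \<phi>" for k \<phi>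
    using that
  proof (induction k arbitrary: \<phi>)
    case 0
    then show ?case by (auto intro!: continuous_intros elim!: continuous_on_compose2)
  next
    case (Suc k)
    show ?case
      by (rule C_k_SucI[OF D[OF C_k_Suc_has_derivative[OF Suc.prems]]])
        (use Suc in \<open>auto simp: partial_deriv_def[abs_def]\<close>)
  qed
  obtain r where r: "\<And>x. r < norm x \<Longrightarrow> \<phi> x = 0"
    using test_function_support[OF assms] by blast
  have "r < norm (x + h)" if "r + norm h < norm x" for x
    using norm_triangle_ineq4[of "x + h" h] that by simp
  with r show "test_function (\<lambda>x. \<phi> (x + h))"
    by (intro test_functionI[of _ "r + norm h"]) (simp_all add: C[OF test_function_C_k[OF assms]])
  show "partial_deriv i (\<lambda>x. \<phi> (x + h)) x = partial_deriv i \<phi> (x + h)"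
    using test_function_has_derivative[OF assms, of "x + h"]
    by (subst partial_deriv_eq[OF D]) (auto simp: partial_deriv_def)
qed

section \<open>Local integrability and the fundamental lemma of the calculus of variations\<close>

definition locally_integrable :: "('a::euclidean_space \<Rightarrow> 'b::{banach, second_countable_topology}) \<Rightarrow> bool" where
  "locally_integrable f \<longleftrightarrow> f \<in> borel_measurable borel \<and>
     (\<forall>r. integrable lborel (\<lambda>x. indicat_real (cball 0 r) x *\<^sub>R f x))"

lemma locally_integrable_measurable [measurable_dest]:
  "locally_integrable f \<Longrightarrow> f \<in> borel_measurable borel"
  by (simp add: locally_integrable_def)

lemma locally_integrable_diff:
  "locally_integrable f \<Longrightarrow> locally_integrable g \<Longrightarrow> locally_integrable (\<lambda>x. f x - g x)"
  by (auto simp: locally_integrable_def scaleR_diff_right)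

lemma locally_integrable_square:
  fixes f :: "'a::euclidean_space \<Rightarrow> 'b::{banach, second_countable_topology}"
  assumes [measurable]: "f \<in> borel_measurable borel" and "integrable lborel (\<lambda>x. (norm (f x))\<^sup>2)"
  shows "locally_integrable f"
  unfolding locally_integrable_def
proof (intro conjI allI assms)
  fix r :: real
  have i: "integrable lborel (\<lambda>x::'a. indicat_real (cball 0 r) x)"
    by (rule integrable_real_indicator) (use emeasure_bounded_finite[OF bounded_cball, of "0::'a" r] in auto)
  have "t \<le> 1 + t\<^sup>2" for t :: real using zero_le_power2[of "t - 1"] by (simp add: power2_diff) (smt (verit) zero_le_power2)
  with i assms show "integrable lborel (\<lambda>x. indicat_real (cball 0 r) x *\<^sub>R f x)"
    by (intro Bochner_Integration.integrable_bound[OF Bochner_Integration.integrable_add[OF i assms(2)]])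
      (auto simp: indicator_def)
qed

lemma integrable_compact_support_times:
  fixes \<phi> :: "'a::euclidean_space \<Rightarrow> real" and f :: "'a \<Rightarrow> complex"
  assumes f: "locally_integrable f" and "continuous_on UNIV \<phi>" "\<And>x. r < norm x \<Longrightarrow> \<phi> x = 0"
  shows "integrable lborel (\<lambda>x. complex_of_real (\<phi> x) * f x)"
proof -
  obtain M where M: "\<And>x. norm (\<phi> x) \<le> M"
    using continuous_compact_support_bounded[OF assms(2,3)] by blast
  have [measurable]: "f \<in> borel_measurable borel" "\<phi> \<in> borel_measurable borel"
    by (rule locally_integrable_measurable[OF f], rule borel_measurable_continuous_onI[OF assms(2)])
  have "integrable lborel (\<lambda>x. M *\<^sub>R (indicat_real (cball 0 r) x *\<^sub>R f x))"
    using f by (auto simp: locally_integrable_def simp del: scaleR_scaleR)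
  then show ?thesis
  proof (rule Bochner_Integration.integrable_bound)
    show "AE x in lborel. norm (complex_of_real (\<phi> x) * f x) \<le> norm (M *\<^sub>R (indicat_real (cball 0 r) x *\<^sub>R f x))"
      using M assms(3) order_trans[OF norm_ge_zero M]
      by (intro AE_I2) (auto simp: norm_mult indicator_def not_le intro!: mult_right_mono)
  qed measurable
qed

lemma integrable_test_function_times:
  assumes "locally_integrable f" "test_function \<phi>"
  shows "integrable lborel (\<lambda>x. complex_of_real (\<phi> x) * f x)"
  using test_function_support[OF assms(2)] assms
  by (metis integrable_compact_support_times test_function_continuous)

text \<open>The indicator of a box is the limit of the test functions \<open>\<psi> n\<close>: a
  product of four steps, one per side, whose transition layers lie inside the box and have width of
  order \<open>1 / n\<close>. The indicator of one ball dominates them all, so the integrals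
  converge.\<close>

lemma integral_box_eq_0:
  assumes f: "locally_integrable f"
    and zero: "\<And>\<psi>. test_function \<psi> \<Longrightarrow> (\<integral>x. complex_of_real (\<psi> x) * f x \<partial>lborel) = 0"
  shows "(\<integral>x. indicat_real (box a b) x *\<^sub>R f x \<partial>lborel) = 0"
proof -
  let ?\<sigma> = smooth_step
  define \<psi> :: "nat \<Rightarrow> real^2 \<Rightarrow> real" where "\<psi> n x =
    ?\<sigma> (real n * x$1 + (- real n * a$1)) * ?\<sigma> ((- real n) * x$1 + real n * b$1) *
    (?\<sigma> (real n * x$2 + (- real n * a$2)) * ?\<sigma> ((- real n) * x$2 + real n * b$2))" for n x
  have pos: "0 < t" if "?\<sigma> (real n * t) \<noteq> 0" for n t
  proof (rule ccontr)
    assume "\<not> 0 < t"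
    then have "real n * t \<le> 0" by (simp add: mult_nonneg_nonpos)
    with smooth_step_eq_0[of "real n * t"] that show False by auto
  qed
  have supp: "x \<in> box a b" if "\<psi> n x \<noteq> 0" for n x
    using that pos[of n "x$1 - a$1"] pos[of n "b$1 - x$1"] pos[of n "x$2 - a$2"] pos[of n "b$2 - x$2"]
    by (auto simp: \<psi>_def mem_box_cart forall_2 algebra_simps)
  obtain r where r: "box a b \<subseteq> cball 0 r"
    using bounded_box[of a b] by (auto simp: bounded_iff subset_eq)
  have C: "C_k k (\<psi> n)" for k n
  proof -
    have "C_k k (\<lambda>x :: real^2. ?\<sigma> (c * x$i + d))" for c d i
      by (rule C_k_compose[OF smooth_upto_affine[OF smooth_upto_step] C_k_component])
    then show ?thesis
      unfolding \<psi>_def by (intro C_k_mult)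
  qed
  have test: "test_function (\<psi> n)" for n
    by (rule test_functionI[OF C, of r]) (use supp r in \<open>force simp: dist_norm\<close>)
  have lim1: "(\<lambda>n. ?\<sigma> (real n * t)) \<longlonglongrightarrow> 1" if "0 < t" for t
  proof (rule tendsto_eventually)
    have "filterlim (\<lambda>n. real n * t) at_top sequentially"
      using that by real_asymp
    then have "eventually (\<lambda>n. 4 \<le> real n * t) sequentially"
      by (simp add: filterlim_at_top)
    then show "eventually (\<lambda>n. ?\<sigma> (real n * t) = 1) sequentially"
      by eventually_elim (use smooth_step_eq_1 in auto)
  qed
  have lim: "(\<lambda>n. \<psi> n x) \<longlonglongrightarrow> indicat_real (box a b) x" for x
  proof (cases "x \<in> box a b")
    case True
    then have "(\<lambda>n. ?\<sigma> (real n * (x$1 - a$1)) * ?\<sigma> (real n * (b$1 - x$1)) *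
        (?\<sigma> (real n * (x$2 - a$2)) * ?\<sigma> (real n * (b$2 - x$2)))) \<longlonglongrightarrow> 1 * 1 * (1 * 1)"
      by (intro tendsto_mult lim1) (auto simp: mem_box_cart)
    with True show ?thesis by (simp add: \<psi>_def algebra_simps)
  next
    case False
    then have "\<psi> n x = 0" for n using supp by blast
    with False show ?thesis by simp
  qed
  have bd: "\<bar>\<psi> n x\<bar> \<le> indicat_real (cball 0 r) x" for n x
  proof (cases "\<psi> n x = 0")
    case False
    then have "x \<in> cball 0 r" using supp r by blast
    moreover have "\<psi> n x \<le> 1 * 1 * (1 * 1)"
      unfolding \<psi>_def by (intro mult_mono mult_nonneg_nonneg smooth_step_nonneg smooth_step_le_1) auto
    moreover have "0 \<le> \<psi> n x"
      unfolding \<psi>_def by (intro mult_nonneg_nonneg smooth_step_nonneg smooth_step_le_1)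
    ultimately show ?thesis by simp
  qed auto
  have [measurable]: "f \<in> borel_measurable borel" using f by measurable
  have [measurable]: "\<psi> n \<in> borel_measurable borel" for n
    by (rule borel_measurable_continuous_onI[OF test_function_continuous[OF test]])
  have "(\<lambda>n. \<integral>x. complex_of_real (\<psi> n x) * f x \<partial>lborel) \<longlonglongrightarrow>
      (\<integral>x. complex_of_real (indicat_real (box a b) x) * f x \<partial>lborel)"
  proof (rule integral_dominated_convergence)
    show "integrable lborel (\<lambda>x. norm (indicat_real (cball 0 r) x *\<^sub>R f x))"
      using f by (intro integrable_norm) (simp add: locally_integrable_def)
    show "AE x in lborel. (\<lambda>n. complex_of_real (\<psi> n x) * f x) \<longlonglongrightarrow> complex_of_real (indicat_real (box a b) x) * f x"
      using lim by (intro AE_I2 tendsto_intros)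
    show "AE x in lborel. norm (complex_of_real (\<psi> n x) * f x) \<le> norm (indicat_real (cball 0 r) x *\<^sub>R f x)" for n
      using bd[of n] by (intro AE_I2) (auto simp: norm_mult intro!: mult_right_mono)
  qed measurable
  moreover have "(\<integral>x. complex_of_real (\<psi> n x) * f x \<partial>lborel) = 0" for n
    by (rule zero[OF test])
  ultimately show ?thesis by (simp add: LIMSEQ_const_iff scaleR_conv_of_real)
qed

text \<open>Boxes form an intersection-stable generator of the Borel sets, so vanishing box
  integrals propagate to all Borel sets by Dynkin's argument. Truncation to a large box makes
  \<open>f\<close> integrable and keeps the base case, as the intersection of two boxes is a
  box.\<close>

lemma fundamental_lemma:
  assumes f: "locally_integrable f"
    and zero: "\<And>\<psi>. test_function \<psi> \<Longrightarrow> (\<integral>x. complex_of_real (\<psi> x) * f x \<partial>lborel) = 0"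
  shows "AE x in lborel. f x = 0"
proof -
  have [measurable]: "f \<in> borel_measurable borel" using f by measurable
  have "AE x in lborel. indicat_real (box (vec (- real n)) (vec (real n))) x *\<^sub>R f x = 0" for n
  proof (rule sigma_finite_measure.density_zero[OF sigma_finite_lborel])
    let ?Q = "box (vec (- real n)) (vec (real n)) :: (real^2) set"
    let ?g = "\<lambda>x. indicat_real ?Q x *\<^sub>R f x"
    obtain r where r: "?Q \<subseteq> cball 0 r"
      using bounded_box by (force simp: bounded_iff subset_eq)
    show g: "integrable lborel ?g"
      by (rule Bochner_Integration.integrable_bound[of _ "\<lambda>x. indicat_real (cball 0 r) x *\<^sub>R f x"])
        (use f r in \<open>force simp: locally_integrable_def indicator_def intro!: AE_I2\<close>)+
    let ?G = "range (\<lambda>(a, b). box a b) :: (real^2) set set"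
    fix A :: "(real^2) set" assume "A \<in> sets lborel"
    then have A: "A \<in> sigma_sets UNIV ?G" by (simp add: borel_eq_box)
    have "Int_stable ?G" by (auto simp: Int_stable_def box_Int_box)
    moreover have "?G \<subseteq> Pow UNIV" by simp
    moreover note A
    ultimately show "set_lebesgue_integral lborel A ?g = 0"
    proof (induction rule: sigma_sets_induct_disjoint)
      case (basic A)
      then obtain a b where "A = box a b" by auto
      moreover obtain c d where "box a b \<inter> ?Q = box c d"
        by (auto simp: box_Int_box)
      ultimately have "set_lebesgue_integral lborel A ?g = (\<integral>x. indicat_real (box c d) x *\<^sub>R f x \<partial>lborel)"
        unfolding set_lebesgue_integral_def
        by (intro Bochner_Integration.integral_cong) (auto simp: indicator_def set_eq_iff split: if_splits)
      then show ?case using integral_box_eq_0[OF f zero] by simp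
    next
      case (compl A)
      have A: "A \<in> sets borel" using compl(1) by (simp add: borel_eq_box)
      have "set_lebesgue_integral lborel (UNIV - A) ?g = (\<integral>x. ?g x - indicat_real A x *\<^sub>R ?g x \<partial>lborel)"
        unfolding set_lebesgue_integral_def
        by (rule Bochner_Integration.integral_cong) (auto simp: indicator_def)
      also have "\<dots> = (\<integral>x. ?g x \<partial>lborel) - set_lebesgue_integral lborel A ?g"
        unfolding set_lebesgue_integral_def
        by (rule Bochner_Integration.integral_diff[OF g integrable_mult_indicator[OF _ g]]) (use A in simp)
      finally have "set_lebesgue_integral lborel (UNIV - A) ?g = (\<integral>x. ?g x \<partial>lborel) - set_lebesgue_integral lborel A ?g" .
      then show ?case using compl integral_box_eq_0[OF f zero] by simp
    next
      case (union A)
      have A: "A i \<in> sets borel" for i using union by (auto simp: borel_eq_box)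
      have "set_integrable lborel (\<Union>i. A i) ?g"
        unfolding set_integrable_def by (rule integrable_mult_indicator[OF _ g]) (use A in auto)
      then have "set_lebesgue_integral lborel (\<Union>i. A i) ?g = (\<Sum>i. set_lebesgue_integral lborel (A i) ?g)"
        using A union by (intro lebesgue_integral_countable_add) (auto simp: disjoint_family_on_def)
      then show ?case using union by simp
    qed (simp add: set_lebesgue_integral_def)
  qed
  then have "AE x in lborel. \<forall>n. indicat_real (box (vec (- real n)) (vec (real n))) x *\<^sub>R f x = 0"
    unfolding AE_all_countable by blast
  then show ?thesis
  proof eventually_elim
    case (elim x)
    obtain n where "norm x < real n" using reals_Archimedean2 by blast
    then have "x \<in> box (vec (- real n)) (vec (real n))"
      using component_le_norm_cart[of x] by (auto simp: mem_box_cart) (smt (verit, best))+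
    with elim[rule_format, of n] show ?case by simp
  qed
qed

section \<open>Weak gradients and translations\<close>

text \<open>\<open>M\<close> is a probability measure. The identity is used twice: without its
  variance term it is Jensen's inequality for the square, and the variance term is what the Poincare
  inequality estimates.\<close>

lemma variance_identity:
  fixes f :: "'a \<Rightarrow> complex"
  assumes M: "emeasure M (space M) = 1" and [measurable]: "f \<in> borel_measurable M"
    and sq: "integrable M (\<lambda>x. (cmod (f x))\<^sup>2)"
  shows "integrable M f"
    and "integrable M (\<lambda>x. (cmod (f x - c))\<^sup>2)"
    and "(\<integral>x. (cmod (f x))\<^sup>2 \<partial>M) = (cmod (\<integral>x. f x \<partial>M))\<^sup>2 + (\<integral>x. (cmod (f x - (\<integral>x. f x \<partial>M)))\<^sup>2 \<partial>M)"
proof -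
  interpret finite_measure M by (rule finite_measureI) (simp add: M)
  have mM: "measure M (space M) = 1" by (simp add: measure_def M)
  have le: "t \<le> 1 + t\<^sup>2" for t :: real
  proof -
    have "2 * t \<le> t\<^sup>2 + 1" using zero_le_power2[of "t - 1"] by (simp add: power2_diff)
    moreover have "0 \<le> t\<^sup>2" by simp
    ultimately show ?thesis by linarith
  qed
  show f: "integrable M f"
    by (rule Bochner_Integration.integrable_bound[of _ "\<lambda>x. 1 + (cmod (f x))\<^sup>2"])
      (use sq le in \<open>auto intro!: AE_I2\<close>)
  have expand: "(cmod (z - c))\<^sup>2 = (cmod z)\<^sup>2 - 2 * Re (cnj c * z) + (cmod c)\<^sup>2" for z c
    unfolding cmod_power2 by (simp add: power2_eq_square algebra_simps)
  have int: "integrable M (\<lambda>x. Re (cnj c * f x))" for c using f by (intro integrable_Re integrable_mult_right) 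
  show "integrable M (\<lambda>x. (cmod (f x - c))\<^sup>2)" for c
    unfolding expand by (intro Bochner_Integration.integrable_add Bochner_Integration.integrable_diff integrable_mult_right sq int integrable_const)
  define m where "m = (\<integral>x. f x \<partial>M)"
  have "(\<integral>x. (cmod (f x - m))\<^sup>2 \<partial>M) = (\<integral>x. (cmod (f x))\<^sup>2 \<partial>M) - 2 * (\<integral>x. Re (cnj m * f x) \<partial>M) + (cmod m)\<^sup>2"
  proof -
    define q where "q x = Re (cnj m * f x)" for x
    have "integrable M q" unfolding q_def by (rule int)
    then show ?thesis unfolding expand q_def[symmetric] using sq by (simp add: mM)
  qed
  also have "(\<integral>x. Re (cnj m * f x) \<partial>M) = Re (cnj m * m)"
    using f by (subst integral_Re) (auto simp: m_def)
  also have "\<dots> = (cmod m)\<^sup>2" by (simp only: cmod_power2) (simp add: power2_eq_square)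
  finally show "(\<integral>x. (cmod (f x))\<^sup>2 \<partial>M) = (cmod (\<integral>x. f x \<partial>M))\<^sup>2 + (\<integral>x. (cmod (f x - (\<integral>x. f x \<partial>M)))\<^sup>2 \<partial>M)"
    by (simp add: m_def)
qed

text \<open>Formulated in \<open>ennreal\<close> so that it applies to slices whose square
  integrability is not known beforehand; if the right side is infinite, there is nothing to
  show.\<close>

lemma norm_integral_square_le:
  fixes f :: "'a \<Rightarrow> complex"
  assumes M: "emeasure M (space M) = 1" and [measurable]: "f \<in> borel_measurable M"
  shows "ennreal ((cmod (\<integral>x. f x \<partial>M))\<^sup>2) \<le> (\<integral>\<^sup>+x. ennreal ((cmod (f x))\<^sup>2) \<partial>M)"
proof (cases "integrable M (\<lambda>x. (cmod (f x))\<^sup>2)")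
  case True
  have "(cmod (\<integral>x. f x \<partial>M))\<^sup>2 \<le> (\<integral>x. (cmod (f x))\<^sup>2 \<partial>M)"
    using variance_identity(3)[OF M assms(2) True] by simp
  then show ?thesis using True by (simp add: nn_integral_eq_integral ennreal_leI)
next
  case False
  then have "(\<integral>\<^sup>+x. ennreal ((cmod (f x))\<^sup>2) \<partial>M) = \<infinity>"
    by (simp add: integrable_iff_bounded less_top[symmetric])
  then show ?thesis by simp
qed

text \<open>For \<open>t\<close> in [0, 1] the shifted support of \<open>\<phi>\<close> stays in the
  ball of radius \<open>r + norm h\<close>. Hence \<open>M\<close> times \<open>cmod (f y)\<close>
  on that ball, the function \<open>F\<close>, is a majorant independent of \<open>t\<close>. A
  translation in \<open>x\<close> carries the first integrand into the second.\<close>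

lemma fubini_shift:
  fixes \<phi> :: "'a::euclidean_space \<Rightarrow> real" and f :: "'a \<Rightarrow> complex"
  assumes f: "locally_integrable f" and [measurable]: "\<phi> \<in> borel_measurable borel"
    and M: "\<And>x. \<bar>\<phi> x\<bar> \<le> M" and r: "\<And>x. r < norm x \<Longrightarrow> \<phi> x = 0"
  shows "integrable (lborel \<Otimes>\<^sub>M lborel) (\<lambda>(t::real, x). indicat_real {0..1} t *\<^sub>R (complex_of_real (\<phi> x) * f (x + t *\<^sub>R h)))"
    and "integrable (lborel \<Otimes>\<^sub>M lborel) (\<lambda>(t::real, x). indicat_real {0..1} t *\<^sub>R (complex_of_real (\<phi> (x - t *\<^sub>R h)) * f x))"
proof -
  let ?k = "\<lambda>(t::real) x. indicat_real {0..1} t *\<^sub>R (complex_of_real (\<phi> (x - t *\<^sub>R h)) * f x)"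
  let ?l = "\<lambda>(t::real) x. indicat_real {0..1} t *\<^sub>R (complex_of_real (\<phi> x) * f (x + t *\<^sub>R h))"
  have [measurable]: "f \<in> borel_measurable borel" using f by measurable
  define F where "F y = ennreal M * (indicator (cball 0 (r + norm h)) y * ennreal (cmod (f y)))" for y
  have [measurable]: "cball (0::'a) (r + norm h) \<in> sets borel" by simp
  have [measurable]: "F \<in> borel_measurable borel" unfolding F_def by measurable
  have "0 \<le> M" using M[of 0] by simp
  have "integrable lborel (\<lambda>x. indicat_real (cball 0 (r + norm h)) x *\<^sub>R f x)"
    using f by (simp add: locally_integrable_def)
  then have "(\<integral>\<^sup>+x. ennreal (cmod (indicat_real (cball 0 (r + norm h)) x *\<^sub>R f x)) \<partial>lborel) < \<infinity>"
    unfolding integrable_iff_bounded by simp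
  also have "(\<lambda>x. ennreal (cmod (indicat_real (cball 0 (r + norm h)) x *\<^sub>R f x))) =
      (\<lambda>x. indicator (cball 0 (r + norm h)) x * ennreal (cmod (f x)))"
    by (auto simp: indicator_def)
  finally have fin: "(\<integral>\<^sup>+y. F y \<partial>lborel) < \<infinity>"
    unfolding F_def by (subst nn_integral_cmult) (measurable, simp add: ennreal_mult_less_top)
  have bound: "ennreal (cmod (complex_of_real (\<phi> (y - t *\<^sub>R h)) * f y)) \<le> F y" if "t \<in> {0..1}" for t y
  proof (cases "norm (y - t *\<^sub>R h) \<le> r")
    case True
    have "norm y \<le> norm (y - t *\<^sub>R h) + norm (t *\<^sub>R h)"
      using norm_triangle_ineq[of "y - t *\<^sub>R h" "t *\<^sub>R h"] by simp
    also have "\<dots> \<le> r + norm h"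
      using True that by (intro add_mono) (auto intro: mult_left_le_one_le)
    finally show ?thesis
      using M[of "y - t *\<^sub>R h"] \<open>0 \<le> M\<close>
      by (auto simp: F_def norm_mult indicator_def simp flip: ennreal_mult intro!: ennreal_leI mult_right_mono)
  next
    case False
    then show ?thesis using r[of "y - t *\<^sub>R h"] by simp
  qed
  have fin2: "(\<integral>\<^sup>+t. indicator {0..1::real} t * (\<integral>\<^sup>+y. F y \<partial>lborel) \<partial>lborel) < \<infinity>"
    using fin by (subst nn_integral_multc) auto
  show "integrable (lborel \<Otimes>\<^sub>M lborel) (\<lambda>(t, x). ?k t x)"
  proof (rule integrableI_bounded)
    have "(\<integral>\<^sup>+p. ennreal (norm (case p of (t, x) \<Rightarrow> ?k t x)) \<partial>(lborel \<Otimes>\<^sub>M lborel))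
      = (\<integral>\<^sup>+t. \<integral>\<^sup>+x. ennreal (norm (?k t x)) \<partial>lborel \<partial>lborel)"
      by (subst lborel.nn_integral_fst[symmetric]) auto
    also have "\<dots> \<le> (\<integral>\<^sup>+t. indicator {0..1::real} t * (\<integral>\<^sup>+y. F y \<partial>lborel) \<partial>lborel)"
    proof (rule nn_integral_mono)
      fix t :: real
      show "(\<integral>\<^sup>+x. ennreal (norm (?k t x)) \<partial>lborel)
          \<le> indicator {0..1} t * (\<integral>\<^sup>+y. F y \<partial>lborel)"
        using bound[of t] by (cases "t \<in> {0..1}") (auto intro!: nn_integral_mono)
    qed
    finally show "(\<integral>\<^sup>+p. ennreal (norm (case p of (t, x) \<Rightarrow> ?k t x)) \<partial>(lborel \<Otimes>\<^sub>M lborel)) < \<infinity>"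
      using fin2 by (rule le_less_trans)
  qed measurable
  show "integrable (lborel \<Otimes>\<^sub>M lborel) (\<lambda>(t, x). ?l t x)"
  proof (rule integrableI_bounded)
    have "(\<integral>\<^sup>+p. ennreal (norm (case p of (t, x) \<Rightarrow> ?l t x)) \<partial>(lborel \<Otimes>\<^sub>M lborel))
      = (\<integral>\<^sup>+t. \<integral>\<^sup>+x. ennreal (norm (?l t x)) \<partial>lborel \<partial>lborel)"
      by (subst lborel.nn_integral_fst[symmetric]) auto
    also have "\<dots> \<le> (\<integral>\<^sup>+t. indicator {0..1::real} t * (\<integral>\<^sup>+y. F y \<partial>lborel) \<partial>lborel)"
    proof (rule nn_integral_mono)
      fix t :: real
      have "(\<integral>\<^sup>+x. ennreal (cmod (complex_of_real (\<phi> x) * f (x + t *\<^sub>R h))) \<partial>lborel) \<le> (\<integral>\<^sup>+y. F (y + t *\<^sub>R h) \<partial>lborel)"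
        if "t \<in> {0..1}"
        using bound[OF that, of "x + t *\<^sub>R h" for x] by (intro nn_integral_mono) auto
      also have "(\<integral>\<^sup>+y. F (y + t *\<^sub>R h) \<partial>lborel) = (\<integral>\<^sup>+y. F y \<partial>lborel)"
        by (rule lborel_nn_integral_translate) measurable
      finally show "(\<integral>\<^sup>+x. ennreal (norm (?l t x)) \<partial>lborel)
          \<le> indicator {0..1} t * (\<integral>\<^sup>+y. F y \<partial>lborel)"
        by (cases "t \<in> {0..1}") auto
    qed
    finally show "(\<integral>\<^sup>+p. ennreal (norm (case p of (t, x) \<Rightarrow> ?l t x)) \<partial>(lborel \<Otimes>\<^sub>M lborel)) < \<infinity>"
      using fin2 by (rule le_less_trans)
  qed measurable
qed

lemma frechet_derivative_partial_deriv:
  assumes "\<phi> differentiable at x"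
  shows "frechet_derivative \<phi> (at x) h = h$1 * partial_deriv 1 \<phi> x + h$2 * partial_deriv 2 \<phi> x"
proof -
  interpret linear "frechet_derivative \<phi> (at x)"
    using assms by (intro linear_frechet_derivative)
  have "h = h$1 *\<^sub>R axis 1 1 + h$2 *\<^sub>R axis 2 1"
    by (simp add: vec_eq_iff forall_2 axis_def)
  then have "frechet_derivative \<phi> (at x) h = frechet_derivative \<phi> (at x) (h$1 *\<^sub>R axis 1 1 + h$2 *\<^sub>R axis 2 1)"
    by simp
  then show ?thesis by (simp add: add scaleR partial_deriv_def)
qed

lemma test_function_ftc:
  assumes "test_function \<psi>"
  shows "(\<integral>t. indicat_real {0..1} t *\<^sub>R
      (h$1 * partial_deriv 1 \<psi> (x - t *\<^sub>R h) + h$2 * partial_deriv 2 \<psi> (x - t *\<^sub>R h)) \<partial>lborel)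
    = \<psi> x - \<psi> (x - h)"
proof -
  let ?f = "\<lambda>t. h$1 * partial_deriv 1 \<psi> (x - t *\<^sub>R h) + h$2 * partial_deriv 2 \<psi> (x - t *\<^sub>R h)"
  have "((\<lambda>t. - \<psi> (x - t *\<^sub>R h)) has_vector_derivative ?f t) (at t within {0..1})" for t
  proof -
    have d: "((\<lambda>t. x - t *\<^sub>R h) has_derivative (\<lambda>s. - (s *\<^sub>R h))) (at t within {0..1})"
      by (auto intro!: derivative_eq_intros)
    have "(\<psi> has_derivative frechet_derivative \<psi> (at (x - t *\<^sub>R h))) (at (x - t *\<^sub>R h))"
      by (rule test_function_has_derivative[OF assms])
    then have "((\<lambda>t. - \<psi> (x - t *\<^sub>R h)) has_derivative
        (\<lambda>s. - frechet_derivative \<psi> (at (x - t *\<^sub>R h)) (- (s *\<^sub>R h)))) (at t within {0..1})"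
      by (intro has_derivative_minus has_derivative_compose[OF d])
    moreover have "- frechet_derivative \<psi> (at (x - t *\<^sub>R h)) (- (s *\<^sub>R h)) = s *\<^sub>R ?f t" for s
      using test_function_has_derivative[OF assms, of "x - t *\<^sub>R h"]
      by (subst frechet_derivative_partial_deriv) (auto simp: differentiable_def algebra_simps)
    ultimately show ?thesis by (simp add: has_vector_derivative_def)
  qed
  moreover have "continuous_on {0..1} ?f"
    by (intro continuous_intros continuous_on_compose2[OF test_function_continuous[OF test_function_partial_deriv[OF assms]]])
      auto
  ultimately show ?thesis
    by (subst integral_FTC_Icc[where F="\<lambda>t. - \<psi> (x - t *\<^sub>R h)"]) auto
qed

text \<open>A Sobolev function is given by Borel functions for itself and for its weak derivatives,
  since Fubini arguments with shifted variables need joint measurability. Elements of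
  \<open>W12\<close> are turned into such pairs by \<open>W12_sobolev_pair\<close>.\<close>

locale sobolev_pair =
  fixes w :: "real^2 \<Rightarrow> complex" and g :: "2 \<Rightarrow> real^2 \<Rightarrow> complex"
  assumes w_meas [measurable]: "w \<in> borel_measurable borel"
    and w_sq: "integrable lborel (\<lambda>x. (cmod (w x))\<^sup>2)"
    and g_meas [measurable]: "\<And>i. g i \<in> borel_measurable borel"
    and g_sq: "\<And>i. integrable lborel (\<lambda>x. (cmod (g i x))\<^sup>2)"
    and weak: "\<And>\<phi> i. test_function \<phi> \<Longrightarrow>
      (\<integral>x. complex_of_real (partial_deriv i \<phi> x) * w x \<partial>lborel) =
      - (\<integral>x. complex_of_real (\<phi> x) * g i x \<partial>lborel)"
begin

definition grad_sq :: "real^2 \<Rightarrow> real" where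
  "grad_sq x = (cmod (g 1 x))\<^sup>2 + (cmod (g 2 x))\<^sup>2"

lemma grad_sq_measurable [measurable]: "grad_sq \<in> borel_measurable borel"
  unfolding grad_sq_def by measurable

lemma grad_sq_nonneg: "0 \<le> grad_sq x" by (simp add: grad_sq_def)

lemma grad_sq_integrable: "integrable lborel grad_sq"
  unfolding grad_sq_def by (intro Bochner_Integration.integrable_add g_sq)

lemma locally_integrable_w: "locally_integrable w" and locally_integrable_g: "locally_integrable (g i)"
  by (auto intro!: locally_integrable_square w_sq g_sq)

definition line_avg :: "2 \<Rightarrow> real^2 \<Rightarrow> real^2 \<Rightarrow> complex" where
  "line_avg i h x = (\<integral>t. indicat_real {0..1} t *\<^sub>R g i (x + t *\<^sub>R h) \<partial>lborel)"

lemma line_avg_measurable [measurable]: "line_avg i h \<in> borel_measurable borel"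
  unfolding line_avg_def by measurable

lemma locally_integrable_line_avg: "locally_integrable (line_avg i h)"
  unfolding locally_integrable_def
proof (intro conjI allI)
  fix r :: real
  have "integrable (lborel \<Otimes>\<^sub>M lborel) (\<lambda>(t::real, x). indicat_real {0..1} t *\<^sub>R
      (complex_of_real (indicat_real (cball 0 r) x) * g i (x + t *\<^sub>R h)))"
    by (rule fubini_shift[OF locally_integrable_g, where M=1 and r=r]) (auto simp: indicator_def)
  from lborel_pair.integrable_snd[OF this]
  have "integrable lborel (\<lambda>x. \<integral>t. complex_of_real (indicat_real (cball 0 r) x) *
      (indicat_real {0..1} t *\<^sub>R g i (x + t *\<^sub>R h)) \<partial>lborel)"
    by (simp add: mult_ac)
  then show "integrable lborel (\<lambda>x. indicat_real (cball 0 r) x *\<^sub>R line_avg i h x)"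
    by (simp add: line_avg_def scaleR_conv_of_real)
qed measurable

text \<open>A translation moves the shift from \<open>w\<close> to \<open>\<psi>\<close>; the
  fundamental theorem turns \<open>\<psi> x - \<psi> (x - h)\<close> into an integral of partial
  derivatives over \<open>t\<close>; the weak derivative is applied to each translate of
  \<open>\<psi>\<close>; Fubini and a second translation then bring the shift to
  \<open>g\<close>.\<close>

lemma test_function_times_shift:
  assumes \<psi>: "test_function \<psi>"
  shows "(\<integral>x. complex_of_real (\<psi> x) * (w (x + h) - w x) \<partial>lborel) =
    (\<integral>x. complex_of_real (\<psi> x) * (h$1 *\<^sub>R line_avg 1 h x + h$2 *\<^sub>R line_avg 2 h x) \<partial>lborel)"
proof -
  let ?y = "\<lambda>i t x. complex_of_real (\<psi> x) * g i (x + t *\<^sub>R h)" and ?z = "\<lambda>i t x. complex_of_real (partial_deriv i \<psi> (x - t *\<^sub>R h)) * w x"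
  let ?d = "\<lambda>i x t. indicat_real {0..1} t * partial_deriv i \<psi> (x - t *\<^sub>R h)"
  have test_bound: "\<exists>M r. (\<forall>x. \<bar>\<phi> x\<bar> \<le> M) \<and> (\<forall>x. r < norm x \<longrightarrow> \<phi> x = 0)" if \<phi>: "test_function \<phi>" for \<phi>
  proof -
    obtain r where "\<And>x. r < norm x \<Longrightarrow> \<phi> x = 0"
      using test_function_support[OF \<phi>] by blast
    moreover from this obtain M where "\<And>x. norm (\<phi> x) \<le> M"
      using continuous_compact_support_bounded[OF test_function_continuous[OF \<phi>], of r] by blast
    ultimately show ?thesis by auto
  qed
  have test_meas: "\<phi> \<in> borel_measurable borel" if "test_function \<phi>" for \<phi>
    using test_function_continuous[OF that] by (rule borel_measurable_continuous_onI)
  note [measurable] = test_meas[OF \<psi>] test_meas[OF test_function_partial_deriv[OF \<psi>]]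
  define e where "e t x = indicat_real {0..1} t *\<^sub>R x" for t :: real and x :: complex
  have shift: "test_function (\<lambda>x. \<psi> (x - h))" for h
    using test_function_translate(1)[OF \<psi>, of "- h"] by simp
  have dshift: "partial_deriv i (\<lambda>x. \<psi> (x - h)) x = partial_deriv i \<psi> (x - h)" for i h x
    using test_function_translate(2)[OF \<psi>, of i "- h"] by simp
  have intA: "integrable (lborel \<Otimes>\<^sub>M lborel) (\<lambda>(t, x). e t (?z i t x))" for i
    using test_bound[OF test_function_partial_deriv[OF \<psi>, of i]] fubini_shift(2)[OF locally_integrable_w, of "partial_deriv i \<psi>"]
    unfolding e_def by (metis (no_types, lifting) test_meas[OF test_function_partial_deriv[OF \<psi>]])
  have intB: "integrable (lborel \<Otimes>\<^sub>M lborel) (\<lambda>(t, x). e t (?y i t x))" for i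
    using test_bound[OF \<psi>] fubini_shift(1)[OF locally_integrable_g, of \<psi>]
    unfolding e_def by (metis (no_types, lifting) test_meas[OF \<psi>])
  define A where "A i x = (\<integral>t. e t (?z i t x) \<partial>lborel)" for i x
  have A: "integrable lborel (A i)" for i
    unfolding A_def using lborel_pair.integrable_snd[OF intA] .
  have step: "(\<integral>x. A i x \<partial>lborel) = - (\<integral>x. complex_of_real (\<psi> x) * line_avg i h x \<partial>lborel)" for i
  proof -
    have "(\<integral>x. A i x \<partial>lborel) = (\<integral>t. \<integral>x. e t (?z i t x) \<partial>lborel \<partial>lborel)"
      unfolding A_def by (rule lborel_pair.Fubini_integral[OF intA])
    also have "\<dots> = (\<integral>t. e t (\<integral>x. complex_of_real (partial_deriv i (\<lambda>x. \<psi> (x - t *\<^sub>R h)) x) * w x \<partial>lborel) \<partial>lborel)"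
      unfolding e_def dshift by simp
    also have "\<dots> = (\<integral>t. e t (- (\<integral>x. complex_of_real (\<psi> (x - t *\<^sub>R h)) * g i x \<partial>lborel)) \<partial>lborel)"
      by (subst weak[OF shift]) simp
    also have "\<dots> = (\<integral>t. e t (- (\<integral>x. ?y i t x \<partial>lborel)) \<partial>lborel)"
    proof -
      have "(\<integral>x. complex_of_real (\<psi> (x - t *\<^sub>R h)) * g i x \<partial>lborel) = (\<integral>x. ?y i t x \<partial>lborel)" for t
        using lborel_integral_translate[of "\<lambda>x. complex_of_real (\<psi> (x - t *\<^sub>R h)) * g i x" "t *\<^sub>R h"] by simp
      then show ?thesis by simp
    qed
    also have "\<dots> = - (\<integral>t. \<integral>x. e t (?y i t x) \<partial>lborel \<partial>lborel)"
      unfolding e_def by simp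
    also have "(\<integral>t. \<integral>x. e t (?y i t x) \<partial>lborel \<partial>lborel) =
        (\<integral>x. \<integral>t. e t (?y i t x) \<partial>lborel \<partial>lborel)"
      by (rule lborel_pair.Fubini_integral[OF intB, symmetric])
    also have "\<dots> = (\<integral>x. complex_of_real (\<psi> x) * line_avg i h x \<partial>lborel)"
    proof -
      have "(\<integral>t. e t (?y i t x) \<partial>lborel) = complex_of_real (\<psi> x) * line_avg i h x" for x
        unfolding line_avg_def integral_mult_right_zero[symmetric] by (simp add: e_def mult_ac)
      then show ?thesis by simp
    qed
    finally show ?thesis .
  qed
  have int\<psi>: "integrable lborel (\<lambda>x. complex_of_real (\<psi> (x - h)) * w x)" "integrable lborel (\<lambda>x. complex_of_real (\<psi> x) * w x)"
    by (auto intro: integrable_test_function_times locally_integrable_w \<psi> shift)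
  have "(\<integral>x. complex_of_real (\<psi> x) * (w (x + h) - w x) \<partial>lborel) =
     (\<integral>x. complex_of_real (\<psi> x) * w (x + h) \<partial>lborel) - (\<integral>x. complex_of_real (\<psi> x) * w x \<partial>lborel)"
    using int\<psi>(2) lborel_integrable_translate[OF int\<psi>(1), of h] by (simp add: right_diff_distrib)
  also have "(\<integral>x. complex_of_real (\<psi> x) * w (x + h) \<partial>lborel) = (\<integral>x. complex_of_real (\<psi> (x - h)) * w x \<partial>lborel)"
    using lborel_integral_translate[of "\<lambda>x. complex_of_real (\<psi> (x - h)) * w x" h] by simp
  also have "(\<integral>x. complex_of_real (\<psi> (x - h)) * w x \<partial>lborel) - (\<integral>x. complex_of_real (\<psi> x) * w x \<partial>lborel) =
     (\<integral>x. - complex_of_real (\<psi> x - \<psi> (x - h)) * w x \<partial>lborel)"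
    using int\<psi> by (subst Bochner_Integration.integral_diff[symmetric]) (auto simp: algebra_simps)
  also have "\<dots> = (\<integral>x. - (h$1 *\<^sub>R A 1 x + h$2 *\<^sub>R A 2 x) \<partial>lborel)"
  proof (rule Bochner_Integration.integral_cong[OF refl])
    fix x
    have c: "integrable lborel (\<lambda>t. ?d i x t)" for i
    proof -
      have "continuous_on {0..1} (\<lambda>t. partial_deriv i \<psi> (x - t *\<^sub>R h))"
        by (intro continuous_intros continuous_on_compose2[OF test_function_continuous[OF test_function_partial_deriv[OF \<psi>]]])
          auto
      then show ?thesis using borel_integrable_compact[of "{0..1}" "\<lambda>t. partial_deriv i \<psi> (x - t *\<^sub>R h)"] by simp
    qed
    have "A i x = (\<integral>t. complex_of_real (?d i x t) * w x \<partial>lborel)" for i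
      by (simp add: A_def e_def scaleR_conv_of_real mult_ac)
    also have "\<dots> i = complex_of_real (\<integral>t. ?d i x t \<partial>lborel) * w x" for i
      by (simp only: integral_mult_left_zero integral_complex_of_real)
    finally have Ai: "A i x = complex_of_real (\<integral>t. ?d i x t \<partial>lborel) * w x" for i .
    have "\<psi> x - \<psi> (x - h) = (\<integral>t. h$1 * (?d 1 x t) + h$2 * (?d 2 x t) \<partial>lborel)"
      unfolding test_function_ftc[OF \<psi>, of h x, symmetric] by (simp add: algebra_simps)
    also have "\<dots> = h$1 * (\<integral>t. ?d 1 x t \<partial>lborel)
         + h$2 * (\<integral>t. ?d 2 x t \<partial>lborel)"
      using c[of 1] c[of 2] by simp
    finally show "- complex_of_real (\<psi> x - \<psi> (x - h)) * w x = - (h$1 *\<^sub>R A 1 x + h$2 *\<^sub>R A 2 x)"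
      unfolding Ai by (simp add: scaleR_conv_of_real algebra_simps)
  qed
  also have "\<dots> = - (h$1 *\<^sub>R (\<integral>x. A 1 x \<partial>lborel) + h$2 *\<^sub>R (\<integral>x. A 2 x \<partial>lborel))"
    using A[of 1] A[of 2] by simp
  also have "\<dots> = h$1 *\<^sub>R (\<integral>x. complex_of_real (\<psi> x) * line_avg 1 h x \<partial>lborel) + h$2 *\<^sub>R (\<integral>x. complex_of_real (\<psi> x) * line_avg 2 h x \<partial>lborel)"
    unfolding step by simp
  also have "\<dots> = (\<integral>x. complex_of_real (\<psi> x) * (h$1 *\<^sub>R line_avg 1 h x + h$2 *\<^sub>R line_avg 2 h x) \<partial>lborel)"
    using integrable_test_function_times[OF locally_integrable_line_avg[of 1 h] \<psi>]
      integrable_test_function_times[OF locally_integrable_line_avg[of 2 h] \<psi>]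
    by (simp add: distrib_left)
  finally show ?thesis .
qed

text \<open>The mean value formula in integral form, for fixed \<open>h\<close> and outside a null
  set that may depend on it. It gives access to finite differences of \<open>w\<close> without
  approximating \<open>w\<close> by smooth functions.\<close>

lemma shift_eq_line_avg:
  "AE x in lborel. w (x + h) - w x = h$1 *\<^sub>R line_avg 1 h x + h$2 *\<^sub>R line_avg 2 h x"
proof -
  have shift: "locally_integrable (\<lambda>x. w (x + h))"
    by (rule locally_integrable_square) (auto intro: lborel_integrable_translate[OF w_sq])
  have avg: "locally_integrable (\<lambda>x. h$1 *\<^sub>R line_avg 1 h x + h$2 *\<^sub>R line_avg 2 h x)"
  proof -
    have "integrable lborel (\<lambda>x. h$1 *\<^sub>R (indicat_real (cball 0 r) x *\<^sub>R line_avg 1 h x) +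
        h$2 *\<^sub>R (indicat_real (cball 0 r) x *\<^sub>R line_avg 2 h x))" for r
      using locally_integrable_line_avg[of 1 h] locally_integrable_line_avg[of 2 h]
      by (intro Bochner_Integration.integrable_add integrable_scaleR_right) (auto simp: locally_integrable_def)
    then show ?thesis
      by (simp add: locally_integrable_def scaleR_add_right mult.commute)
  qed
  have li: "locally_integrable (\<lambda>x. w (x + h) - w x - (h$1 *\<^sub>R line_avg 1 h x + h$2 *\<^sub>R line_avg 2 h x))"
    by (intro locally_integrable_diff shift avg locally_integrable_w)
  have "AE x in lborel. w (x + h) - w x - (h$1 *\<^sub>R line_avg 1 h x + h$2 *\<^sub>R line_avg 2 h x) = 0"
  proof (rule fundamental_lemma[OF li])
    fix \<psi> assume \<psi>: "test_function \<psi>"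
    show "(\<integral>x. complex_of_real (\<psi> x) * (w (x + h) - w x - (h$1 *\<^sub>R line_avg 1 h x + h$2 *\<^sub>R line_avg 2 h x)) \<partial>lborel) = 0"
      using integrable_test_function_times[OF locally_integrable_diff[OF shift locally_integrable_w] \<psi>]
        integrable_test_function_times[OF avg \<psi>] test_function_times_shift[OF \<psi>, of h]
      by (simp add: right_diff_distrib[of "complex_of_real (\<psi> x)" "w (x + h) - w x" for x])
  qed
  then show ?thesis by eventually_elim simp
qed

end

section \<open>Radial integration and a Poincare inequality\<close>

lemma emeasure_cball_plane: "0 \<le> r \<Longrightarrow> emeasure lborel (cball (c::real^2) r) = ennreal (pi * r\<^sup>2)"
  by (simp add: emeasure_cball unit_ball_vol_2)

lemma norm_sq_plane: "(norm (x::real^2))\<^sup>2 = (x$1)\<^sup>2 + (x$2)\<^sup>2"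
  by (simp add: norm_vec_def L2_set_def sum_2)

text \<open>The disc of squared radius \<open>s\<close> has area \<open>pi * s\<close>, so the image
  measure under the squared norm is \<open>pi\<close> times Lebesgue measure on the half-line. The
  sign is reversed because the two measures are compared on the sets \<open>{a<..}\<close>, which
  must have finite measure.\<close>

lemma nn_integral_radial:
  fixes f :: "real \<Rightarrow> ennreal"
  assumes [measurable]: "f \<in> borel_measurable borel"
  shows "(\<integral>\<^sup>+x. f ((norm (x::real^2))\<^sup>2) \<partial>lborel) = ennreal pi * (\<integral>\<^sup>+s. f s * indicator {0..} s \<partial>lborel)"
proof -
  let ?M = "distr lborel borel (\<lambda>x::real^2. - (norm x)\<^sup>2)"
  let ?N = "density lborel (\<lambda>s::real. ennreal pi * indicator {..0} s)"
  have M: "emeasure ?M {a<..} = (if a < 0 then ennreal (pi * (- a)) else 0)" for a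
  proof -
    have "emeasure ?M {a<..} = emeasure lborel ((\<lambda>x::real^2. - (norm x)\<^sup>2) -` {a<..})"
      by (subst emeasure_distr) auto
    also have "(\<lambda>x::real^2. - (norm x)\<^sup>2) -` {a<..} = (if a < 0 then ball 0 (sqrt (- a)) else {})"
    proof (cases "a < 0")
      case True
      have "a < - (norm x)\<^sup>2 \<longleftrightarrow> norm x < sqrt (- a)" for x :: "real^2"
        using real_less_rsqrt[of "norm x" "- a"] real_sqrt_less_iff[of "(norm x)\<^sup>2" "- a"] by auto
      with True show ?thesis by auto
    next
      case False
      then have "\<not> a < - (norm x)\<^sup>2" for x :: "real^2" using zero_le_power2[of "norm x"] by linarith
      with False show ?thesis by auto
    qed
    finally show ?thesis
      by (auto simp: emeasure_ball unit_ball_vol_2)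
  qed
  have N: "emeasure ?N {a<..} = (if a < 0 then ennreal (pi * (- a)) else 0)" for a
  proof -
    have "emeasure ?N {a<..} = (\<integral>\<^sup>+s. ennreal pi * indicator {a<..0} s \<partial>lborel)"
      by (subst emeasure_density) (auto intro!: nn_integral_cong simp: indicator_def)
    also have "\<dots> = ennreal pi * emeasure lborel {a<..0}"
      by (subst nn_integral_cmult) auto
    finally show ?thesis by (auto simp flip: ennreal_mult')
  qed
  have "?M = ?N"
    by (rule measure_eqI_lessThan) (simp_all only: M N, auto)
  then have "(\<integral>\<^sup>+s. f (- s) \<partial>?M) = (\<integral>\<^sup>+s. f (- s) \<partial>?N)" by simp
  moreover have "(\<integral>\<^sup>+s. f (- s) \<partial>?M) = (\<integral>\<^sup>+x. f ((norm (x::real^2))\<^sup>2) \<partial>lborel)"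
    by (subst nn_integral_distr) auto
  moreover have "(\<integral>\<^sup>+s. f (- s) \<partial>?N) = (\<integral>\<^sup>+s. ennreal pi * (f (- s) * indicator {..0} s) \<partial>lborel)"
    by (subst nn_integral_density) (auto simp: mult_ac)
  moreover have "\<dots> = ennreal pi * (\<integral>\<^sup>+s. f (- s) * indicator {..0} s \<partial>lborel)"
    by (subst nn_integral_cmult) auto
  moreover have "(\<integral>\<^sup>+s. f s * indicator {0..} s \<partial>lborel) = (\<integral>\<^sup>+s. f (- s) * indicator {0..} (- s) \<partial>lborel)"
    using nn_integral_real_affine[of "\<lambda>s. f s * indicator {0..} s" "-1" 0] by simp
  moreover have "indicator {0..} (- s) = (indicator {..0} s :: ennreal)" for s :: real
    by (auto simp: indicator_def)
  ultimately show ?thesis by simp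
qed

section \<open>From translations to the Poincare inequality\<close>

context sobolev_pair
begin

lemma line_avg_square_le:
  "ennreal ((cmod (line_avg i h x))\<^sup>2) \<le> (\<integral>\<^sup>+t. indicator {0..1} t * ennreal ((cmod (g i (x + t *\<^sub>R h)))\<^sup>2) \<partial>lborel)"
proof -
  let ?M = "density lborel (\<lambda>t::real. ennreal (indicat_real {0..1} t))"
  have "emeasure ?M (space ?M) = (\<integral>\<^sup>+t. indicator {0..1::real} t \<partial>lborel)"
    by (simp add: emeasure_density ennreal_indicator)
  also have "\<dots> = 1" by simp
  finally have "ennreal ((cmod (\<integral>t. g i (x + t *\<^sub>R h) \<partial>?M))\<^sup>2) \<le> (\<integral>\<^sup>+t. ennreal ((cmod (g i (x + t *\<^sub>R h)))\<^sup>2) \<partial>?M)"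
    by (intro norm_integral_square_le) auto
  moreover have "(\<integral>t. g i (x + t *\<^sub>R h) \<partial>?M) = line_avg i h x"
    unfolding line_avg_def by (rule integral_density) auto
  moreover have "(\<integral>\<^sup>+t. ennreal ((cmod (g i (x + t *\<^sub>R h)))\<^sup>2) \<partial>?M) = (\<integral>\<^sup>+t. indicator {0..1} t * ennreal ((cmod (g i (x + t *\<^sub>R h)))\<^sup>2) \<partial>lborel)"
    by (subst nn_integral_density) (auto simp: ennreal_indicator)
  ultimately show ?thesis by simp
qed

lemma nn_integral_line_avg_le:
  "(\<integral>\<^sup>+x. indicator (cball 0 R) x * ennreal ((cmod (line_avg i h x))\<^sup>2) \<partial>lborel)
    \<le> (\<integral>\<^sup>+x. indicator (cball 0 (R + norm h)) x * ennreal ((cmod (g i x))\<^sup>2) \<partial>lborel)" (is "?L \<le> ?K")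
proof -
  have [measurable]: "cball (0::real^2) r \<in> sets borel" for r by simp
  let ?f = "\<lambda>t x. indicator (cball 0 R) x * (indicator {0..1::real} t * ennreal ((cmod (g i (x + t *\<^sub>R h)))\<^sup>2))"
  have "?L \<le> (\<integral>\<^sup>+x. indicator (cball 0 R) x * (\<integral>\<^sup>+t. indicator {0..1} t * ennreal ((cmod (g i (x + t *\<^sub>R h)))\<^sup>2) \<partial>lborel) \<partial>lborel)"
    by (rule nn_integral_mono, rule mult_left_mono[OF line_avg_square_le]) simp
  also have "\<dots> = (\<integral>\<^sup>+x. \<integral>\<^sup>+t. ?f t x \<partial>lborel \<partial>lborel)"
    by (rule nn_integral_cong, rule nn_integral_cmult[symmetric]) measurable
  also have "\<dots> = (\<integral>\<^sup>+t. \<integral>\<^sup>+x. ?f t x \<partial>lborel \<partial>lborel)"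
    by (rule lborel_pair.Fubini') measurable
  also have "\<dots> \<le> (\<integral>\<^sup>+t. indicator {0..1::real} t * ?K \<partial>lborel)"
  proof (rule nn_integral_mono)
    fix t :: real
    show "(\<integral>\<^sup>+x. ?f t x \<partial>lborel) \<le> indicator {0..1} t * ?K"
    proof (cases "t \<in> {0..1}")
      case True
      have "x + t *\<^sub>R h \<in> cball 0 (R + norm h)" if "x \<in> cball 0 R" for x
      proof -
        have "norm (x + t *\<^sub>R h) \<le> norm x + norm (t *\<^sub>R h)" by (rule norm_triangle_ineq)
        also have "\<dots> \<le> R + norm h"
          using True that by (intro add_mono) (auto intro: mult_left_le_one_le)
        finally show ?thesis by simp
      qed
      then have "(\<integral>\<^sup>+x. ?f t x \<partial>lborel) \<le> (\<integral>\<^sup>+x. indicator (cball 0 (R + norm h)) (x + t *\<^sub>R h) * ennreal ((cmod (g i (x + t *\<^sub>R h)))\<^sup>2) \<partial>lborel)"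
        using True by (intro nn_integral_mono) (auto simp: indicator_def)
      also have "\<dots> = ?K"
        by (rule lborel_nn_integral_translate) measurable
      finally show ?thesis using True by simp
    qed simp
  qed
  also have "\<dots> = ?K" by (subst nn_integral_multc) auto
  finally show ?thesis .
qed

text \<open>The L2 modulus of continuity: Cauchy-Schwarz over the two components of
  \<open>h\<close>, Jensen along the segment, and translation invariance. Segments starting in the
  ball of radius \<open>R\<close> stay in the ball of radius \<open>R + norm h\<close>, which keeps
  the estimate local.\<close>

lemma nn_integral_shift_le:
  "(\<integral>\<^sup>+x. indicator (cball 0 R) x * ennreal ((cmod (w (x + h) - w x))\<^sup>2) \<partial>lborel)
    \<le> ennreal ((norm h)\<^sup>2) * (\<integral>\<^sup>+x. indicator (cball 0 (R + norm h)) x * ennreal (grad_sq x) \<partial>lborel)"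
proof -
  have [measurable]: "cball (0::real^2) r \<in> sets borel" for r by simp
  let ?H = "ennreal ((norm h)\<^sup>2)"
  have cs: "(cmod (a *\<^sub>R u + b *\<^sub>R v))\<^sup>2 \<le> (a\<^sup>2 + b\<^sup>2) * ((cmod u)\<^sup>2 + (cmod v)\<^sup>2)" for a b u v
  proof -
    have "(cmod (a *\<^sub>R u + b *\<^sub>R v))\<^sup>2 \<le> (\<bar>a\<bar> * cmod u + \<bar>b\<bar> * cmod v)\<^sup>2"
      using norm_triangle_ineq[of "a *\<^sub>R u" "b *\<^sub>R v"] by (intro power_mono) auto
    also have "\<dots> \<le> (a\<^sup>2 + b\<^sup>2) * ((cmod u)\<^sup>2 + (cmod v)\<^sup>2)"
      using zero_le_power2[of "\<bar>a\<bar> * cmod v - \<bar>b\<bar> * cmod u"]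
      by (simp add: power2_sum power2_diff power_mult_distrib algebra_simps)
    finally show ?thesis .
  qed
  have "(\<integral>\<^sup>+x. indicator (cball 0 R) x * ennreal ((cmod (w (x + h) - w x))\<^sup>2) \<partial>lborel)
    \<le> (\<integral>\<^sup>+x. ?H * (indicator (cball 0 R) x * ennreal ((cmod (line_avg 1 h x))\<^sup>2) + indicator (cball 0 R) x * ennreal ((cmod (line_avg 2 h x))\<^sup>2)) \<partial>lborel)"
    using shift_eq_line_avg[of h]
  proof (intro nn_integral_mono_AE, eventually_elim)
    case (elim x)
    have "ennreal ((cmod (w (x + h) - w x))\<^sup>2) \<le> ?H * (ennreal ((cmod (line_avg 1 h x))\<^sup>2) + ennreal ((cmod (line_avg 2 h x))\<^sup>2))"
      unfolding elim norm_sq_plane[of h] using cs[of "h$1" "line_avg 1 h x" "h$2" "line_avg 2 h x"]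
      by (simp add: ennreal_leI flip: ennreal_plus ennreal_mult)
    then show ?case by (simp add: indicator_def)
  qed
  also have "\<dots> = ?H * ((\<integral>\<^sup>+x. indicator (cball 0 R) x * ennreal ((cmod (line_avg 1 h x))\<^sup>2) \<partial>lborel) +
      (\<integral>\<^sup>+x. indicator (cball 0 R) x * ennreal ((cmod (line_avg 2 h x))\<^sup>2) \<partial>lborel))"
    by (subst nn_integral_cmult, measurable, subst nn_integral_add, measurable)
  also have "\<dots> \<le> ?H * ((\<integral>\<^sup>+x. indicator (cball 0 (R + norm h)) x * ennreal ((cmod (g 1 x))\<^sup>2) \<partial>lborel) +
      (\<integral>\<^sup>+x. indicator (cball 0 (R + norm h)) x * ennreal ((cmod (g 2 x))\<^sup>2) \<partial>lborel))"
    by (intro mult_left_mono add_mono nn_integral_line_avg_le) simp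
  also have "\<dots> = ?H * (\<integral>\<^sup>+x. indicator (cball 0 (R + norm h)) x * ennreal ((cmod (g 1 x))\<^sup>2) +
      indicator (cball 0 (R + norm h)) x * ennreal ((cmod (g 2 x))\<^sup>2) \<partial>lborel)"
    by (subst nn_integral_add, measurable)
  also have "\<dots> = ?H * (\<integral>\<^sup>+x. indicator (cball 0 (R + norm h)) x * ennreal (grad_sq x) \<partial>lborel)"
    by (simp add: grad_sq_def distrib_left)
  finally show ?thesis .
qed

definition grad_energy :: "(real^2) set \<Rightarrow> real" where
  "grad_energy A = (\<integral>x. indicat_real A x * grad_sq x \<partial>lborel)"

lemma grad_energy_integrable: "A \<in> sets borel \<Longrightarrow> integrable lborel (\<lambda>x. indicat_real A x * grad_sq x)"
  using integrable_mult_indicator[of A lborel grad_sq] grad_sq_integrable by simp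

lemma grad_energy_nonneg: "0 \<le> grad_energy A"
  unfolding grad_energy_def by (intro Bochner_Integration.integral_nonneg) (auto simp: grad_sq_nonneg)

lemma nn_grad_energy:
  "A \<in> sets borel \<Longrightarrow> (\<integral>\<^sup>+x. indicator A x * ennreal (grad_sq x) \<partial>lborel) = ennreal (grad_energy A)"
  unfolding grad_energy_def
  by (subst nn_integral_eq_integral[symmetric, OF grad_energy_integrable])
    (auto simp: grad_sq_nonneg ennreal_mult' ennreal_indicator)

text \<open>Under the probability density \<open>\<rho>\<close> the variance of \<open>w\<close> is
  at most the double average of \<open>(cmod (w x - w y))\<^sup>2\<close>. With
  \<open>y = x + h\<close> only \<open>norm h \<le> 2 * R\<close> contributes. Bounding both
  densities by \<open>B\<close>, the shift estimate gives the factor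
  \<open>B\<^sup>2 * (2 * R)\<^sup>2\<close> for each \<open>h\<close>, and these \<open>h\<close>
  fill a disc of area \<open>pi * (2 * R)\<^sup>2\<close>. The radius \<open>3 * R\<close> bounds
  \<open>R + norm h\<close>.\<close>

lemma poincare:
  fixes \<rho> :: "real^2 \<Rightarrow> real"
  assumes [measurable]: "\<rho> \<in> borel_measurable borel" and nn: "\<And>x. 0 \<le> \<rho> x" and B: "\<And>x. \<rho> x \<le> B"
    and supp: "\<And>x. R < norm x \<Longrightarrow> \<rho> x = 0" and mass: "(\<integral>\<^sup>+x. ennreal (\<rho> x) \<partial>lborel) = 1" and "0 \<le> R"
  shows "(\<integral>x. \<rho> x * (cmod (w x))\<^sup>2 \<partial>lborel)
    \<le> (cmod (\<integral>x. complex_of_real (\<rho> x) * w x \<partial>lborel))\<^sup>2 + 16 * pi * B\<^sup>2 * R ^ 4 * grad_energy (cball 0 (3 * R))"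
proof -
  let ?D = "grad_energy (cball 0 (3 * R))"
  have [measurable]: "cball (0::real^2) r \<in> sets borel" for r by simp
  let ?M = "density lborel (\<lambda>x. ennreal (\<rho> x))"
  define m where "m = (\<integral>x. w x \<partial>?M)"
  have m: "m = (\<integral>x. complex_of_real (\<rho> x) * w x \<partial>lborel)"
    unfolding m_def using nn by (subst integral_density) (auto simp: scaleR_conv_of_real)
  have M1: "emeasure ?M (space ?M) = 1"
    using mass by (simp add: emeasure_density)
  interpret finite_measure ?M by (rule finite_measureI) (simp only: M1, simp)
  have mM: "measure ?M (space ?M) = 1" by (simp only: measure_def M1) simp
  have sq: "integrable ?M (\<lambda>x. (cmod (w x))\<^sup>2)"
  proof -
    have "integrable lborel (\<lambda>x. \<rho> x * (cmod (w x))\<^sup>2)"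
      by (rule Bochner_Integration.integrable_bound[OF integrable_mult_right[OF w_sq, of B]])
        (use nn B in \<open>auto intro!: AE_I2 mult_right_mono simp: abs_mult order_trans[OF nn B]\<close>)
    then show ?thesis using nn by (subst integrable_density) auto
  qed
  note var = variance_identity[OF M1 _ sq, folded m_def]
  have wint: "integrable ?M w" by (rule var(1)) simp
  have "ennreal (\<integral>x. (cmod (w x - m))\<^sup>2 \<partial>?M) = (\<integral>\<^sup>+x. ennreal ((cmod (w x - m))\<^sup>2) \<partial>?M)"
    by (rule nn_integral_eq_integral[symmetric, OF var(2)]) auto
  also have "\<dots> \<le> (\<integral>\<^sup>+x. \<integral>\<^sup>+y. ennreal ((cmod (w x - w y))\<^sup>2) \<partial>?M \<partial>?M)"
  proof (rule nn_integral_mono)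
    fix x
    have "w x - m = (\<integral>y. w x - w y \<partial>?M)"
      using wint mM by (simp add: m_def)
    then show "ennreal ((cmod (w x - m))\<^sup>2) \<le> (\<integral>\<^sup>+y. ennreal ((cmod (w x - w y))\<^sup>2) \<partial>?M)"
      using norm_integral_square_le[OF M1, of "\<lambda>y. w x - w y"] by simp
  qed
  also have "\<dots> = (\<integral>\<^sup>+x. ennreal (\<rho> x) * (\<integral>\<^sup>+y. ennreal (\<rho> y) * ennreal ((cmod (w x - w y))\<^sup>2) \<partial>lborel) \<partial>lborel)"
    by (simp add: nn_integral_density)
  also have "\<dots> = (\<integral>\<^sup>+x. ennreal (\<rho> x) * (\<integral>\<^sup>+h. ennreal (\<rho> (h + x)) * ennreal ((cmod (w x - w (h + x)))\<^sup>2) \<partial>lborel) \<partial>lborel)"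
    by (subst lborel_nn_integral_translate[where f="\<lambda>y. ennreal (\<rho> y) * ennreal ((cmod (w x - w y))\<^sup>2)" and h=x for x]) simp_all
  also have "\<dots> = (\<integral>\<^sup>+x. \<integral>\<^sup>+h. ennreal (\<rho> x) * (ennreal (\<rho> (h + x)) * ennreal ((cmod (w x - w (h + x)))\<^sup>2)) \<partial>lborel \<partial>lborel)"
    by (rule nn_integral_cong, rule nn_integral_cmult[symmetric]) measurable
  also have "\<dots> = (\<integral>\<^sup>+h. \<integral>\<^sup>+x. ennreal (\<rho> x) * (ennreal (\<rho> (h + x)) * ennreal ((cmod (w x - w (h + x)))\<^sup>2)) \<partial>lborel \<partial>lborel)"
    by (rule lborel_pair.Fubini') measurable
  also have "\<dots> \<le> (\<integral>\<^sup>+h. ennreal (B\<^sup>2 * (2 * R)\<^sup>2 * ?D) * indicator (cball 0 (2 * R)) h \<partial>(lborel :: (real^2) measure))"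
  proof (rule nn_integral_mono)
    fix h :: "real^2"
    let ?F = "\<lambda>x. ennreal (\<rho> x) * (ennreal (\<rho> (h + x)) * ennreal ((cmod (w x - w (h + x)))\<^sup>2))"
    show "(\<integral>\<^sup>+x. ?F x \<partial>lborel) \<le> ennreal (B\<^sup>2 * (2 * R)\<^sup>2 * ?D) * indicator (cball 0 (2 * R)) h"
    proof (cases "norm h \<le> 2 * R")
      case True
      have "(\<integral>\<^sup>+x. ?F x \<partial>lborel) \<le> (\<integral>\<^sup>+x. ennreal (B\<^sup>2) * (indicator (cball 0 R) x * ennreal ((cmod (w (x + h) - w x))\<^sup>2)) \<partial>lborel)"
      proof (rule nn_integral_mono)
        fix x
        have "\<rho> x * (\<rho> (h + x) * (cmod (w x - w (h + x)))\<^sup>2) \<le> B * (B * (cmod (w x - w (h + x)))\<^sup>2)"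
          by (intro mult_mono mult_nonneg_nonneg nn B order_refl order_trans[OF nn B]) auto
        moreover have "cmod (w x - w (h + x)) = cmod (w (x + h) - w x)"
          by (simp add: norm_minus_commute add.commute)
        ultimately have "\<rho> x * (\<rho> (h + x) * (cmod (w x - w (h + x)))\<^sup>2) \<le> B\<^sup>2 * (cmod (w (x + h) - w x))\<^sup>2"
          by (simp add: power2_eq_square)
        then have "?F x \<le> ennreal (B\<^sup>2) * ennreal ((cmod (w (x + h) - w x))\<^sup>2)"
          using nn by (simp add: ennreal_leI flip: ennreal_mult)
        then show "?F x \<le> ennreal (B\<^sup>2) * (indicator (cball 0 R) x * ennreal ((cmod (w (x + h) - w x))\<^sup>2))"
          using supp[of x] by (cases "norm x \<le> R") (auto simp: indicator_def)
      qed
      also have "\<dots> = ennreal (B\<^sup>2) * (\<integral>\<^sup>+x. indicator (cball 0 R) x * ennreal ((cmod (w (x + h) - w x))\<^sup>2) \<partial>lborel)"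
        by (rule nn_integral_cmult) measurable
      also have "\<dots> \<le> ennreal (B\<^sup>2) * (ennreal ((norm h)\<^sup>2) * (\<integral>\<^sup>+x. indicator (cball 0 (R + norm h)) x * ennreal (grad_sq x) \<partial>lborel))"
        by (intro mult_left_mono nn_integral_shift_le) simp
      also have "\<dots> \<le> ennreal (B\<^sup>2) * (ennreal ((2 * R)\<^sup>2) * (\<integral>\<^sup>+x. indicator (cball 0 (3 * R)) x * ennreal (grad_sq x) \<partial>lborel))"
        using True by (intro mult_left_mono mult_mono ennreal_leI power_mono nn_integral_mono) (auto simp: indicator_def)
      also have "\<dots> = ennreal (B\<^sup>2 * (2 * R)\<^sup>2 * ?D)"
        by (subst nn_grad_energy) (auto simp: ennreal_mult grad_energy_nonneg mult.assoc)
      finally show ?thesis using True by simp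
    next
      case False
      have "\<rho> x = 0 \<or> \<rho> (h + x) = 0" for x
        using supp[of x] supp[of "h + x"] norm_triangle_ineq4[of "h + x" x] False by (cases "R < norm x") auto
      then have F: "?F x = 0" for x by (metis ennreal_0 mult_zero_left mult_zero_right)
      have "(\<integral>\<^sup>+x. ?F x \<partial>lborel) = (\<integral>\<^sup>+x. 0 \<partial>(lborel :: (real^2) measure))"
        by (rule nn_integral_cong) (rule F)
      then show ?thesis by simp
    qed
  qed
  also have "\<dots> = ennreal (B\<^sup>2 * (2 * R)\<^sup>2 * ?D) * ennreal (pi * (2 * R)\<^sup>2)"
    using \<open>0 \<le> R\<close> by (subst nn_integral_cmult_indicator) (auto simp: emeasure_cball_plane)
  also have "\<dots> = ennreal (B\<^sup>2 * (2 * R)\<^sup>2 * ?D * (pi * (2 * R)\<^sup>2))"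
    by (rule ennreal_mult[symmetric]) (auto intro!: mult_nonneg_nonneg grad_energy_nonneg)
  also have "B\<^sup>2 * (2 * R)\<^sup>2 * ?D * (pi * (2 * R)\<^sup>2) = 16 * pi * B\<^sup>2 * R ^ 4 * ?D"
    by (simp add: power2_eq_square power4_eq_xxxx)
  finally have "(\<integral>x. (cmod (w x - m))\<^sup>2 \<partial>?M) \<le> 16 * pi * B\<^sup>2 * R ^ 4 * ?D"
    by (subst (asm) ennreal_le_iff) (auto intro!: mult_nonneg_nonneg grad_energy_nonneg)
  moreover have "(\<integral>x. (cmod (w x))\<^sup>2 \<partial>?M) = (\<integral>x. \<rho> x * (cmod (w x))\<^sup>2 \<partial>lborel)"
    using nn by (subst integral_density) auto
  ultimately show ?thesis
    using var(3) by (simp add: m)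
qed

end

section \<open>Radial test fields and ring weights\<close>

text \<open>The argument stands for the squared norm, which is smooth at the origin. For
  \<open>0 < r \<le> R\<close> the cutoff is 1 where \<open>norm x\<close> lies between
  \<open>2 * r\<close> and \<open>R\<close>, and 0 outside the annulus from \<open>r\<close> to
  \<open>2 * R\<close>.\<close>

definition cutoff :: "real \<Rightarrow> real \<Rightarrow> real \<Rightarrow> real" where
  "cutoff r R s = smooth_step (s / r\<^sup>2) - smooth_step (s / R\<^sup>2)"

definition cutoff_deriv :: "real \<Rightarrow> real \<Rightarrow> real \<Rightarrow> real" where
  "cutoff_deriv r R s = smooth_bump (s / r\<^sup>2) / r\<^sup>2 - smooth_bump (s / R\<^sup>2) / R\<^sup>2"

text \<open>In the squared norm \<open>s\<close> the area element is \<open>pi\<close> times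
  \<open>ds\<close>, so division by \<open>pi * R\<^sup>2\<close> gives mass one at every radius.
  The profile is the derivative of the step in order that differences of ring weights become
  divergences.\<close>

definition ring_weight :: "real \<Rightarrow> real^2 \<Rightarrow> real" where
  "ring_weight R x = smooth_bump ((norm x)\<^sup>2 / R\<^sup>2) / (pi * R\<^sup>2)"

definition radial_field :: "real \<Rightarrow> real \<Rightarrow> 2 \<Rightarrow> real^2 \<Rightarrow> real" where
  "radial_field r R i x = cutoff r R ((norm x)\<^sup>2) / (norm x)\<^sup>2 * x $ i"

lemma cutoff_has_derivative: "(cutoff r R has_real_derivative cutoff_deriv r R s) (at s)"
proof -
  have "((\<lambda>s. smooth_step (s / c)) has_real_derivative smooth_bump (s / c) / c) (at s)" for c
  proof -
    have "((\<lambda>s. s / c) has_real_derivative 1 / c) (at s)"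
      by (intro DERIV_cdivide DERIV_ident)
    from DERIV_chain2[where f=smooth_step and g="\<lambda>s. s / c", OF smooth_step_has_derivative this]
    show ?thesis by simp
  qed
  then show ?thesis
    unfolding cutoff_def cutoff_deriv_def by (intro DERIV_diff)
qed

lemma smooth_upto_cutoff: "smooth_upto k (cutoff r R)"
proof -
  have "smooth_upto k (\<lambda>s. smooth_step (inverse c * s + 0))" for c
    by (intro smooth_upto_affine smooth_upto_step)
  then have "smooth_upto k (\<lambda>s. smooth_step (inverse (r\<^sup>2) * s + 0) + (-1) * smooth_step (inverse (R\<^sup>2) * s + 0))"
    by (intro smooth_upto_add smooth_upto_mult smooth_upto_const)
  moreover have "(\<lambda>s. smooth_step (inverse (r\<^sup>2) * s + 0) + (-1) * smooth_step (inverse (R\<^sup>2) * s + 0)) = cutoff r R"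
    by (simp add: fun_eq_iff cutoff_def divide_inverse mult.commute)
  ultimately show ?thesis by (simp only:)
qed

context
  fixes r R :: real
  assumes r: "0 < r" and rR: "r \<le> R"
begin

lemma r_R_squares: "0 < r\<^sup>2" "0 < R\<^sup>2" "r\<^sup>2 \<le> R\<^sup>2"
  using r rR by (auto intro: power_mono)

lemma cutoff_eq_0: "s \<le> r\<^sup>2 \<or> 4 * R\<^sup>2 \<le> s \<Longrightarrow> cutoff r R s = 0"
proof (elim disjE)
  assume s: "s \<le> r\<^sup>2"
  then have "s / r\<^sup>2 \<le> 1" "s / R\<^sup>2 \<le> 1" using r_R_squares by (simp_all add: pos_le_divide_eq pos_divide_le_eq)
  then show ?thesis by (simp add: cutoff_def smooth_step_eq_0)
next
  assume s: "4 * R\<^sup>2 \<le> s"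
  then have "4 \<le> s / r\<^sup>2" "4 \<le> s / R\<^sup>2" using r_R_squares by (simp_all add: pos_le_divide_eq pos_divide_le_eq)
  then show ?thesis by (simp add: cutoff_def smooth_step_eq_1)
qed

lemma cutoff_eq_1: "4 * r\<^sup>2 \<le> s \<Longrightarrow> s \<le> R\<^sup>2 \<Longrightarrow> cutoff r R s = 1"
proof -
  assume "4 * r\<^sup>2 \<le> s" "s \<le> R\<^sup>2"
  then have "4 \<le> s / r\<^sup>2" "s / R\<^sup>2 \<le> 1" using r_R_squares by (simp_all add: pos_le_divide_eq pos_divide_le_eq)
  then show ?thesis by (simp add: cutoff_def smooth_step_eq_0 smooth_step_eq_1)
qed

lemma cutoff_nonneg: "0 \<le> cutoff r R s"
proof (cases "s \<le> r\<^sup>2")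
  case False
  then have "0 \<le> s" using r_R_squares by linarith
  then have "s / R\<^sup>2 \<le> s / r\<^sup>2" using r_R_squares by (intro divide_left_mono mult_pos_pos)
  from smooth_step_mono[OF this] show ?thesis by (simp add: cutoff_def)
qed (simp add: cutoff_eq_0)

lemma cutoff_le_1: "cutoff r R s \<le> 1"
  using smooth_step_nonneg[of "s / R\<^sup>2"] smooth_step_le_1[of "s / r\<^sup>2"] by (simp add: cutoff_def)

lemma cutoff_deriv_eq_0: "s \<le> r\<^sup>2 \<or> 4 * R\<^sup>2 \<le> s \<Longrightarrow> cutoff_deriv r R s = 0"
proof (elim disjE)
  assume s: "s \<le> r\<^sup>2"
  then have "s / r\<^sup>2 \<le> 1" "s / R\<^sup>2 \<le> 1" using r_R_squares by (simp_all add: pos_le_divide_eq pos_divide_le_eq)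
  then show ?thesis by (simp add: cutoff_deriv_def smooth_bump_eq_0)
next
  assume s: "4 * R\<^sup>2 \<le> s"
  then have "4 \<le> s / r\<^sup>2" "4 \<le> s / R\<^sup>2" using r_R_squares by (simp_all add: pos_le_divide_eq pos_divide_le_eq)
  then show ?thesis by (simp add: cutoff_deriv_def smooth_bump_eq_0)
qed

lemma smooth_upto_cutoff_div: "smooth_upto k (\<lambda>s. cutoff r R s / s)"
  using smooth_upto_div_power[of "cutoff r R" "r\<^sup>2" k 1] smooth_upto_cutoff r_R_squares cutoff_eq_0 by simp

lemma cutoff_div_has_derivative:
  "((\<lambda>s. cutoff r R s / s) has_real_derivative cutoff_deriv r R s / s - cutoff r R s / s\<^sup>2) (at s)"
proof (cases "s < r\<^sup>2")
  case True
  have "((\<lambda>s. cutoff r R s / s) has_real_derivative 0) (at s)"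
    by (rule has_derivative_zero_below[OF True]) (simp add: cutoff_eq_0)
  with True show ?thesis by (simp add: cutoff_eq_0 cutoff_deriv_eq_0)
next
  case False
  then have "s \<noteq> 0" using r_R_squares by auto
  from DERIV_divide[OF cutoff_has_derivative DERIV_ident this] this show ?thesis
    by (simp add: diff_divide_distrib power2_eq_square)
qed

lemma has_derivative_norm_sq: "((\<lambda>x::real^2. (norm x)\<^sup>2) has_derivative (\<lambda>h. 2 * (x \<bullet> h))) (at x)"
  unfolding power2_norm_eq_inner
  by (auto intro!: derivative_eq_intros simp: inner_commute)

lemma radial_compose_has_derivative:
  assumes "(H has_real_derivative H') (at ((norm (x::real^2))\<^sup>2))"
  shows "((\<lambda>x. H ((norm x)\<^sup>2)) has_derivative (\<lambda>h. H' * (2 * (x \<bullet> h)))) (at x)"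
  using has_derivative_compose[OF has_derivative_norm_sq assms[unfolded has_field_derivative_def]] .

lemma radial_field_has_derivative:
  "(radial_field r R i has_derivative (\<lambda>h. cutoff r R ((norm x)\<^sup>2) / (norm x)\<^sup>2 * h $ i +
     (cutoff_deriv r R ((norm x)\<^sup>2) / (norm x)\<^sup>2 - cutoff r R ((norm x)\<^sup>2) / ((norm x)\<^sup>2)\<^sup>2) * (2 * (x \<bullet> h)) * x $ i)) (at x)"
  unfolding radial_field_def
  by (rule has_derivative_mult[OF radial_compose_has_derivative[OF cutoff_div_has_derivative]])
    (auto intro!: bounded_linear_imp_has_derivative bounded_linear_vec_nth)

text \<open>The field \<open>x / (norm x)\<^sup>2\<close> is free of divergence away from the
  origin, so only the derivative of the cutoff survives, and this is a difference of two rescaled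
  bumps. Tested against this field, a weak gradient returns a difference of two ring means.\<close>

lemma radial_field_divergence:
  "partial_deriv 1 (radial_field r R 1) x + partial_deriv 2 (radial_field r R 2) x =
     2 * pi * (ring_weight r x - ring_weight R x)"
proof -
  have s: "(norm x)\<^sup>2 = x $ 1 * x $ 1 + x $ 2 * x $ 2" by (simp only: norm_sq_plane, simp only: power2_eq_square)
  let ?s = "(norm x)\<^sup>2"
  let ?a = "cutoff r R ?s / ?s" and ?b = "cutoff_deriv r R ?s / ?s - cutoff r R ?s / ?s\<^sup>2"
  have p: "partial_deriv i (radial_field r R i) x = ?a + ?b * (2 * x $ i) * x $ i" for i
    by (subst partial_deriv_eq[OF radial_field_has_derivative]) (simp add: inner_axis)
  have "partial_deriv 1 (radial_field r R 1) x + partial_deriv 2 (radial_field r R 2) x =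
      2 * ?a + 2 * ?b * ?s"
    proof -
    have "(a + b * (2 * p) * p) + (a + b * (2 * q) * q) = 2 * a + 2 * b * t" if "t = p * p + q * q" for a b p q t :: real
      using that by (simp add: algebra_simps)
    from this[OF s] show ?thesis unfolding p .
  qed
  also have "\<dots> = 2 * cutoff_deriv r R ?s"
  proof (cases "?s = 0")
    case True
    then show ?thesis using cutoff_eq_0[of 0] cutoff_deriv_eq_0[of 0] by simp
  next
    case False
    have "2 * (c / t) + 2 * (d / t - c / t\<^sup>2) * t = 2 * d" if "t \<noteq> 0" for c d t :: real
      using that by (simp add: field_simps power2_eq_square)
    from this[OF False] show ?thesis .
  qed
  also have "\<dots> = 2 * pi * (ring_weight r x - ring_weight R x)"
    by (simp add: cutoff_deriv_def ring_weight_def right_diff_distrib)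
  finally show ?thesis .
qed

lemma test_function_radial_field: "test_function (radial_field r R i)"
proof (rule test_functionI)
  show "C_k k (radial_field r R i)" for k
  proof -
    have "C_k k (\<lambda>x::real^2. x$1 * x$1 + x$2 * x$2)"
      by (intro C_k_add C_k_mult C_k_component)
    then have "C_k k (\<lambda>x::real^2. (norm x)\<^sup>2)"
      by (simp only: norm_sq_plane, simp only: power2_eq_square)
    from C_k_compose[OF smooth_upto_cutoff_div this] show ?thesis
      unfolding radial_field_def[abs_def] by (intro C_k_mult C_k_component)
  qed
  fix x :: "real^2" assume "2 * R < norm x"
  then have "(2 * R)\<^sup>2 \<le> (norm x)\<^sup>2" using r rR by (intro power_mono) auto
  then show "radial_field r R i x = 0" by (simp add: radial_field_def cutoff_eq_0)
qed

lemma radial_field_square_le: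
  "(radial_field r R 1 x)\<^sup>2 + (radial_field r R 2 x)\<^sup>2 \<le> indicat_real {x. r \<le> norm x \<and> norm x \<le> 2 * R} x / (norm x)\<^sup>2"
proof (cases "r \<le> norm x \<and> norm x \<le> 2 * R")
  case True
  then have nz: "(norm x)\<^sup>2 \<noteq> 0" using r by auto
  have "(radial_field r R 1 x)\<^sup>2 + (radial_field r R 2 x)\<^sup>2 = (cutoff r R ((norm x)\<^sup>2))\<^sup>2 / ((norm x)\<^sup>2)\<^sup>2 * ((x$1)\<^sup>2 + (x$2)\<^sup>2)"
    by (simp add: radial_field_def power_mult_distrib power_divide distrib_left)
  also have "\<dots> = (cutoff r R ((norm x)\<^sup>2))\<^sup>2 / (norm x)\<^sup>2"
  proof -
    have "c / t\<^sup>2 * t = c / t" if "t \<noteq> 0" for c t :: real using that by (simp add: power2_eq_square)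
    from this[OF nz] show ?thesis unfolding norm_sq_plane[symmetric] .
  qed
  also have "\<dots> \<le> 1 / (norm x)\<^sup>2"
    using cutoff_nonneg cutoff_le_1 by (intro divide_right_mono power_le_one) auto
  finally show ?thesis using True by simp
next
  case False
  have "(norm x)\<^sup>2 \<le> r\<^sup>2 \<or> 4 * R\<^sup>2 \<le> (norm x)\<^sup>2"
  proof (cases "norm x < r")
    case True
    then show ?thesis by (simp add: power_mono)
  next
    case F: False
    with False have "2 * R \<le> norm x" by simp
    then have "(2 * R)\<^sup>2 \<le> (norm x)\<^sup>2" using r rR by (intro power_mono) auto
    then show ?thesis by simp
  qed
  then have "radial_field r R i x = 0" for i by (simp add: radial_field_def cutoff_eq_0)
  with False show ?thesis by simp
qed

end

section \<open>Size and mass of the ring weights, and logarithmic integrals over annuli\<close>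

lemma ring_weight_measurable [measurable]: "ring_weight R \<in> borel_measurable borel"
proof -
  have [measurable]: "smooth_bump \<in> borel_measurable borel"
    using smooth_upto_bump[of 0] by (auto intro: borel_measurable_continuous_onI)
  show ?thesis unfolding ring_weight_def by measurable
qed

lemma ring_weight_nonneg: "0 \<le> ring_weight R x"
  by (simp add: ring_weight_def smooth_bump_nonneg)

lemma ring_weight_eq_0:
  assumes "0 < R" "norm x \<le> R \<or> 2 * R \<le> norm x"
  shows "ring_weight R x = 0"
proof -
  have "(norm x)\<^sup>2 \<le> R\<^sup>2 \<or> (2 * R)\<^sup>2 \<le> (norm x)\<^sup>2"
    using assms power_mono[of "norm x" R 2] power_mono[of "2 * R" "norm x" 2] by auto
  then have "(norm x)\<^sup>2 / R\<^sup>2 \<le> 1 \<or> 4 \<le> (norm x)\<^sup>2 / R\<^sup>2"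
    using assms by (auto simp: field_simps)
  then show ?thesis by (auto simp: ring_weight_def smooth_bump_eq_0)
qed

text \<open>All weights are rescalings of one profile, so one \<open>B\<close> serves every radius;
  this makes the Poincare constant of the rings independent of the scale.\<close>

lemma ring_weight_bounded: "\<exists>B>0. \<forall>R>0. \<forall>x. ring_weight R x \<le> B / R\<^sup>2"
proof -
  have "continuous_on UNIV smooth_bump" using smooth_upto_bump[of 0] by simp
  moreover have "smooth_bump s = 0" if "4 < norm s" for s
    using that smooth_bump_eq_0[of s] by (auto simp: abs_if split: if_splits)
  ultimately obtain M where M: "0 < M" "\<And>s. norm (smooth_bump s) \<le> M"
    using continuous_compact_support_bounded[of smooth_bump 4] by blast
  have "ring_weight R x \<le> (M / pi) / R\<^sup>2" if "0 < R" for R x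
    using M(2)[of "(norm x)\<^sup>2 / R\<^sup>2"] that by (simp add: ring_weight_def field_simps smooth_bump_nonneg)
  with M(1) show ?thesis by (intro exI[of _ "M / pi"]) auto
qed

lemma ring_weight_mass:
  assumes "0 < R"
  shows "(\<integral>\<^sup>+x. ennreal (ring_weight R x) \<partial>lborel) = 1"
proof -
  have [measurable]: "smooth_bump \<in> borel_measurable borel"
    using smooth_upto_bump[of 0] by (auto intro: borel_measurable_continuous_onI)
  let ?f = "\<lambda>s. smooth_bump (s / R\<^sup>2) / R\<^sup>2"
  have "(\<integral>\<^sup>+x. ennreal (ring_weight R x) \<partial>lborel) = (\<integral>\<^sup>+x. ennreal (?f ((norm (x::real^2))\<^sup>2) / pi) \<partial>lborel)"
    by (simp add: ring_weight_def field_simps)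
  also have "\<dots> = ennreal pi * (\<integral>\<^sup>+s. ennreal (?f s / pi) * indicator {0..} s \<partial>lborel)"
    by (subst nn_integral_radial[of "\<lambda>s. ennreal (?f s / pi)"]) auto
  also have "\<dots> = (\<integral>\<^sup>+s. ennreal pi * (ennreal (?f s / pi) * indicator {0..} s) \<partial>lborel)"
    by (rule nn_integral_cmult[symmetric]) measurable
  also have "\<dots> = (\<integral>\<^sup>+s. ennreal (?f s) * indicator {0..4 * R\<^sup>2} s \<partial>lborel)"
  proof (rule nn_integral_cong)
    fix s
    have "?f s = 0" if "4 * R\<^sup>2 < s"
      using that assms smooth_bump_eq_0[of "s / R\<^sup>2"] by (simp add: field_simps)
    moreover have "ennreal pi * ennreal (?f s / pi) = ennreal (?f s)"
      by (subst ennreal_mult'[symmetric]) auto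
    ultimately show "ennreal pi * (ennreal (?f s / pi) * indicator {0..} s) = ennreal (?f s) * indicator {0..4 * R\<^sup>2} s"
      by (cases "4 * R\<^sup>2 < s") (auto simp: indicator_def)
  qed
  also have "\<dots> = ennreal (smooth_step (4 * R\<^sup>2 / R\<^sup>2) - smooth_step (0 / R\<^sup>2))"
  proof (rule nn_integral_FTC_Icc)
    fix s
    have "((\<lambda>s. s / R\<^sup>2) has_real_derivative 1 / R\<^sup>2) (at s)"
      by (intro DERIV_cdivide DERIV_ident)
    from DERIV_chain2[where f=smooth_step and g="\<lambda>s. s / R\<^sup>2", OF smooth_step_has_derivative this]
    show "((\<lambda>s. smooth_step (s / R\<^sup>2)) has_real_derivative ?f s) (at s)" by simp
  qed (use smooth_bump_nonneg in auto)
  also have "\<dots> = 1" using assms by (simp add: smooth_step_eq_0 smooth_step_eq_1)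
  finally show ?thesis .
qed

lemma nn_integral_annulus:
  assumes "0 < a" "a \<le> b"
  shows "(\<integral>\<^sup>+x. ennreal (indicat_real {x. a \<le> norm x \<and> norm x \<le> b} x / (norm (x::real^2))\<^sup>2) \<partial>lborel) = ennreal (2 * pi * ln (b / a))"
proof -
  let ?f = "\<lambda>s::real. ennreal (1 / s) * indicator {a\<^sup>2..b\<^sup>2} s"
  have sq: "a \<le> norm x \<and> norm x \<le> b \<longleftrightarrow> a\<^sup>2 \<le> (norm x)\<^sup>2 \<and> (norm x)\<^sup>2 \<le> b\<^sup>2" for x :: "real^2"
    using assms by (simp add: power2_le_iff_abs_le abs_le_square_iff[symmetric])
  have "(\<integral>\<^sup>+x. ennreal (indicat_real {x. a \<le> norm x \<and> norm x \<le> b} x / (norm (x::real^2))\<^sup>2) \<partial>lborel)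
      = (\<integral>\<^sup>+x. ?f ((norm (x::real^2))\<^sup>2) \<partial>lborel)"
    by (rule nn_integral_cong) (auto simp: indicator_def sq)
  also have "\<dots> = ennreal pi * (\<integral>\<^sup>+s. ?f s * indicator {0..} s \<partial>lborel)"
    by (rule nn_integral_radial) measurable
  also have "(\<integral>\<^sup>+s. ?f s * indicator {0..} s \<partial>lborel) = (\<integral>\<^sup>+s. ?f s \<partial>lborel)"
    by (rule nn_integral_cong) (use assms in \<open>auto simp: indicator_def intro: order_trans[OF zero_le_power2]\<close>)
  also have "\<dots> = ennreal (ln (b\<^sup>2) - ln (a\<^sup>2))"
  proof (rule nn_integral_FTC_Icc)
    show "a\<^sup>2 \<le> b\<^sup>2" using assms by (intro power_mono) auto
    fix s assume s: "s \<in> {a\<^sup>2..b\<^sup>2}"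
    have "0 < a\<^sup>2" using assms by simp
    with s have "0 < s" by (metis atLeastAtMost_iff less_le_trans)
    then show "(ln has_real_derivative 1 / s) (at s)" "0 \<le> 1 / s"
      by (auto intro!: derivative_eq_intros)
  qed measurable
  also have "ennreal pi * \<dots> = ennreal (pi * (ln (b\<^sup>2) - ln (a\<^sup>2)))"
    by (simp add: ennreal_mult')
  also have "pi * (ln (b\<^sup>2) - ln (a\<^sup>2)) = 2 * pi * ln (b / a)"
    using assms by (simp add: ln_div power2_eq_square ln_mult)
  finally show ?thesis .
qed

lemma annulus_integral:
  assumes "0 < a" "a \<le> b"
  shows "integrable lborel (\<lambda>x::real^2. indicat_real {x. a \<le> norm x \<and> norm x \<le> b} x / (norm x)\<^sup>2)"
    and "(\<integral>x. indicat_real {x::real^2. a \<le> norm x \<and> norm x \<le> b} x / (norm x)\<^sup>2 \<partial>lborel) = 2 * pi * ln (b / a)"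
proof -
  have "0 \<le> ln (b / a)" using assms by simp
  then have "has_bochner_integral lborel (\<lambda>x::real^2. indicat_real {x. a \<le> norm x \<and> norm x \<le> b} x / (norm x)\<^sup>2) (2 * pi * ln (b / a))"
    using nn_integral_annulus[OF assms] by (intro has_bochner_integral_nn_integral) auto
  then show "integrable lborel (\<lambda>x::real^2. indicat_real {x. a \<le> norm x \<and> norm x \<le> b} x / (norm x)\<^sup>2)"
    "(\<integral>x. indicat_real {x::real^2. a \<le> norm x \<and> norm x \<le> b} x / (norm x)\<^sup>2 \<partial>lborel) = 2 * pi * ln (b / a)"
    by (simp_all add: has_bochner_integral_iff)
qed

lemma cauchy_schwarz_integral:
  fixes f g :: "'a \<Rightarrow> real"
  assumes [measurable]: "f \<in> borel_measurable M" "g \<in> borel_measurable M"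
    and f: "integrable M (\<lambda>x. (f x)\<^sup>2)" and g: "integrable M (\<lambda>x. (g x)\<^sup>2)"
  shows "integrable M (\<lambda>x. f x * g x)"
    and "(\<integral>x. f x * g x \<partial>M) \<le> sqrt ((\<integral>x. (f x)\<^sup>2 \<partial>M) * (\<integral>x. (g x)\<^sup>2 \<partial>M))"
proof -
  have bd: "\<bar>a * b\<bar> \<le> a\<^sup>2 + b\<^sup>2" for a b :: real
  proof -
    have "2 * \<bar>a * b\<bar> \<le> a\<^sup>2 + b\<^sup>2"
      using zero_le_power2[of "\<bar>a\<bar> - \<bar>b\<bar>"] by (simp add: power2_diff abs_mult)
    then show ?thesis by linarith
  qed
  show fg: "integrable M (\<lambda>x. f x * g x)"
    by (rule Bochner_Integration.integrable_bound[OF Bochner_Integration.integrable_add[OF f g]])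
      (use bd in \<open>auto intro!: AE_I2\<close>)
  let ?a = "\<integral>x. (f x)\<^sup>2 \<partial>M" and ?b = "\<integral>x. (g x)\<^sup>2 \<partial>M" and ?p = "\<integral>x. f x * g x \<partial>M"
  have a: "0 \<le> ?a" by (intro Bochner_Integration.integral_nonneg) auto
  have q: "0 \<le> t\<^sup>2 * ?a - 2 * t * ?p + ?b" for t
  proof -
    have "0 \<le> (\<integral>x. (t * f x - g x)\<^sup>2 \<partial>M)" by (intro Bochner_Integration.integral_nonneg) auto
    also have "\<dots> = (\<integral>x. t\<^sup>2 * (f x)\<^sup>2 - 2 * t * (f x * g x) + (g x)\<^sup>2 \<partial>M)"
      by (simp add: power2_diff power_mult_distrib algebra_simps)
    also have "\<dots> = t\<^sup>2 * ?a - 2 * t * ?p + ?b" using f g fg by simp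
    finally show ?thesis .
  qed
  have "?p\<^sup>2 \<le> ?a * ?b"
  proof (cases "?a = 0")
    case True
    have "?p = 0"
    proof (rule ccontr)
      assume "?p \<noteq> 0"
      \<comment> \<open>With \<open>?a = 0\<close> the quadratic is linear in \<open>t\<close>, and
        this \<open>t\<close> gives it the value -1.\<close>
      then show False using q[of "(?b + 1) / (2 * ?p)"] True by simp
    qed
    then show ?thesis using True by simp
  next
    case False
    then have "0 < ?a" using a by linarith
    have "0 \<le> ?a * ((?p / ?a)\<^sup>2 * ?a - 2 * (?p / ?a) * ?p + ?b)"
      using q[of "?p / ?a"] a by (intro mult_nonneg_nonneg)
    also have "\<dots> = ?a * ?b - ?p\<^sup>2"
      using False by (simp add: power2_eq_square algebra_simps)
    finally show ?thesis by simp
  qed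
  then show "?p \<le> sqrt (?a * ?b)" by (rule real_le_rsqrt)
qed

text \<open>Young's inequality with a weight: for small \<open>\<tau>\<close> the first square keeps
  a factor close to 1 at the price of a large factor on the second. It is applied with
  \<open>\<tau> = lam j\<close>, the first term being the annulus where the constant has to stay
  sharp.\<close>

lemma square_add_le:
  fixes u v \<tau> :: real
  assumes "0 < \<tau>"
  shows "(u + v)\<^sup>2 \<le> (1 + \<tau>) * u\<^sup>2 + (1 + 1 / \<tau>) * v\<^sup>2"
proof -
  have "0 \<le> (\<tau> * u - v)\<^sup>2 / \<tau>" using assms by (intro divide_nonneg_pos) auto
  also have "(\<tau> * u - v)\<^sup>2 / \<tau> = \<tau> * u\<^sup>2 - 2 * u * v + v\<^sup>2 / \<tau>"
    using assms by (simp add: power2_eq_square field_simps)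
  finally show ?thesis by (simp add: power2_sum algebra_simps)
qed

section \<open>Ring means and their differences\<close>

context sobolev_pair
begin

lemma grad_energy_mono:
  assumes "A \<subseteq> B" "A \<in> sets borel" "B \<in> sets borel"
  shows "grad_energy A \<le> grad_energy B"
  unfolding grad_energy_def
  by (rule integral_mono[OF grad_energy_integrable[OF assms(2)] grad_energy_integrable[OF assms(3)]])
    (use assms grad_sq_nonneg in \<open>auto simp: indicator_def\<close>)

lemma grad_energy_Un:
  assumes "A \<inter> B = {}" "A \<in> sets borel" "B \<in> sets borel"
  shows "grad_energy (A \<union> B) = grad_energy A + grad_energy B"
proof -
  have "grad_energy (A \<union> B) = (\<integral>x. indicat_real A x * grad_sq x + indicat_real B x * grad_sq x \<partial>lborel)"
    unfolding grad_energy_def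
    by (rule Bochner_Integration.integral_cong) (use assms in \<open>auto simp: indicator_def\<close>)
  then show ?thesis
    unfolding grad_energy_def using assms grad_energy_integrable by simp
qed

definition ring_mean :: "real \<Rightarrow> complex" where
  "ring_mean R = (\<integral>x. complex_of_real (ring_weight R x) * w x \<partial>lborel)"

lemma ring_weight_times_integrable:
  assumes "0 < R"
  shows "integrable lborel (\<lambda>x. complex_of_real (ring_weight R x) * w x)"
    and "integrable lborel (\<lambda>x. ring_weight R x * (cmod (w x))\<^sup>2)"
proof -
  obtain B where B: "\<And>x. ring_weight R x \<le> B / R\<^sup>2"
    using ring_weight_bounded assms by blast
  show "integrable lborel (\<lambda>x. ring_weight R x * (cmod (w x))\<^sup>2)"
    by (rule Bochner_Integration.integrable_bound[OF integrable_mult_right[OF w_sq, of "B / R\<^sup>2"]])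
      (auto intro!: AE_I2 mult_right_mono order_trans[OF B abs_ge_self] simp: abs_mult ring_weight_nonneg simp del: times_divide_eq_left abs_divide)
  have "integrable lborel (\<lambda>x. indicat_real (cball 0 (2 * R)) x *\<^sub>R w x)"
    using locally_integrable_w by (simp add: locally_integrable_def)
  then have "integrable lborel (\<lambda>x. (B / R\<^sup>2) *\<^sub>R (indicat_real (cball 0 (2 * R)) x *\<^sub>R w x))"
    by (rule integrable_scaleR_right)
  then show "integrable lborel (\<lambda>x. complex_of_real (ring_weight R x) * w x)"
  proof (rule Bochner_Integration.integrable_bound)
    show "AE x in lborel. cmod (complex_of_real (ring_weight R x) * w x) \<le> cmod ((B / R\<^sup>2) *\<^sub>R (indicat_real (cball 0 (2 * R)) x *\<^sub>R w x))"
    proof (rule AE_I2)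
      fix x
      show "cmod (complex_of_real (ring_weight R x) * w x) \<le> cmod ((B / R\<^sup>2) *\<^sub>R (indicat_real (cball 0 (2 * R)) x *\<^sub>R w x))"
      proof (cases "norm x \<le> 2 * R")
        case True
        have "cmod (complex_of_real (ring_weight R x) * w x) = ring_weight R x * cmod (w x)"
          by (simp add: norm_mult ring_weight_nonneg)
        also have "\<dots> \<le> \<bar>B / R\<^sup>2\<bar> * cmod (w x)"
          by (intro mult_right_mono order_trans[OF B abs_ge_self]) auto
        finally show ?thesis using True by (simp add: indicator_def)
      next
        case False
        then show ?thesis using ring_weight_eq_0[OF assms, of x] by simp
      qed
    qed
  qed measurable
qed

text \<open>The powers of \<open>R\<close> cancel, so the constant is the same for all rings. The
  weight is supported up to radius \<open>2 * R\<close>, which turns the factor 3 of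
  \<open>poincare\<close> into 6.\<close>

lemma ring_poincare:
  assumes B: "\<And>R x. 0 < R \<Longrightarrow> ring_weight R x \<le> B / R\<^sup>2" and "0 < R"
  shows "(\<integral>x. ring_weight R x * (cmod (w x))\<^sup>2 \<partial>lborel)
     \<le> (cmod (ring_mean R))\<^sup>2 + 256 * pi * B\<^sup>2 * grad_energy (cball 0 (6 * R))"
proof -
  have "(\<integral>x. ring_weight R x * (cmod (w x))\<^sup>2 \<partial>lborel)
     \<le> (cmod (ring_mean R))\<^sup>2 + 16 * pi * (B / R\<^sup>2)\<^sup>2 * (2 * R) ^ 4 * grad_energy (cball 0 (3 * (2 * R)))"
    unfolding ring_mean_def
    by (rule poincare) (use assms ring_weight_mass ring_weight_eq_0 in \<open>auto simp: ring_weight_nonneg\<close>)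
  also have "16 * pi * (B / R\<^sup>2)\<^sup>2 * (2 * R) ^ 4 = 256 * pi * B\<^sup>2"
    using \<open>0 < R\<close> by (simp add: power2_eq_square power4_eq_xxxx)
  finally show ?thesis by simp
qed

text \<open>Duality with \<open>radial_field r R\<close>, whose squared length is at most
  \<open>1 / (norm x)\<^sup>2\<close> on its annulus; the integral of this bound gives the
  logarithms. The cut at \<open>q\<close> keeps the energies inside and outside \<open>q\<close>
  apart, since only the outer one is to be weighted with the sharp constant.\<close>

lemma ring_mean_diff_le:
  assumes r: "0 < r" and rq: "r \<le> q" and qR: "q \<le> R"
  shows "2 * pi * cmod (ring_mean r - ring_mean R) \<le>
    sqrt (2 * pi * ln (2 * R / q) * grad_energy {x. q < norm x \<and> norm x \<le> 2 * R}) +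
    sqrt (2 * pi * ln (q / r) * grad_energy (cball 0 q))"
proof -
  have rR: "r \<le> R" "0 < R" "0 < q" "q \<le> 2 * R" using assms by auto
  let ?F = "radial_field r R"
  let ?A = "{x::real^2. q < norm x \<and> norm x \<le> 2 * R}"
  have [measurable]: "?A \<in> sets borel" "cball (0::real^2) q \<in> sets borel" by measurable
  have test: "test_function (?F i)" for i by (rule test_function_radial_field[OF r rR(1)])
  have [measurable]: "?F i \<in> borel_measurable borel" for i
    by (rule borel_measurable_continuous_onI[OF test_function_continuous[OF test]])
  have int_g: "integrable lborel (\<lambda>x. complex_of_real (?F i x) * g i x)" for i
    by (rule integrable_test_function_times[OF locally_integrable_g test])
  have int_w: "integrable lborel (\<lambda>x. complex_of_real (partial_deriv i (?F i) x) * w x)" for i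
    by (rule integrable_test_function_times[OF locally_integrable_w test_function_partial_deriv[OF test]])
  have "2 * pi * (ring_mean r - ring_mean R) = (\<integral>x. complex_of_real (2 * pi * (ring_weight r x - ring_weight R x)) * w x \<partial>lborel)"
  proof -
    have "(\<integral>x. complex_of_real (2 * pi * (ring_weight r x - ring_weight R x)) * w x \<partial>lborel) =
        (\<integral>x. complex_of_real (2 * pi) * (complex_of_real (ring_weight r x) * w x - complex_of_real (ring_weight R x) * w x) \<partial>lborel)"
      by (simp add: algebra_simps)
    also have "\<dots> = 2 * pi * (ring_mean r - ring_mean R)"
      unfolding ring_mean_def integral_mult_right_zero
      using ring_weight_times_integrable(1)[OF r] ring_weight_times_integrable(1)[OF rR(2)] by simp
    finally show ?thesis ..
  qed
  also have "\<dots> = (\<integral>x. complex_of_real (partial_deriv 1 (?F 1) x) * w x + complex_of_real (partial_deriv 2 (?F 2) x) * w x \<partial>lborel)"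
    by (simp only: radial_field_divergence[OF r rR(1), symmetric] of_real_add distrib_right)
  also have "\<dots> = - (\<integral>x. complex_of_real (?F 1 x) * g 1 x + complex_of_real (?F 2 x) * g 2 x \<partial>lborel)"
    using int_w int_g by (simp add: weak[OF test])
  finally have "cmod (2 * pi * (ring_mean r - ring_mean R)) \<le>
      (\<integral>x. cmod (complex_of_real (?F 1 x) * g 1 x + complex_of_real (?F 2 x) * g 2 x) \<partial>lborel)"
    by (simp only: norm_minus_cancel integral_norm_bound)
  also have "cmod (2 * pi * (ring_mean r - ring_mean R)) = 2 * pi * cmod (ring_mean r - ring_mean R)"
    by (simp add: norm_mult)
  finally have bound: "2 * pi * cmod (ring_mean r - ring_mean R) \<le>
      (\<integral>x. cmod (complex_of_real (?F 1 x) * g 1 x + complex_of_real (?F 2 x) * g 2 x) \<partial>lborel)" .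
  \<comment> \<open>\<open>k r (2 * R)\<close> dominates the length of the test field, and
    \<open>G A\<close> is the length of the gradient on \<open>A\<close>. After the cut at
    \<open>q\<close>, Cauchy-Schwarz is applied to each of the two products.\<close>
  define k where "k a b x = indicat_real {x. a \<le> norm x \<and> norm x \<le> b} x / norm x" for a b and x :: "real^2"
  have [measurable]: "k a b \<in> borel_measurable borel" for a b unfolding k_def by measurable
  have k_sq: "(k a b x)\<^sup>2 = indicat_real {x. a \<le> norm x \<and> norm x \<le> b} x / (norm x)\<^sup>2" for a b x
    by (simp add: k_def power_divide indicator_def)
  define G where "G A x = indicat_real A x * sqrt (grad_sq x)" for A x
  have G_sq: "(G A x)\<^sup>2 = indicat_real A x * grad_sq x" for A x
    by (simp add: G_def power_mult_distrib grad_sq_nonneg indicator_def)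
  have [measurable]: "G A \<in> borel_measurable borel" if "A \<in> sets borel" for A
    using that unfolding G_def by measurable
  have cs: "integrable lborel (\<lambda>x. k a b x * G A x)"
    "(\<integral>x. k a b x * G A x \<partial>lborel) \<le> sqrt (2 * pi * ln (b / a) * grad_energy A)"
    if "0 < a" "a \<le> b" "A \<in> sets borel" for a b A
  proof -
    have f: "integrable lborel (\<lambda>x. (k a b x)\<^sup>2)" "(\<integral>x. (k a b x)\<^sup>2 \<partial>lborel) = 2 * pi * ln (b / a)"
      unfolding k_sq using annulus_integral[OF that(1,2)] by auto
    have g: "integrable lborel (\<lambda>x. (G A x)\<^sup>2)" "(\<integral>x. (G A x)\<^sup>2 \<partial>lborel) = grad_energy A"
      unfolding G_sq using grad_energy_integrable[OF that(3)] by (auto simp: grad_energy_def)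
    show "integrable lborel (\<lambda>x. k a b x * G A x)"
      by (rule cauchy_schwarz_integral(1)) (use f g that in auto)
    show "(\<integral>x. k a b x * G A x \<partial>lborel) \<le> sqrt (2 * pi * ln (b / a) * grad_energy A)"
      using cauchy_schwarz_integral(2)[of "k a b" lborel "G A"] f g that by simp
  qed
  have "(\<integral>x. cmod (complex_of_real (?F 1 x) * g 1 x + complex_of_real (?F 2 x) * g 2 x) \<partial>lborel)
      \<le> (\<integral>x. k q (2 * R) x * G ?A x + k r q x * G (cball 0 q) x \<partial>lborel)"
  proof (rule integral_mono)
    show "integrable lborel (\<lambda>x. cmod (complex_of_real (?F 1 x) * g 1 x + complex_of_real (?F 2 x) * g 2 x))"
      using int_g by (intro integrable_norm Bochner_Integration.integrable_add)
    show "integrable lborel (\<lambda>x. k q (2 * R) x * G ?A x + k r q x * G (cball 0 q) x)"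
      using cs(1) rR r rq by (intro Bochner_Integration.integrable_add) auto
    fix x
    have csr: "u1 * v1 + u2 * v2 \<le> sqrt (u1\<^sup>2 + u2\<^sup>2) * sqrt (v1\<^sup>2 + v2\<^sup>2)" for u1 u2 v1 v2 :: real
    proof -
      have "(u1 * v1 + u2 * v2)\<^sup>2 \<le> (u1\<^sup>2 + u2\<^sup>2) * (v1\<^sup>2 + v2\<^sup>2)"
        using zero_le_power2[of "u1 * v2 - u2 * v1"] by (simp add: power2_eq_square algebra_simps)
      from real_le_rsqrt[OF this] show ?thesis by (simp add: real_sqrt_mult)
    qed
    have "cmod (complex_of_real (?F 1 x) * g 1 x + complex_of_real (?F 2 x) * g 2 x)
        \<le> \<bar>?F 1 x\<bar> * cmod (g 1 x) + \<bar>?F 2 x\<bar> * cmod (g 2 x)"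
      by (rule order_trans[OF norm_triangle_ineq]) (simp add: norm_mult)
    also have "\<dots> \<le> sqrt ((?F 1 x)\<^sup>2 + (?F 2 x)\<^sup>2) * sqrt (grad_sq x)"
      using csr[of "\<bar>?F 1 x\<bar>" "cmod (g 1 x)" "\<bar>?F 2 x\<bar>" "cmod (g 2 x)"] by (simp add: grad_sq_def)
    also have "\<dots> \<le> k r (2 * R) x * sqrt (grad_sq x)"
    proof (rule mult_right_mono)
      have "sqrt ((?F 1 x)\<^sup>2 + (?F 2 x)\<^sup>2) \<le> sqrt ((k r (2 * R) x)\<^sup>2)"
        unfolding k_sq using radial_field_square_le[OF r rR(1)] by (intro real_sqrt_le_mono)
      then show "sqrt ((?F 1 x)\<^sup>2 + (?F 2 x)\<^sup>2) \<le> k r (2 * R) x" by (simp add: k_def)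
    qed (simp add: grad_sq_nonneg)
    also have "\<dots> \<le> k q (2 * R) x * G ?A x + k r q x * G (cball 0 q) x"
      using grad_sq_nonneg[of x] by (auto simp: k_def G_def indicator_def)
    finally show "cmod (complex_of_real (?F 1 x) * g 1 x + complex_of_real (?F 2 x) * g 2 x)
      \<le> k q (2 * R) x * G ?A x + k r q x * G (cball 0 q) x" .
  qed
  also have "\<dots> = (\<integral>x. k q (2 * R) x * G ?A x \<partial>lborel) + (\<integral>x. k r q x * G (cball 0 q) x \<partial>lborel)"
    using cs(1) rR r rq by (intro Bochner_Integration.integral_add) auto
  also have "\<dots> \<le> sqrt (2 * pi * ln (2 * R / q) * grad_energy ?A) + sqrt (2 * pi * ln (q / r) * grad_energy (cball 0 q))"
    using cs(2) rR r rq by (intro add_mono) auto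
  finally show ?thesis using bound by linarith
qed

lemma ring_mean_diff_square_le:
  assumes "0 < r" "r \<le> q" "q \<le> R" "0 < \<tau>"
  shows "2 * pi * (cmod (ring_mean r - ring_mean R))\<^sup>2 \<le>
    (1 + \<tau>) * ln (2 * R / q) * grad_energy {x. q < norm x \<and> norm x \<le> 2 * R} +
    (1 + 1 / \<tau>) * ln (q / r) * grad_energy (cball 0 q)"
proof -
  let ?u = "2 * pi * ln (2 * R / q) * grad_energy {x. q < norm x \<and> norm x \<le> 2 * R}"
  let ?v = "2 * pi * ln (q / r) * grad_energy (cball 0 q)"
  have nn: "0 \<le> ?u" "0 \<le> ?v"
    using assms grad_energy_nonneg by (auto intro!: mult_nonneg_nonneg)
  have "(2 * pi * cmod (ring_mean r - ring_mean R))\<^sup>2 \<le> (sqrt ?u + sqrt ?v)\<^sup>2"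
    using ring_mean_diff_le[OF assms(1-3)] by (intro power_mono) auto
  also have "\<dots> \<le> (1 + \<tau>) * (sqrt ?u)\<^sup>2 + (1 + 1 / \<tau>) * (sqrt ?v)\<^sup>2"
    by (rule square_add_le[OF assms(4)])
  also have "\<dots> = (1 + \<tau>) * ?u + (1 + 1 / \<tau>) * ?v" using nn by simp
  also have "\<dots> = (2 * pi) * ((1 + \<tau>) * ln (2 * R / q) * grad_energy {x. q < norm x \<and> norm x \<le> 2 * R} +
    (1 + 1 / \<tau>) * ln (q / r) * grad_energy (cball 0 q))" by (simp add: algebra_simps)
  finally have "(2 * pi) * (2 * pi * (cmod (ring_mean r - ring_mean R))\<^sup>2) \<le> (2 * pi) * ((1 + \<tau>) * ln (2 * R / q) * grad_energy {x. q < norm x \<and> norm x \<le> 2 * R} +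
    (1 + 1 / \<tau>) * ln (q / r) * grad_energy (cball 0 q))" by (simp add: power2_eq_square mult_ac)
  then show ?thesis by (subst (asm) mult_le_cancel_left_pos) auto
qed

end

section \<open>Sparse wells: nonnegativity of the energy\<close>

text \<open>
  Bookkeeping of the locale: \<open>c j\<close> is the nominal critical coupling of well \<open>j\<close> inside its window
  \<open>a j < b j\<close>, \<open>lam j\<close> measures the fraction of the energy on the ring between \<open>q j\<close> and
  \<open>q (Suc j)\<close> that subcritical couplings leave unspent, \<open>kap j\<close> bounds all lower order losses of
  well \<open>j\<close>, and \<open>mu n\<close> is the fraction of the energy inside radius \<open>q n\<close> that the first
  \<open>n\<close> wells leave unspent.
\<close>

locale wells =
  fixes a b c lam kap mu R q :: "nat \<Rightarrow> real" and B :: real and gam :: "nat \<Rightarrow> real"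
  assumes a_pos: "\<And>j. 0 < a j" and a_less_c: "\<And>j. a j < c j" and c_less_b: "\<And>j. c j < b j"
    and B: "\<And>R x. 0 < R \<Longrightarrow> ring_weight R x \<le> B / R\<^sup>2"
    and lam_pos: "\<And>j. 0 < lam j" and lam: "\<And>j. (1 + lam j) * a j \<le> (1 - 2 * lam j) * c j"
    and kap_pos: "\<And>j. 0 < kap j"
    and mu_0: "mu 0 = 1" and mu_pos: "\<And>j. 0 < mu j"
    and mu_kap: "\<And>j. mu (Suc j) \<le> mu j - 2 * kap j" and mu_lam: "\<And>j. mu (Suc j) \<le> 2 * lam j - 2 * kap j"
    and q_0: "q 0 = 1" and q_R: "\<And>j. 4 * q j < R j" and R_q: "\<And>j. 9 * R j < q (Suc j)"
    and gam_def: "\<And>j. gam j = 2 * pi / (c j * ln (2 * R j / q j))"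
    and gam_poincare: "\<And>j. 256 * pi * B\<^sup>2 * gam j \<le> kap j"
    and gam_inner: "\<And>j. (1 + 1 / lam j) * ln (q j) / ln (2 * R j / q j) \<le> kap j"
    and gam_summable: "\<And>j. gam j \<le> (1 / 2) ^ j"
    and gam_tent: "\<And>j. 2 * pi * ln (R j / q j) / (ln (R j / (4 * q j)))\<^sup>2 +
      2 * pi * ln (q (Suc j) / (2 * R j)) / (ln (q (Suc j) / (8 * R j)))\<^sup>2 < b j * gam j"
begin

definition potential :: "real^2 \<Rightarrow> real" where
  "potential x = (\<Sum>j. gam j * ring_weight (R j) x)"

lemma q_ge_1: "1 \<le> q j"
proof (induction j)
  case (Suc j)
  then show ?case using q_R[of j] R_q[of j] by linarith
qed (simp add: q_0)

lemma R_gt_4: "4 < R j" using q_ge_1[of j] q_R[of j] by linarith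

lemma R_pos: "0 < R j" using R_gt_4[of j] by linarith

lemma R_0_le_q: "0 < j \<Longrightarrow> R 0 \<le> q j"
proof (induction j)
  case (Suc j)
  then show ?case using R_q[of j] R_gt_4[of j] q_R[of j] q_ge_1[of j] by (cases j) auto
qed auto

lemma c_pos: "0 < c j" using a_pos[of j] a_less_c[of j] by linarith

lemma b_pos: "0 < b j" using c_pos[of j] c_less_b[of j] by linarith

lemma ln_pos: "0 < ln (2 * R j / q j)"
proof -
  have "q j < 2 * R j" using q_R[of j] q_ge_1[of j] by linarith
  then show ?thesis using q_ge_1[of j] by (intro ln_gt_zero) (auto simp: field_simps)
qed

lemma gam_pos: "0 < gam j"
  unfolding gam_def using c_pos ln_pos by (intro divide_pos_pos mult_pos_pos) auto

lemma B_nonneg: "0 \<le> B" using B[of 1 0] ring_weight_nonneg[of 1 0] by simp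

lemma ring_weight_le_B: "ring_weight (R j) x \<le> B"
proof -
  have "ring_weight (R j) x \<le> B / (R j)\<^sup>2" by (rule B[OF R_pos])
  also have "\<dots> \<le> B / 1"
    using R_gt_4[of j] B_nonneg by (intro divide_left_mono) auto
  finally show ?thesis by simp
qed

lemma term_nonneg: "0 \<le> gam j * ring_weight (R j) x"
  using gam_pos[of j] ring_weight_nonneg[of "R j" x] by simp

lemma summable_gam: "summable gam"
  by (rule summable_comparison_test'[of "\<lambda>j. (1/2)^j" 0])
    (use gam_summable gam_pos in \<open>auto simp: less_imp_le abs_of_pos intro: summable_geometric\<close>)

lemma summable_potential: "summable (\<lambda>j. gam j * ring_weight (R j) x)"
proof (rule summable_comparison_test'[of "\<lambda>j. gam j * B" 0])
  show "summable (\<lambda>j. gam j * B)" by (intro summable_mult2 summable_gam)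
  show "norm (gam j * ring_weight (R j) x) \<le> gam j * B" for j
    using ring_weight_le_B[of j x] gam_pos[of j] term_nonneg[of j x] by (simp add: less_imp_le mult_left_mono)
qed

lemma potential_nonneg: "0 \<le> potential x"
  unfolding potential_def by (intro suminf_nonneg summable_potential term_nonneg)

lemma potential_ge_term: "gam j * ring_weight (R j) x \<le> potential x"
  unfolding potential_def
  using sum_le_suminf[OF summable_potential, of "{j}" x] term_nonneg by simp

lemma potential_measurable [measurable]: "potential \<in> borel_measurable borel"
  unfolding potential_def by measurable

lemma ring_weight_integral: "integrable lborel (ring_weight (R j))" "(\<integral>x. ring_weight (R j) x \<partial>lborel) = 1"
proof -
  have "has_bochner_integral lborel (ring_weight (R j)) 1"
    using ring_weight_mass[OF R_pos, of j]
    by (intro has_bochner_integral_nn_integral) (auto simp: ring_weight_nonneg)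
  then show "integrable lborel (ring_weight (R j))" "(\<integral>x. ring_weight (R j) x \<partial>lborel) = 1"
    by (auto simp: has_bochner_integral_iff)
qed

lemma potential_integrable: "integrable lborel potential"
  unfolding potential_def
proof (rule integrable_suminf)
  show "integrable lborel (\<lambda>x. gam j * ring_weight (R j) x)" for j
    using ring_weight_integral by simp
  show "AE x in lborel. summable (\<lambda>j. norm (gam j * ring_weight (R j) x))"
    using summable_potential term_nonneg by simp
  have "(\<integral>x. norm (gam j * ring_weight (R j) x) \<partial>lborel) = gam j" for j
    using term_nonneg[of j] ring_weight_integral[of j] by simp
  then show "summable (\<lambda>j. \<integral>x. norm (gam j * ring_weight (R j) x) \<partial>lborel)"
    using summable_gam by simp
qed

end

section \<open>Charging the potential energy to the annuli between the radii
  \<open>q j\<close>\<close>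

locale wells_sobolev = wells + sobolev_pair
begin

definition mass :: "nat \<Rightarrow> real" where
  "mass j = (\<integral>x. ring_weight (R j) x * (cmod (w x))\<^sup>2 \<partial>lborel)"

definition inner_energy :: "nat \<Rightarrow> real" where
  "inner_energy j = grad_energy (cball 0 (q j))"

lemma inner_energy_Suc:
  "inner_energy (Suc j) = inner_energy j + grad_energy {x. q j < norm x \<and> norm x \<le> q (Suc j)}"
proof -
  have [measurable]: "{x::real^2. q j < norm x \<and> norm x \<le> q (Suc j)} \<in> sets borel" by measurable
  have "cball 0 (q (Suc j)) = cball 0 (q j) \<union> {x::real^2. q j < norm x \<and> norm x \<le> q (Suc j)}"
    using q_R[of j] R_q[of j] R_pos[of j] by (auto simp: not_less)
  then show ?thesis unfolding inner_energy_def by (subst grad_energy_Un[symmetric]) auto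
qed

text \<open>A well with \<open>a j < \<alpha>\<close> has zero mean and pays only the Poincare
  error, one share \<open>kap j\<close>. For any other well the mean is compared with the vanishing
  mean over ring 0. After multiplication by \<open>\<alpha> * gam j\<close>, the part beyond
  \<open>q j\<close> costs the factor \<open>\<alpha> / c j * (1 + lam j)\<close>, which is at most
  \<open>1 - 2 * lam j\<close>, and the part inside \<open>q j\<close> costs the second share
  \<open>kap j\<close>, by \<open>gam_inner\<close>.\<close>

lemma mass_le:
  assumes \<alpha>: "0 < \<alpha>" "\<alpha> \<le> 1" and zero: "\<And>j. a j < \<alpha> \<Longrightarrow> ring_mean (R j) = 0" and a0: "a 0 < \<alpha>"
  shows "\<alpha> * gam j * mass j \<le>
    (1 - 2 * lam j) * (inner_energy (Suc j) - inner_energy j) + 2 * kap j * inner_energy (Suc j)"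
proof -
  let ?D = "inner_energy (Suc j) - inner_energy j"
  have D: "grad_energy {x. q j < norm x \<and> norm x \<le> 2 * R j} \<le> ?D"
  proof -
    have [measurable]: "{x::real^2. q j < norm x \<and> norm x \<le> t} \<in> sets borel" for t by measurable
    show ?thesis
      unfolding inner_energy_Suc using R_q[of j] R_pos[of j] by (simp, intro grad_energy_mono) auto
  qed
  have D_nonneg: "0 \<le> ?D" using D grad_energy_nonneg order_trans by blast
  have T_nonneg: "0 \<le> inner_energy i" for i unfolding inner_energy_def by (rule grad_energy_nonneg)
  have ag: "0 \<le> \<alpha> * gam j" using \<alpha> gam_pos[of j] by simp
  have "0 < (1 - 2 * lam j) * c j"
    using lam[of j] mult_pos_pos[of "1 + lam j" "a j"] lam_pos[of j] a_pos[of j] by linarith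
  then have lam1: "0 \<le> 1 - 2 * lam j" using c_pos[of j] by (simp add: zero_less_mult_iff)
  have "mass j \<le> (cmod (ring_mean (R j)))\<^sup>2 + 256 * pi * B\<^sup>2 * grad_energy (cball 0 (6 * R j))"
    unfolding mass_def by (rule ring_poincare[OF B R_pos])
  also have "grad_energy (cball 0 (6 * R j)) \<le> inner_energy (Suc j)"
    unfolding inner_energy_def using R_q[of j] R_pos[of j] by (intro grad_energy_mono) auto
  finally have m: "mass j \<le> (cmod (ring_mean (R j)))\<^sup>2 + 256 * pi * B\<^sup>2 * inner_energy (Suc j)"
    by (simp add: mult_left_mono)
  have "\<alpha> * gam j * mass j \<le> \<alpha> * gam j * ((cmod (ring_mean (R j)))\<^sup>2 + 256 * pi * B\<^sup>2 * inner_energy (Suc j))"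
    by (rule mult_left_mono[OF m ag])
  also have "\<dots> = \<alpha> * gam j * (cmod (ring_mean (R j)))\<^sup>2 + \<alpha> * (256 * pi * B\<^sup>2 * gam j) * inner_energy (Suc j)"
    by (simp add: algebra_simps)
  also have "\<dots> \<le> \<alpha> * gam j * (cmod (ring_mean (R j)))\<^sup>2 + 1 * kap j * inner_energy (Suc j)"
    using \<alpha> gam_poincare[of j] gam_pos[of j] T_nonneg
    by (intro add_left_mono mult_right_mono mult_mono) (auto simp: less_imp_le)
  finally have 1: "\<alpha> * gam j * mass j \<le> \<alpha> * gam j * (cmod (ring_mean (R j)))\<^sup>2 + kap j * inner_energy (Suc j)" by simp
  have "\<alpha> * gam j * (cmod (ring_mean (R j)))\<^sup>2 \<le> (1 - 2 * lam j) * ?D + kap j * inner_energy j"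
  proof (cases "a j < \<alpha>")
    case True
    then show ?thesis using zero lam1 D_nonneg T_nonneg[of j] kap_pos[of j] by simp
  next
    case False
    \<comment> \<open>Ring 0 is therefore a different ring, it lies inside radius
      \<open>q j\<close>, and its mean can serve as the anchor.\<close>
    then have "0 < j" using a0 by (cases j) auto
    let ?l = "ln (2 * R j / q j)"
    have l: "0 < ?l" by (rule ln_pos)
    have "2 * pi * (cmod (ring_mean (R 0) - ring_mean (R j)))\<^sup>2 \<le>
      (1 + lam j) * ?l * grad_energy {x. q j < norm x \<and> norm x \<le> 2 * R j} +
      (1 + 1 / lam j) * ln (q j / R 0) * inner_energy j"
      unfolding inner_energy_def using R_0_le_q[OF \<open>0 < j\<close>] q_R[of j] q_ge_1[of j]
      by (intro ring_mean_diff_square_le R_pos lam_pos) auto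
    also have "\<dots> \<le> (1 + lam j) * ?l * ?D + (1 + 1 / lam j) * ln (q j) * inner_energy j"
    proof (intro add_mono mult_left_mono mult_right_mono D)
      have "q j / R 0 \<le> q j" using R_gt_4[of 0] q_ge_1[of j] by (simp add: field_simps)
      then show "ln (q j / R 0) \<le> ln (q j)"
        using R_gt_4[of 0] q_ge_1[of j] by (subst ln_le_cancel_iff) auto
    qed (use l lam_pos[of j] T_nonneg in auto)
    finally have "2 * pi * (cmod (ring_mean (R j)))\<^sup>2 \<le> (1 + lam j) * ?l * ?D + (1 + 1 / lam j) * ln (q j) * inner_energy j"
      using zero[OF a0] by simp
    \<comment> \<open>By \<open>gam_def\<close> this factor turns \<open>2 * pi\<close> into
      \<open>\<alpha> * gam j\<close>.\<close>
    then have "(\<alpha> / (c j * ?l)) * (2 * pi * (cmod (ring_mean (R j)))\<^sup>2) \<le> (\<alpha> / (c j * ?l)) * ((1 + lam j) * ?l * ?D + (1 + 1 / lam j) * ln (q j) * inner_energy j)"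
      using \<alpha> l c_pos[of j] by (intro mult_left_mono) auto
    also have "(\<alpha> / (c j * ?l)) * (2 * pi * (cmod (ring_mean (R j)))\<^sup>2) = \<alpha> * gam j * (cmod (ring_mean (R j)))\<^sup>2"
      by (simp add: gam_def)
    also have "(\<alpha> / (c j * ?l)) * ((1 + lam j) * ?l * ?D + (1 + 1 / lam j) * ln (q j) * inner_energy j) =
        ((\<alpha> / c j) * (1 + lam j)) * ?D + ((\<alpha> / c j) * ((1 + 1 / lam j) * ln (q j) / ?l)) * inner_energy j"
      using l c_pos[of j] by (simp add: field_simps)
    also have "\<dots> \<le> (1 - 2 * lam j) * ?D + (1 * kap j) * inner_energy j"
    proof (intro add_mono mult_right_mono mult_mono)
      have "\<alpha> * (1 + lam j) \<le> a j * (1 + lam j)"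
        using False lam_pos[of j] by (intro mult_right_mono) auto
      also have "\<dots> \<le> (1 - 2 * lam j) * c j" using lam[of j] by (simp add: mult.commute)
      finally show "\<alpha> / c j * (1 + lam j) \<le> 1 - 2 * lam j"
        using c_pos[of j] by (simp add: field_simps)
      show "\<alpha> / c j \<le> 1" using False a_less_c[of j] c_pos[of j] by simp
      show "(1 + 1 / lam j) * ln (q j) / ?l \<le> kap j" by (rule gam_inner)
      show "0 \<le> (1 + 1 / lam j) * ln (q j) / ?l"
        using l lam_pos[of j] q_ge_1[of j] by simp
    qed (use D_nonneg T_nonneg \<alpha> c_pos[of j] in auto)
    finally show ?thesis by simp
  qed
  moreover have "kap j * inner_energy j \<le> kap j * inner_energy (Suc j)"
    using D_nonneg kap_pos[of j] by (intro mult_left_mono) auto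
  ultimately show ?thesis using 1 by linarith
qed

text \<open>Well \<open>n\<close> lowers the unspent fraction of the energy inside
  \<open>q n\<close> to \<open>mu n - 2 * kap n\<close> and leaves the fraction
  \<open>2 * lam n - 2 * kap n\<close> on the new annulus. As \<open>mu (Suc n)\<close> lies below
  both, the bound keeps its shape.\<close>

lemma sum_mass_le:
  assumes "0 < \<alpha>" "\<alpha> \<le> 1" "\<And>j. a j < \<alpha> \<Longrightarrow> ring_mean (R j) = 0" "a 0 < \<alpha>"
  shows "(\<Sum>j<n. \<alpha> * gam j * mass j) \<le> (1 - mu n) * inner_energy n"
proof (induction n)
  case (Suc n)
  let ?T = "inner_energy n" and ?D = "inner_energy (Suc n) - inner_energy n"
  have T: "0 \<le> ?T" unfolding inner_energy_def by (rule grad_energy_nonneg)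
  have D: "0 \<le> ?D" unfolding inner_energy_Suc using grad_energy_nonneg by simp
  have "(\<Sum>j<Suc n. \<alpha> * gam j * mass j) \<le> (1 - mu n) * ?T + ((1 - 2 * lam n) * ?D + 2 * kap n * (?T + ?D))"
    using Suc mass_le[OF assms, of n] by simp
  also have "\<dots> = (1 - (mu n - 2 * kap n)) * ?T + (1 - (2 * lam n - 2 * kap n)) * ?D"
    by (simp add: algebra_simps)
  also have "\<dots> \<le> (1 - mu (Suc n)) * ?T + (1 - mu (Suc n)) * ?D"
    using mu_kap[of n] mu_lam[of n] T D by (intro add_mono mult_right_mono) auto
  finally show ?case by (simp add: algebra_simps)
qed (simp add: mu_0)

text \<open>Since \<open>mu n > 0\<close>, the bound for the first \<open>n\<close> wells is uniform
  in \<open>n\<close> and survives the limit; the full potential term is the dominating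
  function.\<close>

lemma potential_energy_le:
  assumes \<alpha>: "0 < \<alpha>" "\<alpha> \<le> 1" "\<And>j. a j < \<alpha> \<Longrightarrow> ring_mean (R j) = 0" "a 0 < \<alpha>"
    and int: "integrable lborel (\<lambda>x. \<alpha> * potential x * (cmod (w x))\<^sup>2)"
  shows "(\<integral>x. \<alpha> * potential x * (cmod (w x))\<^sup>2 \<partial>lborel) \<le> (\<integral>x. grad_sq x \<partial>lborel)"
proof (rule LIMSEQ_le_const2)
  let ?f = "\<lambda>n x. \<alpha> * (\<Sum>j<n. gam j * ring_weight (R j) x) * (cmod (w x))\<^sup>2"
  show "(\<lambda>n. \<integral>x. ?f n x \<partial>lborel) \<longlonglongrightarrow> (\<integral>x. \<alpha> * potential x * (cmod (w x))\<^sup>2 \<partial>lborel)"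
  proof (rule integral_dominated_convergence[OF _ _ int])
    show "AE x in lborel. (\<lambda>n. ?f n x) \<longlonglongrightarrow> \<alpha> * potential x * (cmod (w x))\<^sup>2"
      unfolding potential_def
      by (intro AE_I2 tendsto_intros summable_LIMSEQ summable_potential)
    show "AE x in lborel. norm (?f n x) \<le> \<alpha> * potential x * (cmod (w x))\<^sup>2" for n
    proof (rule AE_I2)
      fix x
      have "0 \<le> (\<Sum>j<n. gam j * ring_weight (R j) x)" by (intro sum_nonneg term_nonneg)
      moreover have "(\<Sum>j<n. gam j * ring_weight (R j) x) \<le> potential x"
        unfolding potential_def by (intro sum_le_suminf summable_potential) (auto intro: term_nonneg)
      ultimately show "norm (?f n x) \<le> \<alpha> * potential x * (cmod (w x))\<^sup>2"
        using \<alpha>(1) by (simp add: abs_mult mult_right_mono mult_left_mono)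
    qed
  qed measurable
  show "\<exists>N. \<forall>n\<ge>N. (\<integral>x. ?f n x \<partial>lborel) \<le> (\<integral>x. grad_sq x \<partial>lborel)"
  proof (intro exI allI impI)
    fix n
    have "(\<integral>x. ?f n x \<partial>lborel) = (\<integral>x. (\<Sum>j<n. \<alpha> * gam j * (ring_weight (R j) x * (cmod (w x))\<^sup>2)) \<partial>lborel)"
      by (simp add: sum_distrib_left sum_distrib_right mult.assoc)
    also have "\<dots> = (\<Sum>j<n. \<alpha> * gam j * mass j)"
      unfolding mass_def using ring_weight_times_integrable(2)[OF R_pos]
      by (subst Bochner_Integration.integral_sum) auto
    also have "\<dots> \<le> (1 - mu n) * inner_energy n" by (rule sum_mass_le[OF \<alpha>])
    also have "\<dots> \<le> 1 * inner_energy n"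
      using mu_pos[of n] grad_energy_nonneg by (intro mult_right_mono) (auto simp: inner_energy_def)
    also have "\<dots> \<le> grad_energy UNIV"
      unfolding inner_energy_def by (simp, intro grad_energy_mono) auto
    finally show "(\<integral>x. ?f n x \<partial>lborel) \<le> (\<integral>x. grad_sq x \<partial>lborel)"
      by (simp add: grad_energy_def)
  qed
qed

end

section \<open>Logarithmic tents\<close>

text \<open>The profile is a primitive of the radial cutoff field, so
  \<open>radial_field_energy\<close> already bounds its Dirichlet energy. Before normalisation it
  rises by \<open>A\<close>, which is at least its logarithmic growth between the radii
  \<open>2 * r\<close> and \<open>R\<close>, where the cutoff is 1.\<close>

lemma log_rise_exists:
  assumes r: "0 < r" and rR: "2 * r < R"
  shows "\<exists>A u. ln (R / (2 * r)) \<le> A \<and>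
    (\<forall>x :: real^2. (u has_derivative (\<lambda>h. radial_field r R 1 x / A * h $ 1 + radial_field r R 2 x / A * h $ 2)) (at x)) \<and>
    (\<forall>x. norm x \<le> r \<longrightarrow> u x = 0) \<and> (\<forall>x. 2 * R \<le> norm x \<longrightarrow> u x = 1)"
proof -
  have le: "r \<le> R" "0 < R" using r rR by auto
  \<comment> \<open>The factor 1/2 compensates the gradient \<open>2 * x\<close> of the squared
    norm.\<close>
  define h where "h s = cutoff r R s / s / 2" for s
  have h0: "h s = 0" if "s \<le> r\<^sup>2 \<or> 4 * R\<^sup>2 \<le> s" for s
    using that cutoff_eq_0[OF r le(1)] by (simp add: h_def)
  have "continuous_on UNIV h"
    unfolding h_def using smooth_upto_cutoff_div[OF r le(1), of 0]
    by (intro continuous_on_divide[OF _ continuous_on_const]) auto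
  then obtain E where E: "\<And>s. (E has_real_derivative h s) (at s)" "\<And>s. s \<le> r\<^sup>2 \<Longrightarrow> E s = 0"
    using antiderivative_exists[of h "r\<^sup>2"] h0 r by auto
  have h_nonneg: "0 \<le> h s" for s
  proof (cases "s \<le> r\<^sup>2")
    case False
    then have "0 \<le> s" using zero_le_power2[of r] by linarith
    then show ?thesis using cutoff_nonneg[OF r le(1), of s] by (simp add: h_def)
  qed (simp add: h0)
  have mono: "E s \<le> E t" if "s \<le> t" for s t
    using that by (intro DERIV_nonneg_imp_nondecreasing[of s t E]) (auto intro: E h_nonneg)
  define A where "A = E (4 * R\<^sup>2)"
  have EA: "E s = A" if "4 * R\<^sup>2 \<le> s" for s
  proof (cases "s = 4 * R\<^sup>2")
    case False
    then have "4 * R\<^sup>2 < s" using that by simp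
    from MVT2[OF this E(1)] obtain z where "4 * R\<^sup>2 < z" "E s - E (4 * R\<^sup>2) = (s - 4 * R\<^sup>2) * h z" by auto
    then show ?thesis using h0[of z] by (simp add: A_def)
  qed (simp add: A_def)
  have "(2 * r)\<^sup>2 < R\<^sup>2" using r rR by (intro power_strict_mono) auto
  then have less: "4 * r\<^sup>2 < R\<^sup>2" by simp
  have pos: "0 < r\<^sup>2" "0 < R\<^sup>2" using r le by auto
  \<comment> \<open>The cutoff is 1 on this interval, so \<open>E s\<close> and
    \<open>ln s / 2\<close> have the same derivative, and the mean value theorem makes their
    increments equal.\<close>
  have "\<exists>z. 4 * r\<^sup>2 < z \<and> z < R\<^sup>2 \<and>
      (E (R\<^sup>2) - ln (R\<^sup>2) / 2) - (E (4 * r\<^sup>2) - ln (4 * r\<^sup>2) / 2) = (R\<^sup>2 - 4 * r\<^sup>2) * 0"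
  proof (rule MVT2[OF less])
    fix s assume s: "4 * r\<^sup>2 \<le> s" "s \<le> R\<^sup>2"
    then have "0 < s" using pos by linarith
    have "((\<lambda>s. E s - ln s / 2) has_real_derivative h s - 1 / s / 2) (at s)"
      using \<open>0 < s\<close> by (auto intro!: derivative_eq_intros E)
    moreover have "h s = 1 / s / 2" using cutoff_eq_1[OF r le(1) s] by (simp add: h_def)
    ultimately show "((\<lambda>s. E s - ln s / 2) has_real_derivative 0) (at s)" by simp
  qed
  then have "E (R\<^sup>2) - E (4 * r\<^sup>2) = ln (R\<^sup>2) / 2 - ln ((2 * r)\<^sup>2) / 2" by auto
  also have "\<dots> = ln (R / (2 * r))"
    using r le by (subst (1 2) ln_realpow) (auto simp: ln_div)
  finally have "ln (R / (2 * r)) = E (R\<^sup>2) - E (4 * r\<^sup>2)" ..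
  moreover have "0 \<le> E (4 * r\<^sup>2)" using mono[of "r\<^sup>2" "4 * r\<^sup>2"] E(2)[of "r\<^sup>2"] pos by simp
  moreover have "E (R\<^sup>2) \<le> A" unfolding A_def using pos by (intro mono) simp
  ultimately have A: "ln (R / (2 * r)) \<le> A" by linarith
  have "0 < ln (R / (2 * r))" using r rR by (intro ln_gt_zero) (auto simp: field_simps)
  with A have A_pos: "0 < A" by linarith
  show ?thesis
  proof (intro exI conjI allI impI, rule A)
    show "((\<lambda>x. E ((norm x)\<^sup>2) / A) has_derivative (\<lambda>h. radial_field r R 1 x / A * h $ 1 + radial_field r R 2 x / A * h $ 2)) (at x)" for x :: "real^2"
    proof -
      have "((\<lambda>x. E ((norm x)\<^sup>2)) has_derivative (\<lambda>v. h ((norm x)\<^sup>2) * (2 * (x \<bullet> v)))) (at x)"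
        by (rule radial_compose_has_derivative[OF r le(1) E(1)])
      then have "((\<lambda>x. E ((norm x)\<^sup>2) / A) has_derivative (\<lambda>v. h ((norm x)\<^sup>2) * (2 * (x \<bullet> v)) / A)) (at x)"
        using A_pos by (auto intro!: derivative_eq_intros)
      moreover have "h ((norm x)\<^sup>2) * (2 * (x \<bullet> v)) / A = radial_field r R 1 x / A * v $ 1 + radial_field r R 2 x / A * v $ 2" for v
        by (simp add: h_def radial_field_def inner_vec_def sum_2 algebra_simps add_divide_distrib)
      ultimately show ?thesis by simp
    qed
    show "E ((norm x)\<^sup>2) / A = 0" if "norm x \<le> r" for x :: "real^2"
      using E(2)[of "(norm x)\<^sup>2"] that by (simp add: power_mono)
    show "E ((norm x)\<^sup>2) / A = 1" if "2 * R \<le> norm x" for x :: "real^2"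
      using EA[of "(norm x)\<^sup>2"] power_mono[OF that, of 2] le A_pos by simp
  qed
qed

lemma radial_field_eq_0:
  assumes "0 < r" "r \<le> R" "norm x \<le> r \<or> 2 * R \<le> norm x"
  shows "radial_field r R i x = 0"
proof -
  have "(norm x)\<^sup>2 \<le> r\<^sup>2 \<or> 4 * R\<^sup>2 \<le> (norm x)\<^sup>2"
    using assms power_mono[of "norm x" r 2] power_mono[of "2 * R" "norm x" 2] by auto
  then show ?thesis using cutoff_eq_0[OF assms(1,2)] by (simp add: radial_field_def)
qed

lemma radial_field_energy:
  assumes "0 < r" "r \<le> R"
  shows "integrable lborel (\<lambda>x. (radial_field r R 1 x)\<^sup>2 + (radial_field r R 2 x)\<^sup>2)"
    and "(\<integral>x. (radial_field r R 1 x)\<^sup>2 + (radial_field r R 2 x)\<^sup>2 \<partial>lborel) \<le> 2 * pi * ln (2 * R / r)"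
proof -
  have [measurable]: "radial_field r R i \<in> borel_measurable borel" for i
    by (rule borel_measurable_continuous_onI[OF test_function_continuous[OF test_function_radial_field[OF assms]]])
  have r: "0 < r" "r \<le> 2 * R" using assms by auto
  note ann = annulus_integral[OF r]
  note le = radial_field_square_le[OF assms]
  show int: "integrable lborel (\<lambda>x. (radial_field r R 1 x)\<^sup>2 + (radial_field r R 2 x)\<^sup>2)"
    by (rule Bochner_Integration.integrable_bound[OF ann(1)])
      (use le in \<open>auto intro!: AE_I2 intro: order_trans[OF _ abs_ge_self]\<close>)
  show "(\<integral>x. (radial_field r R 1 x)\<^sup>2 + (radial_field r R 2 x)\<^sup>2 \<partial>lborel) \<le> 2 * pi * ln (2 * R / r)"
    unfolding ann(2)[symmetric] by (rule integral_mono[OF int ann(1)]) (rule le)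
qed

text \<open>A rise from \<open>q\<close> to \<open>R\<close> minus a rise from \<open>2 * R\<close>
  to \<open>q'\<close>. In \<open>log_rise_exists\<close> a rise is complete only at twice its
  second parameter, hence the parameters \<open>R / 2\<close> and \<open>q' / 2\<close> and the
  factors 4 and 8 in the assumptions. The two gradients have disjoint supports, so the energies
  add.\<close>

lemma tent_exists:
  assumes q: "0 < q" "4 * q < R" "8 * R < q'"
  shows "\<exists>(u :: real^2 \<Rightarrow> real) (G :: 2 \<Rightarrow> real^2 \<Rightarrow> real).
    (\<forall>x. (u has_derivative (\<lambda>h. G 1 x * h $ 1 + G 2 x * h $ 2)) (at x)) \<and>
    (\<forall>i. continuous_on UNIV (G i)) \<and>
    (\<forall>x. norm x \<le> q \<or> q' \<le> norm x \<longrightarrow> u x = 0) \<and>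
    (\<forall>i x. norm x \<le> q \<or> q' \<le> norm x \<longrightarrow> G i x = 0) \<and>
    (\<forall>x. R \<le> norm x \<and> norm x \<le> 2 * R \<longrightarrow> u x = 1) \<and>
    integrable lborel (\<lambda>x. (G 1 x)\<^sup>2 + (G 2 x)\<^sup>2) \<and>
    (\<integral>x. (G 1 x)\<^sup>2 + (G 2 x)\<^sup>2 \<partial>lborel) \<le> 2 * pi * ln (R / q) / (ln (R / (4 * q)))\<^sup>2 +
      2 * pi * ln (q' / (2 * R)) / (ln (q' / (8 * R)))\<^sup>2"
proof -
  have up: "0 < q" "2 * q < R / 2" "q \<le> R / 2" and dn: "0 < 2 * R" "2 * (2 * R) < q' / 2" "2 * R \<le> q' / 2"
    using q by auto
  obtain A1 u1 where u1: "ln (R / 2 / (2 * q)) \<le> A1"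
    "\<forall>x :: real^2. (u1 has_derivative (\<lambda>h. radial_field q (R/2) 1 x / A1 * h $ 1 + radial_field q (R/2) 2 x / A1 * h $ 2)) (at x)"
    "\<forall>x. norm x \<le> q \<longrightarrow> u1 x = 0" "\<forall>x. 2 * (R/2) \<le> norm x \<longrightarrow> u1 x = 1"
    using log_rise_exists[OF up(1,2)] by (elim exE conjE)
  obtain A2 u2 where u2: "ln (q' / 2 / (2 * (2 * R))) \<le> A2"
    "\<forall>x :: real^2. (u2 has_derivative (\<lambda>h. radial_field (2*R) (q'/2) 1 x / A2 * h $ 1 + radial_field (2*R) (q'/2) 2 x / A2 * h $ 2)) (at x)"
    "\<forall>x. norm x \<le> 2 * R \<longrightarrow> u2 x = 0" "\<forall>x. 2 * (q'/2) \<le> norm x \<longrightarrow> u2 x = 1"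
    using log_rise_exists[OF dn(1,2)] by (elim exE conjE)
  let ?F = "radial_field q (R/2)" and ?H = "radial_field (2*R) (q'/2)"
  define G where "G i x = ?F i x / A1 - ?H i x / A2" for i x
  have F0: "?F i x = 0" if "norm x \<le> q \<or> R \<le> norm x" for i x
    using that by (intro radial_field_eq_0 up) auto
  have H0: "?H i x = 0" if "norm x \<le> 2 * R \<or> q' \<le> norm x" for i x
    using that by (intro radial_field_eq_0 dn) auto
  have ln_pos: "0 < ln (R / (4 * q))" "0 < ln (q' / (8 * R))"
    using q by (auto intro!: ln_gt_zero simp: field_simps)
  have A: "ln (R / (4 * q)) \<le> A1" "ln (q' / (8 * R)) \<le> A2"
    using u1(1) u2(1) by (simp_all add: mult.commute)
  have split: "(G 1 x)\<^sup>2 + (G 2 x)\<^sup>2 = ((?F 1 x)\<^sup>2 + (?F 2 x)\<^sup>2) / A1\<^sup>2 + ((?H 1 x)\<^sup>2 + (?H 2 x)\<^sup>2) / A2\<^sup>2" for x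
  proof (cases "R \<le> norm x")
    case True
    then show ?thesis by (simp add: G_def F0 power_divide add_divide_distrib)
  next
    case False
    then have "norm x \<le> 2 * R" using norm_ge_zero[of x] by linarith
    then show ?thesis by (simp add: G_def H0 power_divide add_divide_distrib)
  qed
  note eF = radial_field_energy[OF up(1,3)] and eH = radial_field_energy[OF dn(1,3)]
  have R2: "2 * (R / 2) = R" "2 * (q' / 2) = q'" by auto
  show ?thesis
  proof (rule exI[of _ "\<lambda>x. u1 x - u2 x"], rule exI[of _ G], intro conjI allI impI)
    show "((\<lambda>x. u1 x - u2 x) has_derivative (\<lambda>h. G 1 x * h $ 1 + G 2 x * h $ 2)) (at x)" for x
      using has_derivative_diff[OF u1(2)[rule_format] u2(2)[rule_format], of x] by (simp add: G_def algebra_simps)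
    show "continuous_on UNIV (G i)" for i
      unfolding G_def
      by (intro continuous_on_diff continuous_on_divide continuous_on_const test_function_continuous
          test_function_radial_field up dn) (use A ln_pos in auto)
    show "u1 x - u2 x = 0" if "norm x \<le> q \<or> q' \<le> norm x" for x
      using that u1(3,4)[rule_format, of x] u2(3,4)[rule_format, of x] q by auto
    show "G i x = 0" if "norm x \<le> q \<or> q' \<le> norm x" for i x
    proof -
      have "norm x \<le> q \<or> R \<le> norm x" "norm x \<le> 2 * R \<or> q' \<le> norm x" using that q by auto
      then show ?thesis by (simp add: G_def F0 H0)
    qed
    show "u1 x - u2 x = 1" if "R \<le> norm x \<and> norm x \<le> 2 * R" for x
      using that u1(4)[rule_format, of x] u2(3)[rule_format, of x] by simp
    show "integrable lborel (\<lambda>x. (G 1 x)\<^sup>2 + (G 2 x)\<^sup>2)"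
      unfolding split
      by (rule Bochner_Integration.integrable_add[OF integrable_divide[OF eF(1)] integrable_divide[OF eH(1)]])
    have "(\<integral>x. (G 1 x)\<^sup>2 + (G 2 x)\<^sup>2 \<partial>lborel) =
        (\<integral>x. (?F 1 x)\<^sup>2 + (?F 2 x)\<^sup>2 \<partial>lborel) / A1\<^sup>2 + (\<integral>x. (?H 1 x)\<^sup>2 + (?H 2 x)\<^sup>2 \<partial>lborel) / A2\<^sup>2"
      unfolding split using eF(1) eH(1)
      by (subst Bochner_Integration.integral_add) (auto intro!: integrable_divide simp del: Bochner_Integration.integral_add)
    also have "\<dots> \<le> 2 * pi * ln (R / q) / (ln (R / (4 * q)))\<^sup>2 + 2 * pi * ln (q' / (2 * R)) / (ln (q' / (8 * R)))\<^sup>2"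
      using eF(2) eH(2) A ln_pos q unfolding R2
      by (intro add_mono frac_le power_mono mult_nonneg_nonneg ln_ge_zero) (auto simp: field_simps)
    finally show "(\<integral>x. (G 1 x)\<^sup>2 + (G 2 x)\<^sup>2 \<partial>lborel) \<le> 2 * pi * ln (R / q) / (ln (R / (4 * q)))\<^sup>2 +
      2 * pi * ln (q' / (2 * R)) / (ln (q' / (8 * R)))\<^sup>2" .
  qed
qed

section \<open>Integration by parts with compact support\<close>

lemma integrable_continuous_compact_support:
  fixes f :: "real^2 \<Rightarrow> real"
  assumes "continuous_on UNIV f" "\<And>x. r < norm x \<Longrightarrow> f x = 0"
  shows "integrable lborel f"
proof -
  have "integrable lborel (\<lambda>x. complex_of_real (f x) * 1)"
    by (rule integrable_compact_support_times[OF _ assms])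
      (auto simp: locally_integrable_def intro!: integrable_real_indicator integrable_scaleR_left emeasure_bounded_finite)
  then show ?thesis using integrable_Re by fastforce
qed

text \<open>By translation invariance the difference quotients of \<open>f\<close> have integral 0.
  They converge to the directional derivative, and the mean value theorem bounds them by
  \<open>M\<close> on the ball of radius \<open>r + 1\<close>, because the increments
  \<open>s n\<close> are at most 1 and \<open>e\<close> is a unit vector.\<close>

lemma integral_partial_eq_0:
  fixes f :: "real^2 \<Rightarrow> real"
  assumes D: "\<And>x. (f has_derivative D x) (at x)" and cont: "continuous_on UNIV (\<lambda>x. D x e)"
    and supp: "\<And>x. r < norm x \<Longrightarrow> f x = 0" "\<And>x. r < norm x \<Longrightarrow> D x e = 0" and e: "norm e = 1"
  shows "(\<integral>x. D x e \<partial>lborel) = 0"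
proof -
  have f_cont: "continuous_on UNIV f"
    using D by (auto intro!: continuous_at_imp_continuous_on intro: has_derivative_continuous)
  have [measurable]: "f \<in> borel_measurable borel" "(\<lambda>x. D x e) \<in> borel_measurable borel"
    by (rule borel_measurable_continuous_onI[OF f_cont], rule borel_measurable_continuous_onI[OF cont])
  obtain M where M: "0 < M" "\<And>x. norm (D x e) \<le> M"
    using continuous_compact_support_bounded[OF cont supp(2)] by blast
  have f_int: "integrable lborel f"
    by (rule integrable_continuous_compact_support[OF f_cont supp(1)])
  define s where "s n = 1 / real (Suc n)" for n
  have s: "0 < s n" "s n \<le> 1" for n by (auto simp: s_def field_simps)
  have s0: "s \<longlonglongrightarrow> 0" unfolding s_def by (rule LIMSEQ_Suc, rule lim_1_over_n)
  let ?Q = "\<lambda>n x. (f (x + s n *\<^sub>R e) - f x) / s n"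
  have line: "((\<lambda>t. f (x + t *\<^sub>R e)) has_real_derivative D (x + t *\<^sub>R e) e) (at t)" for x t
  proof -
    have "((\<lambda>t. x + t *\<^sub>R e) has_derivative (\<lambda>u. u *\<^sub>R e)) (at t)"
      by (auto intro!: derivative_eq_intros)
    from has_derivative_compose[where g=f and f="\<lambda>t. x + t *\<^sub>R e", OF this D]
    have "((\<lambda>t. f (x + t *\<^sub>R e)) has_derivative (\<lambda>u. D (x + t *\<^sub>R e) (u *\<^sub>R e))) (at t)" .
    moreover have "D (x + t *\<^sub>R e) (u *\<^sub>R e) = D (x + t *\<^sub>R e) e * u" for u
      using has_derivative_bounded_linear[OF D] by (simp add: linear_simps mult.commute)
    ultimately show ?thesis by (simp add: has_field_derivative_def)
  qed
  have "(\<lambda>n. \<integral>x. ?Q n x \<partial>lborel) \<longlonglongrightarrow> (\<integral>x. D x e \<partial>lborel)"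
  proof (rule integral_dominated_convergence)
    show "integrable lborel (\<lambda>x. M * indicat_real (cball 0 (r + 1)) (x :: real^2))"
      using emeasure_bounded_finite[OF bounded_cball, of "0::real^2" "r + 1"]
      by (intro integrable_mult_right integrable_real_indicator) auto
    show "AE x in lborel. (\<lambda>n. ?Q n x) \<longlonglongrightarrow> D x e"
    proof (rule AE_I2)
      fix x
      have "((\<lambda>h. (f (x + (0 + h) *\<^sub>R e) - f (x + 0 *\<^sub>R e)) / h) \<longlongrightarrow> D (x + 0 *\<^sub>R e) e) (at 0)"
        using line[of x 0] by (simp add: DERIV_def)
      then have "((\<lambda>h. (f (x + h *\<^sub>R e) - f x) / h) \<longlongrightarrow> D x e) (at 0)" by simp
      moreover have "filterlim s (at 0) sequentially"
        using s0 s(1) by (auto simp: filterlim_at intro!: always_eventually) (metis less_irrefl)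
      ultimately show "(\<lambda>n. ?Q n x) \<longlonglongrightarrow> D x e" by (rule filterlim_compose)
    qed
    show "AE x in lborel. norm (?Q n x) \<le> M * indicat_real (cball 0 (r + 1)) x" for n
    proof (rule AE_I2)
      fix x
      from MVT2[of 0 "s n" "\<lambda>t. f (x + t *\<^sub>R e)", OF s(1) line]
      obtain z where z: "0 < z" "z < s n" "f (x + s n *\<^sub>R e) - f (x + 0 *\<^sub>R e) = (s n - 0) * D (x + z *\<^sub>R e) e" by blast
      then have Q: "?Q n x = D (x + z *\<^sub>R e) e" using s(1)[of n] by simp
      show "norm (?Q n x) \<le> M * indicat_real (cball 0 (r + 1)) x"
      proof (cases "norm x \<le> r + 1")
        case True
        then show ?thesis unfolding Q using M(2) by simp
      next
        case False
        have "norm x \<le> norm (x + z *\<^sub>R e) + norm (z *\<^sub>R e)"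
          using norm_triangle_ineq4[of "x + z *\<^sub>R e" "z *\<^sub>R e"] by simp
        also have "norm (z *\<^sub>R e) \<le> 1" using z e s(2)[of n] by simp
        finally have "r < norm (x + z *\<^sub>R e)" using False by linarith
        then show ?thesis unfolding Q using supp(2) M(1) by simp
      qed
    qed
  qed measurable
  moreover have "(\<integral>x. ?Q n x \<partial>lborel) = 0" for n
    using f_int lborel_integrable_translate[OF f_int, of "s n *\<^sub>R e"] lborel_integral_translate[of f "s n *\<^sub>R e"] by simp
  ultimately show ?thesis by (simp only: LIMSEQ_const_iff)
qed

section \<open>Negative index and square integrable classes\<close>

context vector_space
begin

text \<open>The kernel of one functional has codimension at most one in \<open>L\<close>, so a
  single vector \<open>v\<close> restores \<open>L\<close>; once all functionals are used up, only 0
  is left. The conclusion speaks of a spanning set because finite dimension is part of the claim and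
  \<open>dim\<close> alone cannot express it.\<close>

lemma finite_spanning_of_functionals:
  assumes "finite F" "subspace L"
    and add: "\<And>i x y. i \<in> F \<Longrightarrow> f i (x + y) = f i x + f i y"
    and mult: "\<And>i c x. i \<in> F \<Longrightarrow> f i (scale c x) = c * f i x"
    and kernel: "\<And>x. x \<in> L \<Longrightarrow> (\<And>i. i \<in> F \<Longrightarrow> f i x = 0) \<Longrightarrow> x = 0"
  shows "\<exists>B. finite B \<and> card B \<le> card F \<and> L \<subseteq> span B"
  using assms
proof (induction F arbitrary: L rule: finite_induct)
  case empty
  then have "L \<subseteq> {0}" by blast
  then show ?case by (intro exI[of _ "{}"]) (auto simp: span_0)
next
  case (insert i F)
  define L0 where "L0 = {x \<in> L. f i x = 0}"
  have f0: "f i 0 = 0" using insert.prems(3)[of i 0 0] by simp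
  have sub: "subspace L0"
    using insert.prems(1) f0 insert.prems(2,3)[of i] by (auto simp: subspace_def L0_def)
  have "\<exists>B. finite B \<and> card B \<le> card F \<and> L0 \<subseteq> span B"
  proof (rule insert.IH[OF sub])
    fix x assume x: "x \<in> L0" "\<And>i. i \<in> F \<Longrightarrow> f i x = 0"
    show "x = 0" by (rule insert.prems(4)) (use x in \<open>auto simp: L0_def\<close>)
  qed (use insert.prems(2,3) in blast)+
  then obtain B0 where B0: "finite B0" "card B0 \<le> card F" "L0 \<subseteq> span B0" by blast
  show ?case
  proof (cases "L = L0")
    case True
    then show ?thesis using B0 insert.hyps by (intro exI[of _ B0]) auto
  next
    case False
    then obtain v where v: "v \<in> L" "f i v \<noteq> 0" by (auto simp: L0_def)
    have "x \<in> span (insert v B0)" if "x \<in> L" for x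
    proof -
      let ?c = "f i x / f i v"
      define y where "y = x + scale (- ?c) v"
      have "f i y = f i x + f i (scale (- ?c) v)"
        unfolding y_def by (rule insert.prems(2)) simp
      also have "f i (scale (- ?c) v) = - ?c * f i v"
        by (rule insert.prems(3)) simp
      finally have "f i y = 0" using v by simp
      moreover have "y \<in> L" unfolding y_def
        by (intro subspace_add subspace_scale insert.prems(1) that v)
      ultimately have "y \<in> span (insert v B0)"
        using B0(3) span_mono[of B0 "insert v B0"] by (auto simp: L0_def)
      then have "y + scale ?c v \<in> span (insert v B0)"
        by (intro span_add span_scale) (auto intro: span_base)
      moreover have "y + scale ?c v = x" by (simp add: y_def)
      ultimately show ?thesis by simp
    qed
    moreover have "card (insert v B0) \<le> card (insert i F)"
      using B0 insert.hyps by (simp add: card_insert_if)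
    ultimately show ?thesis using B0 by (intro exI[of _ "insert v B0"]) auto
  qed
qed

text \<open>On a subspace where the form is negative the functionals have only 0 as a common zero,
  so their number bounds its dimension.\<close>

lemma neg_index_le:
  assumes "finite F"
    and "\<And>i x y. i \<in> F \<Longrightarrow> f i (x + y) = f i x + f i y"
    and "\<And>i c x. i \<in> F \<Longrightarrow> f i (scale c x) = c * f i x"
    and nonneg: "\<And>x. x \<in> D \<Longrightarrow> (\<And>i. i \<in> F \<Longrightarrow> f i x = 0) \<Longrightarrow> 0 \<le> Q x"
  shows "neg_index D Q \<le> enat (card F)"
  unfolding neg_index_def
proof (rule SUP_least, clarify)
  fix L assume L: "subspace L" "L \<subseteq> D" "\<forall>u\<in>L - {0}. Q u < 0"
  have "x = 0" if "x \<in> L" "\<And>i. i \<in> F \<Longrightarrow> f i x = 0" for x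
  proof (rule ccontr)
    assume "x \<noteq> 0"
    then have "Q x < 0" using L(3) that(1) by auto
    moreover have "0 \<le> Q x" using nonneg[of x] that L(2) by auto
    ultimately show False by simp
  qed
  then obtain B where B: "finite B" "card B \<le> card F" "L \<subseteq> span B"
    using finite_spanning_of_functionals[where f=f and F=F and L=L, OF assms(1) L(1) assms(2,3)] by blast
  have "dim L \<le> card F" using dim_le_card[OF B(3,1)] B(2) by linarith
  then show "edim L \<le> enat (card F)" using B by (auto simp: edim_def)
qed

text \<open>Linear independence comes from the form itself: a nontrivial combination equal to 0
  would give \<open>Q 0\<close> a negative value.\<close>

lemma neg_index_ge:
  assumes J: "finite J"
    and neg: "\<And>c. (\<exists>j\<in>J. c j \<noteq> 0) \<Longrightarrow> (\<Sum>j\<in>J. scale (c j) (v j)) \<in> D \<and> Q (\<Sum>j\<in>J. scale (c j) (v j)) < 0"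
    and D0: "0 \<in> D" and Q0: "0 \<le> Q 0"
  shows "enat (card J) \<le> neg_index D Q"
proof -
  have zero: "c j = 0" if "(\<Sum>j\<in>J. scale (c j) (v j)) = 0" "j \<in> J" for c j
    using neg[of c] Q0 that by force
  have inj: "inj_on v J"
  proof (rule inj_onI, rule ccontr)
    fix i j assume ij: "i \<in> J" "j \<in> J" "v i = v j" "i \<noteq> j"
    \<comment> \<open>Coefficients 1 and -1 at two equal vectors would be a nontrivial combination
      equal to 0.\<close>
    let ?c = "\<lambda>k. if k = i then (1::'a) else if k = j then - 1 else 0"
    have "(\<Sum>k\<in>J. scale (?c k) (v k)) = (\<Sum>k\<in>{i, j}. scale (?c k) (v k))"
      using J ij by (intro sum.mono_neutral_right) auto
    also have "\<dots> = 0" using ij by simp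
    finally have "?c i = 0" using zero[of ?c i] ij by simp
    then show False by simp
  qed
  have comb: "\<exists>c. (\<Sum>w\<in>v ` J. scale (u w) w) = (\<Sum>j\<in>J. scale (c j) (v j)) \<and> (\<forall>j. c j = u (v j))" for u
    by (intro exI[of _ "\<lambda>j. u (v j)"]) (simp add: sum.reindex[OF inj])
  have indep: "independent (v ` J)"
  proof (rule independent_if_scalars_zero)
    fix u x assume "(\<Sum>x\<in>v ` J. scale (u x) x) = 0" "x \<in> v ` J"
    then show "u x = 0" using comb[of u] zero by fastforce
  qed (use J in simp)
  have fin: "finite (v ` J)" using J by simp
  have L: "u \<in> D \<and> (u \<noteq> 0 \<longrightarrow> Q u < 0)" if u: "u \<in> span (v ` J)" for u
  proof -
    obtain c where c: "u = (\<Sum>j\<in>J. scale (c j) (v j))"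
      using u comb unfolding span_finite[OF fin] by blast
    show ?thesis
    proof (cases "\<exists>j\<in>J. c j \<noteq> 0")
      case True
      then show ?thesis using neg c by blast
    next
      case False
      then have "u = 0" unfolding c by simp
      then show ?thesis using D0 by simp
    qed
  qed
  have "edim (span (v ` J)) = enat (card J)"
    unfolding edim_def using fin dim_span_eq_card_independent[OF indep] card_image[OF inj] by auto
  moreover have "edim (span (v ` J)) \<le> neg_index D Q"
    unfolding neg_index_def by (rule SUP_upper) (use L in auto)
  ultimately show ?thesis by simp
qed

end

section \<open>Classes in \<open>L2\<close> and their Borel representatives\<close>

lemma sq_integrable_borel:
  assumes "w \<in> borel_measurable borel" "integrable lborel (\<lambda>x. (cmod (w x))\<^sup>2)"
  shows "sq_integrable w"
  using assms by (auto simp: sq_integrable_def integrable_completion measurable_completion)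

lemma sq_integrable_rep_L2: "sq_integrable (rep_L2 u)"
  using Quotient3_rep_reflp[OF Quotient3_L2, of u] by (simp add: ae_equal_def)

lemma rep_abs_L2: "sq_integrable f \<Longrightarrow> AE x in lebesgue. rep_L2 (abs_L2 f) x = f x"
  using rep_abs_rsp_left[OF Quotient3_L2, of f f] by (auto simp: ae_equal_def)

lemma abs_L2_eqI:
  "sq_integrable f \<Longrightarrow> sq_integrable g \<Longrightarrow> AE x in lebesgue. f x = g x \<Longrightarrow> abs_L2 f = abs_L2 g"
  using Quotient3_rel_abs[OF Quotient3_L2, of f g] by (simp add: ae_equal_def)

lemma abs_rep_L2: "abs_L2 (rep_L2 u) = u"
  by (rule Quotient3_abs_rep[OF Quotient3_L2])

lemma borel_representative:
  obtains w where "w \<in> borel_measurable borel" "integrable lborel (\<lambda>x. (cmod (w x))\<^sup>2)" "u = abs_L2 w"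
proof -
  let ?f = "rep_L2 u"
  have f: "?f \<in> borel_measurable lebesgue" "integrable lebesgue (\<lambda>x. (cmod (?f x))\<^sup>2)"
    using sq_integrable_rep_L2[of u] by (auto simp: sq_integrable_def)
  obtain p where p: "p \<in> borel_measurable lborel" "AE x in lborel. Re (?f x) = p x"
    using completion_ex_borel_measurable_real[of "\<lambda>x. Re (?f x)" lborel] f(1) by auto
  obtain m where m: "m \<in> borel_measurable lborel" "AE x in lborel. Im (?f x) = m x"
    using completion_ex_borel_measurable_real[of "\<lambda>x. Im (?f x)" lborel] f(1) by auto
  define w where "w x = Complex (p x) (m x)" for x
  have w: "w \<in> borel_measurable borel"
    using p(1) m(1) by (subst borel_measurable_complex_iff) (simp add: w_def)
  have ae: "AE x in lborel. ?f x = w x"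
    using p(2) m(2) by eventually_elim (simp add: w_def complex_eq_iff)
  then have ae': "AE x in lebesgue. ?f x = w x" by (rule AE_completion)
  have "integrable lebesgue (\<lambda>x. (cmod (w x))\<^sup>2)"
  proof (rule integrable_cong_AE_imp[OF f(2)])
    show "(\<lambda>x. (cmod (w x))\<^sup>2) \<in> borel_measurable lebesgue"
      using w by (intro measurable_completion) simp
    show "AE x in lebesgue. (cmod (?f x))\<^sup>2 = (cmod (w x))\<^sup>2" using ae' by eventually_elim simp
  qed
  then have sq: "integrable lborel (\<lambda>x. (cmod (w x))\<^sup>2)"
    using w by (subst (asm) integrable_completion) auto
  have "u = abs_L2 ?f" by (simp add: abs_rep_L2)
  also have "\<dots> = abs_L2 w"
    by (intro abs_L2_eqI sq_integrable_rep_L2 sq_integrable_borel w sq ae')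
  finally show thesis using that w sq by blast
qed

text \<open>Joint measurability of \<open>F\<close> lets one lemma serve all integrands that occur:
  weak derivatives, ring means, and both terms of the energy. Almost everywhere equality removes the
  choice of representative, and Borel measurability removes the completion.\<close>

lemma integral_rep_L2:
  fixes F :: "real^2 \<Rightarrow> complex \<Rightarrow> 'b::{banach, second_countable_topology}"
  assumes [measurable]: "w \<in> borel_measurable borel" and sq: "integrable lborel (\<lambda>x. (cmod (w x))\<^sup>2)"
    and F: "(\<lambda>(x, z). F x z) \<in> borel_measurable (borel \<Otimes>\<^sub>M borel)"
  shows "(\<integral>x. F x (rep_L2 (abs_L2 w) x) \<partial>lebesgue) = (\<integral>x. F x (w x) \<partial>lborel)"
    and "integrable lebesgue (\<lambda>x. F x (rep_L2 (abs_L2 w) x)) \<longleftrightarrow> integrable lborel (\<lambda>x. F x (w x))"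
proof -
  let ?r = "rep_L2 (abs_L2 w)"
  have r: "?r \<in> borel_measurable lebesgue"
    using sq_integrable_rep_L2 by (simp add: sq_integrable_def)
  have "(\<lambda>x. x) \<in> measurable lebesgue borel" by (rule measurable_completion) simp
  then have "(\<lambda>x. (x, ?r x)) \<in> measurable lebesgue (borel \<Otimes>\<^sub>M borel)"
    using r by (intro measurable_Pair)
  from measurable_compose[OF this F] have m1: "(\<lambda>x. F x (?r x)) \<in> borel_measurable lebesgue" by simp
  have "(\<lambda>x. (x, w x)) \<in> measurable borel (borel \<Otimes>\<^sub>M borel)"
    by measurable
  from measurable_compose[OF this F] have m2: "(\<lambda>x. F x (w x)) \<in> borel_measurable borel" by simp
  then have m2': "(\<lambda>x. F x (w x)) \<in> borel_measurable lebesgue" by (intro measurable_completion) simp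
  have ae: "AE x in lebesgue. F x (?r x) = F x (w x)"
    using rep_abs_L2[OF sq_integrable_borel[OF assms(1,2)]] by eventually_elim simp
  show "(\<integral>x. F x (?r x) \<partial>lebesgue) = (\<integral>x. F x (w x) \<partial>lborel)"
    using m2 by (subst integral_cong_AE[OF m1 m2' ae]) (simp add: integral_completion)
  show "integrable lebesgue (\<lambda>x. F x (?r x)) \<longleftrightarrow> integrable lborel (\<lambda>x. F x (w x))"
    using m2 by (subst integrable_cong_AE[OF m1 m2' ae]) (simp add: integrable_completion)
qed

lemma test_function_measurable: "test_function \<phi> \<Longrightarrow> \<phi> \<in> borel_measurable borel"
  by (rule borel_measurable_continuous_onI[OF test_function_continuous])

lemma weak_deriv_abs_L2_iff:
  assumes w: "w \<in> borel_measurable borel" "integrable lborel (\<lambda>x. (cmod (w x))\<^sup>2)"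
    and h: "h \<in> borel_measurable borel" "integrable lborel (\<lambda>x. (cmod (h x))\<^sup>2)"
  shows "weak_deriv i (abs_L2 w) (abs_L2 h) \<longleftrightarrow> (\<forall>\<phi>. test_function \<phi> \<longrightarrow>
      (\<integral>x. complex_of_real (partial_deriv i \<phi> x) * w x \<partial>lborel) =
      - (\<integral>x. complex_of_real (\<phi> x) * h x \<partial>lborel))"
proof -
  have *: "(\<integral>x. complex_of_real (\<phi> x) * rep_L2 (abs_L2 v) x \<partial>lebesgue) = (\<integral>x. complex_of_real (\<phi> x) * v x \<partial>lborel)"
    if "test_function \<phi>" "v \<in> borel_measurable borel" "integrable lborel (\<lambda>x. (cmod (v x))\<^sup>2)" for \<phi> v
  proof -
    note [measurable] = test_function_measurable[OF that(1)]
    show ?thesis by (rule integral_rep_L2[OF that(2,3)]) measurable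
  qed
  show ?thesis
    unfolding weak_deriv_def using *[OF _ w] *[OF _ h] test_function_partial_deriv by auto
qed

text \<open>By the fundamental lemma. It makes the definite description in
  \<open>weak_partial\<close> denote a weak derivative whenever one exists.\<close>

lemma weak_deriv_unique:
  assumes "weak_deriv i u f" "weak_deriv i u h"
  shows "f = h"
proof -
  obtain w where w: "w \<in> borel_measurable borel" "integrable lborel (\<lambda>x. (cmod (w x))\<^sup>2)" "u = abs_L2 w"
    by (rule borel_representative)
  obtain f' where f: "f' \<in> borel_measurable borel" "integrable lborel (\<lambda>x. (cmod (f' x))\<^sup>2)" "f = abs_L2 f'"
    by (rule borel_representative)
  obtain h' where h: "h' \<in> borel_measurable borel" "integrable lborel (\<lambda>x. (cmod (h' x))\<^sup>2)" "h = abs_L2 h'"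
    by (rule borel_representative)
  note lf = locally_integrable_square[OF f(1,2)] and lh = locally_integrable_square[OF h(1,2)]
  have "AE x in lborel. f' x - h' x = 0"
  proof (rule fundamental_lemma[OF locally_integrable_diff[OF lf lh]])
    fix \<psi> assume \<psi>: "test_function \<psi>"
    have "(\<integral>x. complex_of_real (\<psi> x) * f' x \<partial>lborel) = (\<integral>x. complex_of_real (\<psi> x) * h' x \<partial>lborel)"
      using assms(1)[unfolded w(3) f(3) weak_deriv_abs_L2_iff[OF w(1,2) f(1,2)], rule_format, OF \<psi>]
        assms(2)[unfolded w(3) h(3) weak_deriv_abs_L2_iff[OF w(1,2) h(1,2)], rule_format, OF \<psi>]
      by simp
    then show "(\<integral>x. complex_of_real (\<psi> x) * (f' x - h' x) \<partial>lborel) = 0"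
      using integrable_test_function_times[OF lf \<psi>] integrable_test_function_times[OF lh \<psi>]
      by (simp add: right_diff_distrib)
  qed
  then have "AE x in lborel. f' x = h' x" by eventually_elim simp
  then have "AE x in lebesgue. f' x = h' x" by (rule AE_completion)
  then show ?thesis unfolding f(3) h(3) by (intro abs_L2_eqI sq_integrable_borel f(1,2) h(1,2))
qed

lemma weak_partial_eqI: "weak_deriv i u h \<Longrightarrow> weak_partial i u = h"
  unfolding weak_partial_def using weak_deriv_unique by blast

lemma W12_sobolev_pair:
  assumes "u \<in> W12"
  obtains w g where "sobolev_pair w g" "u = abs_L2 w"
proof -
  obtain w where w: "w \<in> borel_measurable borel" "integrable lborel (\<lambda>x. (cmod (w x))\<^sup>2)" "u = abs_L2 w"
    by (rule borel_representative)
  have "\<exists>h. h \<in> borel_measurable borel \<and> integrable lborel (\<lambda>x. (cmod (h x))\<^sup>2) \<and> weak_deriv i u (abs_L2 h)" for i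
  proof -
    obtain f where "weak_deriv i u f" using assms by (auto simp: W12_def)
    moreover obtain h where "h \<in> borel_measurable borel" "integrable lborel (\<lambda>x. (cmod (h x))\<^sup>2)" "f = abs_L2 h"
      by (rule borel_representative)
    ultimately show ?thesis by blast
  qed
  then obtain g where g: "\<And>i. g i \<in> borel_measurable borel" "\<And>i. integrable lborel (\<lambda>x. (cmod (g i x))\<^sup>2)"
    "\<And>i. weak_deriv i u (abs_L2 (g i))" by metis
  have "sobolev_pair w g"
    using w g weak_deriv_abs_L2_iff[OF w(1,2) g(1,2)] by unfold_locales auto
  then show thesis using that w(3) by blast
qed

context sobolev_pair
begin

lemma sq_integrable_w: "sq_integrable w"
  by (rule sq_integrable_borel[OF w_meas w_sq])

lemma weak_deriv_L2: "weak_deriv i (abs_L2 w) (abs_L2 (g i))"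
  unfolding weak_deriv_abs_L2_iff[OF w_meas w_sq g_meas g_sq] using weak by blast

lemma abs_L2_in_W12: "abs_L2 w \<in> W12"
  using weak_deriv_L2 by (auto simp: W12_def)

lemma in_energy_dom_iff:
  assumes [measurable]: "W \<in> borel_measurable borel"
  shows "abs_L2 w \<in> energy_dom W \<longleftrightarrow> integrable lborel (\<lambda>x. W x * (cmod (w x))\<^sup>2)"
  using integral_rep_L2(2)[OF w_meas w_sq, of "\<lambda>x z. W x * (cmod z)\<^sup>2"] abs_L2_in_W12
  by (simp add: energy_dom_def)

lemma energy_eq:
  assumes [measurable]: "W \<in> borel_measurable borel"
  shows "energy W (abs_L2 w) = (\<integral>x. grad_sq x \<partial>lborel) - (\<integral>x. W x * (cmod (w x))\<^sup>2 \<partial>lborel)"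
proof -
  have p: "weak_partial i (abs_L2 w) = abs_L2 (g i)" for i
    by (rule weak_partial_eqI[OF weak_deriv_L2])
  have s: "integrable lebesgue (\<lambda>x. (cmod (rep_L2 (abs_L2 (g i)) x))\<^sup>2)" for i
    using sq_integrable_rep_L2 by (simp add: sq_integrable_def)
  have "(\<integral>x. (\<Sum>i\<in>UNIV. (cmod (rep_L2 (weak_partial i (abs_L2 w)) x))\<^sup>2) \<partial>lebesgue) =
      (\<Sum>i\<in>UNIV. \<integral>x. (cmod (rep_L2 (abs_L2 (g i)) x))\<^sup>2 \<partial>lebesgue)"
    unfolding p by (rule Bochner_Integration.integral_sum) (rule s)
  also have "\<dots> = (\<Sum>i\<in>UNIV. \<integral>x. (cmod (g i x))\<^sup>2 \<partial>lborel)"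
    by (rule sum.cong[OF refl], rule integral_rep_L2(1)[OF g_meas g_sq, of "\<lambda>x z. (cmod z)\<^sup>2"]) measurable
  also have "\<dots> = (\<integral>x. grad_sq x \<partial>lborel)"
    unfolding grad_sq_def using g_sq by (simp add: sum_2)
  finally show ?thesis
    unfolding energy_def using integral_rep_L2(1)[OF w_meas w_sq, of "\<lambda>x z. W x * (cmod z)\<^sup>2"] by simp
qed

end

section \<open>Linear combinations and C1 functions as Sobolev pairs\<close>

lemma sobolev_pair_zero: "sobolev_pair (\<lambda>x. 0) (\<lambda>i x. 0)"
  by unfold_locales auto

lemma sobolev_pair_add_scale:
  assumes "sobolev_pair w g" "sobolev_pair w' g'"
  shows "sobolev_pair (\<lambda>x. c * w x + w' x) (\<lambda>i x. c * g i x + g' i x)"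
proof -
  interpret a: sobolev_pair w g by fact
  interpret b: sobolev_pair w' g' by fact
  have sq: "integrable lborel (\<lambda>x. (cmod (c * u x + v x))\<^sup>2)"
    if [measurable]: "u \<in> borel_measurable borel" "v \<in> borel_measurable borel"
      and "integrable lborel (\<lambda>x. (cmod (u x))\<^sup>2)" "integrable lborel (\<lambda>x. (cmod (v x))\<^sup>2)"
    for u v :: "real^2 \<Rightarrow> complex"
  proof -
    have "sq_integrable (\<lambda>x. c * u x + v x)"
      by (intro sq_integrable_add sq_integrable_scale sq_integrable_borel that)
    then show ?thesis by (simp add: sq_integrable_def integrable_completion)
  qed
  show ?thesis
  proof
    fix \<phi> i assume \<phi>: "test_function \<phi>"
    note i = integrable_test_function_times[OF a.locally_integrable_w test_function_partial_deriv[OF \<phi>, of i]]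
      integrable_test_function_times[OF b.locally_integrable_w test_function_partial_deriv[OF \<phi>, of i]]
      integrable_test_function_times[OF a.locally_integrable_g[of i] \<phi>]
      integrable_test_function_times[OF b.locally_integrable_g[of i] \<phi>]
    have e: "complex_of_real t * (c * y + z) = c * (complex_of_real t * y) + complex_of_real t * z" for t y z
      by (simp add: algebra_simps)
    show "(\<integral>x. complex_of_real (partial_deriv i \<phi> x) * (c * w x + w' x) \<partial>lborel) =
      - (\<integral>x. complex_of_real (\<phi> x) * (c * g i x + g' i x) \<partial>lborel)"
      unfolding e using i a.weak[OF \<phi>, of i] b.weak[OF \<phi>, of i] by simp
  qed (auto intro!: sq a.w_sq b.w_sq a.g_sq b.g_sq)
qed

lemma sobolev_pair_sum:
  assumes "finite J" "\<And>j. j \<in> J \<Longrightarrow> sobolev_pair (w j) (g j)"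
  shows "sobolev_pair (\<lambda>x. \<Sum>j\<in>J. c j * w j x) (\<lambda>i x. \<Sum>j\<in>J. c j * g j i x) \<and>
    abs_L2 (\<lambda>x. \<Sum>j\<in>J. c j * w j x) = (\<Sum>j\<in>J. scale_L2 (c j) (abs_L2 (w j)))"
  using assms
proof (induction J rule: finite_induct)
  case empty
  then show ?case by (simp add: sobolev_pair_zero zero_L2.abs_eq)
next
  case (insert j J)
  have j: "sobolev_pair (w j) (g j)" using insert.prems by simp
  let ?w = "\<lambda>x. \<Sum>j\<in>J. c j * w j x" and ?g = "\<lambda>i x. \<Sum>j\<in>J. c j * g j i x"
  have IH: "sobolev_pair ?w ?g" "abs_L2 ?w = (\<Sum>j\<in>J. scale_L2 (c j) (abs_L2 (w j)))"
    using insert by auto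
  have sq: "sq_integrable (w j)" "sq_integrable ?w"
    using sobolev_pair.sq_integrable_w[OF j] sobolev_pair.sq_integrable_w[OF IH(1)] by auto
  have "abs_L2 (\<lambda>x. c j * w j x + ?w x) = scale_L2 (c j) (abs_L2 (w j)) + abs_L2 ?w"
    using sq sq_integrable_scale[OF sq(1), of "c j"]
    by (subst scale_L2.abs_eq, simp add: ae_equal_def, subst plus_L2.abs_eq) (auto simp: ae_equal_def)
  then show ?case
    using sobolev_pair_add_scale[OF j IH(1), of "c j"] insert.hyps IH(2) by simp
qed

text \<open>The partial derivative of the product \<open>\<phi> x * u x\<close> has integral 0 by
  compact support, and the product rule splits it into the two sides of the weak identity.\<close>

lemma C1_sobolev_pair:
  fixes u :: "real^2 \<Rightarrow> real" and G :: "2 \<Rightarrow> real^2 \<Rightarrow> real"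
  assumes u: "\<And>x. (u has_derivative (\<lambda>h. G 1 x * h $ 1 + G 2 x * h $ 2)) (at x)"
    and G: "\<And>i. continuous_on UNIV (G i)"
    and supp: "\<And>x. r < norm x \<Longrightarrow> u x = 0" "\<And>x i. r < norm x \<Longrightarrow> G i x = 0"
  shows "sobolev_pair (\<lambda>x. complex_of_real (u x)) (\<lambda>i x. complex_of_real (G i x))"
proof
  have cont: "continuous_on UNIV u"
    using u by (auto intro!: continuous_at_imp_continuous_on intro: has_derivative_continuous)
  have [measurable]: "u \<in> borel_measurable borel" "G i \<in> borel_measurable borel" for i
    by (rule borel_measurable_continuous_onI[OF cont], rule borel_measurable_continuous_onI[OF G])
  show "(\<lambda>x. complex_of_real (u x)) \<in> borel_measurable borel" "(\<lambda>x. complex_of_real (G i x)) \<in> borel_measurable borel" for i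
    by measurable
  show "integrable lborel (\<lambda>x. (cmod (complex_of_real (u x)))\<^sup>2)"
    using supp(1) by (intro integrable_continuous_compact_support[of _ r]) (auto intro!: continuous_intros cont)
  show "integrable lborel (\<lambda>x. (cmod (complex_of_real (G i x)))\<^sup>2)" for i
    using supp(2) by (intro integrable_continuous_compact_support[of _ r]) (auto intro!: continuous_intros G)
  fix \<phi> and i :: 2 assume \<phi>: "test_function \<phi>"
  have axis: "G 1 x * (axis i 1 :: real^2) $ 1 + G 2 x * axis i 1 $ 2 = G i x" for x
    using exhaust_2[of i] by (auto simp: axis_def)
  have D: "((\<lambda>x. \<phi> x * u x) has_derivative (\<lambda>h. \<phi> x * (G 1 x * h $ 1 + G 2 x * h $ 2) + frechet_derivative \<phi> (at x) h * u x)) (at x)" for x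
    by (rule has_derivative_mult[OF test_function_has_derivative[OF \<phi>] u])
  have "(\<integral>x. \<phi> x * (G 1 x * (axis i 1 :: real^2) $ 1 + G 2 x * axis i 1 $ 2) + frechet_derivative \<phi> (at x) (axis i 1) * u x \<partial>lborel) = 0"
  proof (rule integral_partial_eq_0[OF D, where r=r])
    show "continuous_on UNIV (\<lambda>x. \<phi> x * (G 1 x * (axis i 1 :: real^2) $ 1 + G 2 x * axis i 1 $ 2) + frechet_derivative \<phi> (at x) (axis i 1) * u x)"
      unfolding axis partial_deriv_def[symmetric]
      by (intro continuous_intros cont G test_function_continuous \<phi> test_function_partial_deriv)
  qed (use supp in auto)
  then have zero: "(\<integral>x. \<phi> x * G i x + partial_deriv i \<phi> x * u x \<partial>lborel) = 0"
    unfolding axis partial_deriv_def[symmetric] .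
  have int: "integrable lborel (\<lambda>x. \<phi> x * G i x)" "integrable lborel (\<lambda>x. partial_deriv i \<phi> x * u x)"
    using supp by (auto intro!: integrable_continuous_compact_support[of _ r] continuous_on_mult cont G
      test_function_continuous[OF \<phi>] test_function_continuous[OF test_function_partial_deriv[OF \<phi>]])
  have "(\<integral>x. partial_deriv i \<phi> x * u x \<partial>lborel) = - (\<integral>x. \<phi> x * G i x \<partial>lborel)"
    using zero int by simp
  then have "complex_of_real (\<integral>x. partial_deriv i \<phi> x * u x \<partial>lborel) = - complex_of_real (\<integral>x. \<phi> x * G i x \<partial>lborel)"
    by simp
  then show "(\<integral>x. complex_of_real (partial_deriv i \<phi> x) * complex_of_real (u x) \<partial>lborel) =
      - (\<integral>x. complex_of_real (\<phi> x) * complex_of_real (G i x) \<partial>lborel)"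
    by (simp only: integral_complex_of_real[symmetric] of_real_mult)
qed

section \<open>Counting negative directions\<close>

lemma ring_weight_continuous: "continuous_on UNIV (ring_weight R)"
proof -
  have bump: "continuous_on UNIV smooth_bump"
    using smooth_upto_bump[of 0] by simp
  have "continuous_on UNIV (\<lambda>x::real^2. (norm x)\<^sup>2 * inverse (R\<^sup>2))"
    by (intro continuous_on_mult continuous_on_power continuous_on_norm continuous_on_id continuous_on_const)
  from continuous_on_compose2[OF bump this]
  have "continuous_on UNIV (\<lambda>x::real^2. smooth_bump ((norm x)\<^sup>2 * inverse (R\<^sup>2)))" by simp
  then show ?thesis
    unfolding ring_weight_def divide_inverse by (intro continuous_on_mult continuous_on_const)
qed

lemma square_norm_sum_disjoint:
  fixes v :: "'i \<Rightarrow> complex"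
  assumes J: "finite J" and disj: "\<And>i j. i \<in> J \<Longrightarrow> j \<in> J \<Longrightarrow> i \<noteq> j \<Longrightarrow> v i = 0 \<or> v j = 0"
  shows "(cmod (\<Sum>j\<in>J. v j))\<^sup>2 = (\<Sum>j\<in>J. (cmod (v j))\<^sup>2)"
proof (cases "\<exists>i\<in>J. v i \<noteq> 0")
  case True
  then obtain i where i: "i \<in> J" "v i \<noteq> 0" by blast
  then have z: "v j = 0" if "j \<in> J - {i}" for j using disj[of i j] that by auto
  have "(\<Sum>j\<in>J. v j) = v i" using z J i(1) by (simp add: sum.remove)
  moreover have "(\<Sum>j\<in>J. (cmod (v j))\<^sup>2) = (cmod (v i))\<^sup>2" using z J i(1) by (simp add: sum.remove)
  ultimately show ?thesis by simp
qed simp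

section \<open>Bounds for the index at a given coupling\<close>

context wells
begin

text \<open>The ring mean as a linear functional on classes, the form in which
  \<open>neg_index_le\<close> takes its constraints.\<close>

definition mean :: "nat \<Rightarrow> L2 \<Rightarrow> complex" where
  "mean j u = (\<integral>x. complex_of_real (ring_weight (R j) x) * rep_L2 u x \<partial>lebesgue)"

lemma mean_abs_L2:
  assumes "w \<in> borel_measurable borel" "integrable lborel (\<lambda>x. (cmod (w x))\<^sup>2)"
  shows "mean j (abs_L2 w) = (\<integral>x. complex_of_real (ring_weight (R j) x) * w x \<partial>lborel)"
  unfolding mean_def by (rule integral_rep_L2(1)[OF assms]) measurable

lemma ring_weight_integrable_times:
  assumes "w \<in> borel_measurable borel" "integrable lborel (\<lambda>x. (cmod (w x))\<^sup>2)"
  shows "integrable lborel (\<lambda>x. complex_of_real (ring_weight (R j) x) * w x)"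
  by (rule integrable_compact_support_times[OF locally_integrable_square[OF assms] ring_weight_continuous, of "2 * R j"])
    (use ring_weight_eq_0[OF R_pos] in auto)

lemma mean_add: "mean j (u + v) = mean j u + mean j v"
  and mean_scale: "mean j (scale_L2 z u) = z * mean j u"
proof -
  obtain f where f: "f \<in> borel_measurable borel" "integrable lborel (\<lambda>x. (cmod (f x))\<^sup>2)" "u = abs_L2 f"
    by (rule borel_representative)
  obtain h where h: "h \<in> borel_measurable borel" "integrable lborel (\<lambda>x. (cmod (h x))\<^sup>2)" "v = abs_L2 h"
    by (rule borel_representative)
  note sq = sq_integrable_borel[OF f(1,2)] sq_integrable_borel[OF h(1,2)]
  have bor: "k \<in> borel_measurable borel \<Longrightarrow> sq_integrable k \<Longrightarrow> integrable lborel (\<lambda>x. (cmod (k x))\<^sup>2)" for k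
    by (simp add: sq_integrable_def integrable_completion)
  have "u + v = abs_L2 (\<lambda>x. f x + h x)"
    unfolding f(3) h(3) using sq by (subst plus_L2.abs_eq) (auto simp: ae_equal_def)
  moreover have "mean j (abs_L2 (\<lambda>x. f x + h x)) = mean j u + mean j v"
    unfolding f(3) h(3)
    using ring_weight_integrable_times[OF f(1,2)] ring_weight_integrable_times[OF h(1,2)] f h
    by (subst mean_abs_L2) (auto intro!: bor sq_integrable_add sq simp: mean_abs_L2 distrib_left)
  ultimately show "mean j (u + v) = mean j u + mean j v" by simp
  have "scale_L2 z u = abs_L2 (\<lambda>x. z * f x)"
    unfolding f(3) using sq by (subst scale_L2.abs_eq) (auto simp: ae_equal_def)
  moreover have "mean j (abs_L2 (\<lambda>x. z * f x)) = z * mean j u"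
    unfolding f(3)
    using f by (subst mean_abs_L2)
      (auto intro!: bor sq_integrable_scale sq simp: mean_abs_L2 mult.left_commute[of _ z])
  ultimately show "mean j (scale_L2 z u) = z * mean j u" by simp
qed

text \<open>Each well with \<open>a j < \<alpha>\<close> contributes one linear constraint; on their
  common kernel \<open>potential_energy_le\<close> makes the form nonnegative.\<close>

lemma N_minus_le:
  assumes \<alpha>: "0 < \<alpha>" "\<alpha> \<le> 1" and fin: "finite {j. a j < \<alpha>}" and a0: "a 0 < \<alpha>"
  shows "N_minus (\<lambda>x. \<alpha> * potential x) \<le> enat (card {j. a j < \<alpha>})"
  unfolding N_minus_def
proof (rule L2.neg_index_le[where f=mean, OF fin mean_add mean_scale])
  fix u assume u: "u \<in> energy_dom (\<lambda>x. \<alpha> * potential x)" and zero: "\<And>i. i \<in> {j. a j < \<alpha>} \<Longrightarrow> mean i u = 0"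
  obtain w g where wg: "sobolev_pair w g" "u = abs_L2 w"
    using u by (auto simp: energy_dom_def elim: W12_sobolev_pair)
  interpret sobolev_pair w g by (rule wg(1))
  interpret wells_sobolev a b c lam kap mu R q B gam w g ..
  have "ring_mean (R j) = 0" if "a j < \<alpha>" for j
    using zero[of j] that unfolding wg(2) mean_abs_L2[OF w_meas w_sq] ring_mean_def by simp
  then have "(\<integral>x. \<alpha> * potential x * (cmod (w x))\<^sup>2 \<partial>lborel) \<le> (\<integral>x. grad_sq x \<partial>lborel)"
    using \<alpha> a0 u by (intro potential_energy_le) (auto simp: wg(2) in_energy_dom_iff)
  then show "0 \<le> energy (\<lambda>x. \<alpha> * potential x) u"
    unfolding wg(2) by (subst energy_eq) auto
qed

lemma q_mono: "i \<le> j \<Longrightarrow> q i \<le> q j"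
  by (rule lift_Suc_mono_le[of q]) (use q_R R_q q_ge_1 in \<open>smt (verit)\<close>)

text \<open>The tents live on the disjoint annuli between \<open>q j\<close> and
  \<open>q (Suc j)\<close>, so the form is diagonal on their span. The diagonal entries are
  negative: a tent is 1 on its ring and collects at least \<open>gam j\<close> from the potential,
  while \<open>gam_tent\<close> keeps its energy below \<open>b j * gam j\<close>.\<close>

lemma N_minus_ge:
  assumes J: "finite J" and b: "\<And>j. j \<in> J \<Longrightarrow> b j \<le> \<alpha>"
  shows "enat (card J) \<le> N_minus (\<lambda>x. \<alpha> * potential x)"
proof -
  define e where "e j = 2 * pi * ln (R j / q j) / (ln (R j / (4 * q j)))\<^sup>2 +
      2 * pi * ln (q (Suc j) / (2 * R j)) / (ln (q (Suc j) / (8 * R j)))\<^sup>2" for j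
  \<comment> \<open>The properties of a tent and its gradient are bundled so that both can be chosen
    for all \<open>j\<close> at once.\<close>
  define T where "T j u G \<longleftrightarrow>
    (\<forall>x. (u has_derivative (\<lambda>h. G 1 x * h $ 1 + G 2 x * h $ 2)) (at x)) \<and>
    (\<forall>i. continuous_on UNIV (G i)) \<and>
    (\<forall>x. norm x \<le> q j \<or> q (Suc j) \<le> norm x \<longrightarrow> u x = 0) \<and>
    (\<forall>i x. norm x \<le> q j \<or> q (Suc j) \<le> norm x \<longrightarrow> G i x = 0) \<and>
    (\<forall>x. R j \<le> norm x \<and> norm x \<le> 2 * R j \<longrightarrow> u x = 1) \<and>
    integrable lborel (\<lambda>x. (G 1 x)\<^sup>2 + (G 2 x)\<^sup>2) \<and>
    (\<integral>x. (G 1 x)\<^sup>2 + (G 2 x)\<^sup>2 \<partial>lborel) \<le> e j"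
    for j and u :: "real^2 \<Rightarrow> real" and G :: "2 \<Rightarrow> real^2 \<Rightarrow> real"
  have ex: "\<exists>u G. T j u G" for j
  proof -
    have "0 < q j" "4 * q j < R j" "8 * R j < q (Suc j)"
      using q_ge_1[of j] q_R[of j] R_q[of j] R_pos[of j] by linarith+
    from tent_exists[OF this] show ?thesis unfolding T_def e_def .
  qed
  define u where "u j = (SOME u. \<exists>G. T j u G)" for j
  define G where "G j = (SOME G. T j (u j) G)" for j
  have "T j (u j) (G j)" for j
  proof -
    have "\<exists>G. T j (u j) G" unfolding u_def by (rule someI_ex[OF ex])
    then show ?thesis unfolding G_def by (rule someI_ex)
  qed
  then have u:
    "\<forall>j x. (u j has_derivative (\<lambda>h. G j 1 x * h $ 1 + G j 2 x * h $ 2)) (at x)"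
    "\<forall>j i. continuous_on UNIV (G j i)"
    "\<forall>j x. norm x \<le> q j \<or> q (Suc j) \<le> norm x \<longrightarrow> u j x = 0"
    "\<forall>j i x. norm x \<le> q j \<or> q (Suc j) \<le> norm x \<longrightarrow> G j i x = 0"
    "\<forall>j x. R j \<le> norm x \<and> norm x \<le> 2 * R j \<longrightarrow> u j x = 1"
    "\<forall>j. integrable lborel (\<lambda>x. (G j 1 x)\<^sup>2 + (G j 2 x)\<^sup>2)"
    "\<forall>j. (\<integral>x. (G j 1 x)\<^sup>2 + (G j 2 x)\<^sup>2 \<partial>lborel) \<le> e j"
    unfolding T_def by blast+
  let ?w = "\<lambda>j x. complex_of_real (u j x)" and ?g = "\<lambda>j i x. complex_of_real (G j i x)"
  let ?E = "\<lambda>j. \<integral>x. (G j 1 x)\<^sup>2 + (G j 2 x)\<^sup>2 \<partial>lborel" and ?P = "\<lambda>j. \<integral>x. potential x * (u j x)\<^sup>2 \<partial>lborel"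
  let ?W = "\<lambda>x. \<alpha> * potential x"
  have pair: "sobolev_pair (?w j) (?g j)" for j
    by (rule C1_sobolev_pair[where r="q (Suc j)", OF u(1)[rule_format] u(2)[rule_format]])
      (use u(3,4) in auto)
  have cont: "continuous_on UNIV (u j)" for j
    using u(1) by (auto intro!: continuous_at_imp_continuous_on intro: has_derivative_continuous)
  have [measurable]: "u j \<in> borel_measurable borel" for j
    by (rule borel_measurable_continuous_onI[OF cont])
  have disj: "(norm x \<le> q i \<or> q (Suc i) \<le> norm x) \<or> (norm x \<le> q j \<or> q (Suc j) \<le> norm x)" if "i \<noteq> j" for i j and x :: "real^2"
    using that q_mono[of "Suc i" j] q_mono[of "Suc j" i] by (cases i j rule: linorder_cases) auto
  have Vu_int: "integrable lborel (\<lambda>x. potential x * (u j x)\<^sup>2)" for j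
  proof -
    have "u j x = 0" if "q (Suc j) < norm x" for x using u(3) that by auto
    then obtain M where M: "\<And>x. norm (u j x) \<le> M"
      using continuous_compact_support_bounded[OF cont] by metis
    have "(u j x)\<^sup>2 \<le> M\<^sup>2" for x using M[of x] by (simp add: abs_le_square_iff[symmetric])
    then show ?thesis
      by (intro Bochner_Integration.integrable_bound[OF integrable_mult_left[OF potential_integrable, of "M\<^sup>2"]])
        (auto intro!: AE_I2 mult_left_mono simp: abs_mult potential_nonneg)
  qed
  have Vu_ge: "gam j \<le> ?P j" for j
  proof -
    have "gam j = (\<integral>x. gam j * ring_weight (R j) x \<partial>lborel)" using ring_weight_integral[of j] by simp
    also have "\<dots> \<le> ?P j"
    proof (rule integral_mono[OF _ Vu_int])
      show "integrable lborel (\<lambda>x. gam j * ring_weight (R j) x)" using ring_weight_integral[of j] by simp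
      fix x
      show "gam j * ring_weight (R j) x \<le> potential x * (u j x)\<^sup>2"
      proof (cases "R j \<le> norm x \<and> norm x \<le> 2 * R j")
        case True
        then show ?thesis using u(5) potential_ge_term by simp
      next
        case False
        then have "ring_weight (R j) x = 0" by (intro ring_weight_eq_0 R_pos) auto
        then show ?thesis using potential_nonneg by simp
      qed
    qed
    finally show ?thesis .
  qed
  show ?thesis
    unfolding N_minus_def
  proof (rule L2.neg_index_ge[OF J, where v="\<lambda>j. abs_L2 (?w j)"])
    interpret z: sobolev_pair "\<lambda>x::real^2. 0" "\<lambda>i x. 0" by (rule sobolev_pair_zero)
    show "0 \<in> energy_dom ?W" "0 \<le> energy ?W 0"
      unfolding zero_L2.abs_eq by (subst z.in_energy_dom_iff, auto) (subst z.energy_eq, auto simp: z.grad_sq_def)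
    fix k :: "nat \<Rightarrow> complex" assume k: "\<exists>j\<in>J. k j \<noteq> 0"
    let ?s = "\<lambda>x. \<Sum>j\<in>J. k j * ?w j x" and ?t = "\<lambda>i x. \<Sum>j\<in>J. k j * ?g j i x"
    have st: "sobolev_pair ?s ?t" "abs_L2 ?s = (\<Sum>j\<in>J. scale_L2 (k j) (abs_L2 (?w j)))"
      using sobolev_pair_sum[OF J, of ?w ?g k] pair by auto
    interpret s: sobolev_pair ?s ?t by (rule st(1))
    have s_sq: "(cmod (?s x))\<^sup>2 = (\<Sum>j\<in>J. (cmod (k j))\<^sup>2 * (u j x)\<^sup>2)" for x
    proof -
      have "k i * ?w i x = 0 \<or> k j * ?w j x = 0" if "i \<noteq> j" for i j
        using disj[OF that, of x] u(3) by auto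
      then show ?thesis
        by (subst square_norm_sum_disjoint[OF J]) (auto simp: norm_mult power_mult_distrib)
    qed
    have t_sq: "s.grad_sq x = (\<Sum>j\<in>J. (cmod (k j))\<^sup>2 * ((G j 1 x)\<^sup>2 + (G j 2 x)\<^sup>2))" for x
    proof -
      have "k j * ?g j l x = 0 \<or> k m * ?g m l x = 0" if "j \<noteq> m" for j m l
        using disj[OF that, of x] u(4) by auto
      then have "(cmod (?t l x))\<^sup>2 = (\<Sum>j\<in>J. (cmod (k j))\<^sup>2 * (G j l x)\<^sup>2)" for l
        by (subst square_norm_sum_disjoint[OF J]) (auto simp: norm_mult power_mult_distrib)
      then show ?thesis by (simp add: s.grad_sq_def distrib_left sum.distrib)
    qed
    have W_int: "integrable lborel (\<lambda>x. ?W x * (cmod (?s x))\<^sup>2)"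
      and W_eq: "(\<integral>x. ?W x * (cmod (?s x))\<^sup>2 \<partial>lborel) = (\<Sum>j\<in>J. \<alpha> * (cmod (k j))\<^sup>2 * ?P j)"
    proof -
      have e: "?W x * (cmod (?s x))\<^sup>2 = (\<Sum>j\<in>J. \<alpha> * (cmod (k j))\<^sup>2 * (potential x * (u j x)\<^sup>2))" for x
        unfolding s_sq by (simp add: sum_distrib_left mult_ac)
      have i: "integrable lborel (\<lambda>x. \<alpha> * (cmod (k j))\<^sup>2 * (potential x * (u j x)\<^sup>2))" for j
        by (rule integrable_mult_right[OF Vu_int])
      show "integrable lborel (\<lambda>x. ?W x * (cmod (?s x))\<^sup>2)"
        unfolding e by (rule Bochner_Integration.integrable_sum[OF i])
      show "(\<integral>x. ?W x * (cmod (?s x))\<^sup>2 \<partial>lborel) = (\<Sum>j\<in>J. \<alpha> * (cmod (k j))\<^sup>2 * ?P j)"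
        unfolding e by (subst Bochner_Integration.integral_sum[OF i]) simp
    qed
    have grad_eq: "(\<integral>x. s.grad_sq x \<partial>lborel) = (\<Sum>j\<in>J. (cmod (k j))\<^sup>2 * ?E j)"
      unfolding t_sq using u(6)
      by (subst Bochner_Integration.integral_sum) (auto simp del: Bochner_Integration.integral_add)
    have "energy ?W (abs_L2 ?s) = (\<integral>x. s.grad_sq x \<partial>lborel) - (\<integral>x. ?W x * (cmod (?s x))\<^sup>2 \<partial>lborel)"
      by (rule s.energy_eq) measurable
    also have "\<dots> = (\<Sum>j\<in>J. (cmod (k j))\<^sup>2 * (?E j - \<alpha> * ?P j))"
      unfolding grad_eq W_eq by (simp only: right_diff_distrib sum_subtractf mult_ac)
    also have "\<dots> < 0"
    proof -
      have neg: "?E j - \<alpha> * ?P j < 0" if "j \<in> J" for j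
      proof -
        have "?E j \<le> e j" using u(7) by blast
        also have "\<dots> < b j * gam j" unfolding e_def by (rule gam_tent)
        also have "\<dots> \<le> \<alpha> * ?P j"
          using b[OF that] b_pos[of j] gam_pos[of j] by (intro mult_mono Vu_ge) auto
        finally show ?thesis by simp
      qed
      obtain i where i: "i \<in> J" "k i \<noteq> 0" using k by blast
      let ?f = "\<lambda>j. (cmod (k j))\<^sup>2 * (?E j - \<alpha> * ?P j)"
      have "(\<Sum>j\<in>J. ?f j) < (\<Sum>j\<in>J. 0)"
      proof (rule sum_strict_mono_ex1[OF J])
        show "\<forall>j\<in>J. ?f j \<le> 0" by (intro ballI mult_nonneg_nonpos zero_le_power2 less_imp_le[OF neg])
        show "\<exists>j\<in>J. ?f j < 0" using neg[OF i(1)] i by (intro bexI[of _ i] mult_pos_neg) auto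
      qed
      then show ?thesis by simp
    qed
    finally show "(\<Sum>j\<in>J. scale_L2 (k j) (abs_L2 (?w j))) \<in> energy_dom ?W \<and>
        energy ?W (\<Sum>j\<in>J. scale_L2 (k j) (abs_L2 (?w j))) < 0"
      using s.in_energy_dom_iff[of ?W] W_int unfolding st(2) by simp
  qed
qed

end

text \<open>What depends on the windows alone, namely \<open>c\<close>, \<open>lam\<close>,
  \<open>mu\<close> and \<open>kap\<close>, is fixed first. Then \<open>R j\<close> is taken large
  in terms of \<open>q j\<close>, and \<open>q (Suc j)\<close> large in terms of \<open>R j\<close>;
  the remaining conditions hold for all sufficiently large radii chosen in this order.\<close>

lemma wells_exist:
  fixes a b :: "nat \<Rightarrow> real"
  assumes a: "\<And>j. 0 < a j" and ab: "\<And>j. a j < b j"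
  shows "\<exists>c lam kap mu R q B gam. wells a b c lam kap mu R q B gam"
proof -
  obtain B where B: "\<And>R x. 0 < R \<Longrightarrow> ring_weight R x \<le> B / R\<^sup>2"
    using ring_weight_bounded by blast
  define c where "c j = (a j + b j) / 2" for j
  have c: "a j < c j" "c j < b j" "0 < c j" for j using ab[of j] a[of j] by (auto simp: c_def)
  \<comment> \<open>The solution of \<open>(1 + lam j) * a j = (1 - 2 * lam j) * c j\<close>,
    positive because \<open>a j < c j\<close>.\<close>
  define lam where "lam j = (c j - a j) / (a j + 2 * c j)" for j
  have lam_pos: "0 < lam j" for j using c[of j] a[of j] by (simp add: lam_def)
  have lam: "(1 + lam j) * a j \<le> (1 - 2 * lam j) * c j" for j
  proof -
    have "lam j * (a j + 2 * c j) = c j - a j" using c[of j] a[of j] by (simp add: lam_def)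
    then show ?thesis by (simp add: algebra_simps)
  qed
  define mu where "mu = rec_nat 1 (\<lambda>j m. min (m / 2) (lam j))"
  have mu_0: "mu 0 = 1" and mu_Suc: "mu (Suc j) = min (mu j / 2) (lam j)" for j by (auto simp: mu_def)
  have mu_pos: "0 < mu j" for j
    by (induction j) (auto simp: mu_0 mu_Suc lam_pos)
  \<comment> \<open>With a quarter, \<open>2 * kap j\<close> takes at most half of
    \<open>mu j\<close> and half of \<open>lam j\<close>, which is what the recursion for
    \<open>mu\<close> allows.\<close>
  define kap where "kap j = min (mu j) (lam j) / 4" for j
  have kap_pos: "0 < kap j" for j using mu_pos lam_pos by (simp add: kap_def)
  define g where "g j q R = 2 * pi / (c j * ln (2 * R / q))" for j q R
  define P where "P j q R q' \<longleftrightarrow> 4 * q < R \<and> 9 * R < q' \<and> 256 * pi * B\<^sup>2 * g j q R \<le> kap j \<and>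
    (1 + 1 / lam j) * ln q / ln (2 * R / q) \<le> kap j \<and> g j q R \<le> (1 / 2) ^ j \<and>
    2 * pi * ln (R / q) / (ln (R / (4 * q)))\<^sup>2 + 2 * pi * ln (q' / (2 * R)) / (ln (q' / (8 * R)))\<^sup>2 < b j * g j q R"
    for j q R q'
  have step: "\<exists>R q'. P j q R q'" if q: "1 \<le> q" for j q
  proof -
    have "0 < q" using q by simp
    have g0: "((\<lambda>R. g j q R) \<longlongrightarrow> 0) at_top"
      unfolding g_def using \<open>0 < q\<close> c(3)[of j] by real_asymp
    have i0: "((\<lambda>R. (1 + 1 / lam j) * ln q / ln (2 * R / q)) \<longlongrightarrow> 0) at_top"
      using \<open>0 < q\<close> by real_asymp
    have r1: "((\<lambda>R. ln (R / q) * ln (2 * R / q) / (ln (R / (4 * q)))\<^sup>2) \<longlongrightarrow> 1) at_top"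
      using \<open>0 < q\<close> by real_asymp
    have e1: "eventually (\<lambda>R. 256 * pi * B\<^sup>2 * g j q R < kap j) at_top"
      using tendsto_mult_right_zero[OF g0, of "256 * pi * B\<^sup>2"] kap_pos[of j] by (rule order_tendstoD(2))
    have e2: "eventually (\<lambda>R. (1 + 1 / lam j) * ln q / ln (2 * R / q) < kap j) at_top"
      using i0 kap_pos[of j] by (rule order_tendstoD(2))
    have e3: "eventually (\<lambda>R. g j q R < (1 / 2) ^ j) at_top"
      using g0 by (rule order_tendstoD(2)) simp
    \<comment> \<open>The factors 2 and 4 inside the logarithms lose their weight for large
      \<open>R\<close>, so the energy of the rising side compared with the nominal threshold tends
      to 1. It falls below \<open>b j / c j\<close> because \<open>c j < b j\<close>.\<close>
    have e4: "eventually (\<lambda>R. ln (R / q) * ln (2 * R / q) / (ln (R / (4 * q)))\<^sup>2 < b j / c j) at_top"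
      using r1 by (rule order_tendstoD(2)) (use c[of j] in simp)
    have e5: "eventually (\<lambda>R. 4 * q < R) at_top" by (rule eventually_gt_at_top)
    from e1 e2 e3 e4 e5 have "eventually (\<lambda>R. 256 * pi * B\<^sup>2 * g j q R < kap j \<and>
      (1 + 1 / lam j) * ln q / ln (2 * R / q) < kap j \<and> g j q R < (1 / 2) ^ j \<and>
      ln (R / q) * ln (2 * R / q) / (ln (R / (4 * q)))\<^sup>2 < b j / c j \<and> 4 * q < R) at_top"
      by eventually_elim simp
    then obtain R where R: "256 * pi * B\<^sup>2 * g j q R < kap j"
      "(1 + 1 / lam j) * ln q / ln (2 * R / q) < kap j" "g j q R < (1 / 2) ^ j"
      "ln (R / q) * ln (2 * R / q) / (ln (R / (4 * q)))\<^sup>2 < b j / c j" "4 * q < R"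
      by (auto dest!: eventually_happens)
    have "0 < R" using R(5) q by linarith
    have l: "0 < ln (2 * R / q)" using R(5) q by (intro ln_gt_zero) (auto simp: field_simps)
    have "2 * pi * ln (R / q) / (ln (R / (4 * q)))\<^sup>2 = (2 * pi / ln (2 * R / q)) * (ln (R / q) * ln (2 * R / q) / (ln (R / (4 * q)))\<^sup>2)"
      using l by simp
    also have "\<dots> < (2 * pi / ln (2 * R / q)) * (b j / c j)"
      using l by (intro mult_strict_left_mono R(4)) auto
    also have "\<dots> = b j * g j q R" by (simp add: g_def mult_ac)
    finally have gap: "0 < b j * g j q R - 2 * pi * ln (R / q) / (ln (R / (4 * q)))\<^sup>2" by simp
    \<comment> \<open>The falling side of the tent becomes free as \<open>q'\<close> grows, so it
      fits into the gap left by the rising side.\<close>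
    have "((\<lambda>q'. 2 * pi * ln (q' / (2 * R)) / (ln (q' / (8 * R)))\<^sup>2) \<longlongrightarrow> 0) at_top"
      using \<open>0 < R\<close> by real_asymp
    from order_tendstoD(2)[OF this gap] eventually_gt_at_top[of "9 * R"]
    have "eventually (\<lambda>q'. P j q R q') at_top"
      by eventually_elim (use R in \<open>auto simp: P_def\<close>)
    then show ?thesis by (auto dest!: eventually_happens)
  qed
  define Rf where "Rf j q = (SOME R. \<exists>q'. P j q R q')" for j q
  define Qf where "Qf j q = (SOME q'. P j q (Rf j q) q')" for j q
  have RQ: "P j q (Rf j q) (Qf j q)" if "1 \<le> q" for j q
    unfolding Qf_def by (rule someI_ex) (use someI_ex[OF step[OF that]] in \<open>simp add: Rf_def\<close>)
  define q where "q = rec_nat 1 Qf"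
  define R where "R j = Rf j (q j)" for j
  have q_0: "q 0 = 1" and q_Suc: "q (Suc j) = Qf j (q j)" for j by (auto simp: q_def)
  have q1: "1 \<le> q j" for j
  proof (induction j)
    case (Suc j)
    from RQ[OF Suc, of j] Suc show ?case by (simp add: q_Suc P_def)
  qed (simp add: q_0)
  have P: "P j (q j) (R j) (q (Suc j))" for j using RQ[OF q1, of j j] by (simp add: R_def q_Suc)
  have "wells a b c lam kap mu R q B (\<lambda>j. g j (q j) (R j))"
  proof
    fix j
    show "mu (Suc j) \<le> mu j - 2 * kap j" using mu_pos[of j] by (simp add: mu_Suc kap_def)
    show "mu (Suc j) \<le> 2 * lam j - 2 * kap j" using lam_pos[of j] by (simp add: mu_Suc kap_def)
    show "g j (q j) (R j) = 2 * pi / (c j * ln (2 * R j / q j))" by (simp add: g_def)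
  qed (use P a c B lam lam_pos kap_pos mu_0 mu_pos q_0 in \<open>auto simp: P_def\<close>)
  then show ?thesis by blast
qed

section \<open>From windows to potentials\<close>

lemma potential_exists:
  fixes a b :: "nat \<Rightarrow> real"
  assumes "\<And>j. 0 < a j" "\<And>j. a j < b j"
  shows "\<exists>V :: real^2 \<Rightarrow> real. integrable lebesgue V \<and> (\<forall>x. 0 \<le> V x) \<and>
    (\<forall>\<alpha> J. finite J \<longrightarrow> (\<forall>j\<in>J. b j \<le> \<alpha>) \<longrightarrow> enat (card J) \<le> N_minus (\<lambda>x. \<alpha> * V x)) \<and>
    (\<forall>\<alpha>. 0 < \<alpha> \<longrightarrow> \<alpha> \<le> 1 \<longrightarrow> finite {j. a j < \<alpha>} \<longrightarrow> a 0 < \<alpha> \<longrightarrow>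
      N_minus (\<lambda>x. \<alpha> * V x) \<le> enat (card {j. a j < \<alpha>}))"
proof -
  obtain c lam kap mu R q B gam where "wells a b c lam kap mu R q B gam"
    using wells_exist[of a b] assms by blast
  then interpret wells a b c lam kap mu R q B gam .
  have "integrable lebesgue potential"
    using potential_integrable by (simp add: integrable_completion)
  then show ?thesis
    using potential_nonneg N_minus_ge N_minus_le by (intro exI[of _ potential]) blast
qed

text \<open>\<open>S k\<close> wells have to be active at \<open>\<alpha> k\<close>. Well
  \<open>j\<close> is first needed at index \<open>\<kappa> j\<close>, so its window runs from the
  preceding coupling to \<open>\<alpha> (\<kappa> j)\<close>. No \<open>\<alpha> k\<close> then lies
  strictly inside a window, except possibly the artificial ones below \<open>\<alpha> 0\<close>,
  which contain none either, so the upper and lower bounds agree.\<close>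

lemma staircase_potential_exists:
  fixes \<alpha> :: "nat \<Rightarrow> real" and N :: "nat \<Rightarrow> nat"
  assumes \<alpha>: "strict_mono \<alpha>" "\<And>k. 0 < \<alpha> k" "\<alpha> \<longlonglongrightarrow> 1" and N: "\<And>k. N k \<ge> 1"
  obtains V :: "real^2 \<Rightarrow> real" where "integrable lebesgue V" "\<And>x. 0 \<le> V x"
    "\<And>k. N_minus (\<lambda>x. \<alpha> k * V x) = enat (Suc (\<Sum>i<k. N i))"
proof -
  \<comment> \<open>The value \<open>S 0 = 1\<close> makes well 0 active at
    \<open>\<alpha> 0\<close> already, so that \<open>a 0 < \<alpha> k\<close> for all
    \<open>k\<close>, as the upper bound requires. The shift by one cancels in differences.\<close>
  define S where "S k = Suc (\<Sum>i<k. N i)" for k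
  have S_Suc: "S (Suc k) = S k + N k" for k by (simp add: S_def)
  have S_mono: "S k \<le> S l" if "k \<le> l" for k l
    using that by (rule lift_Suc_mono_le[rotated]) (simp add: S_Suc)
  have S_gt: "k < S k" for k
  proof (induction k)
    case (Suc k)
    then show ?case using N[of k] by (simp add: S_Suc)
  qed (simp add: S_def)
  define \<kappa> where "\<kappa> j = (LEAST k. j < S k)" for j
  have \<kappa>: "\<kappa> j \<le> k \<longleftrightarrow> j < S k" for j k
  proof
    assume "\<kappa> j \<le> k"
    moreover have "j < S (\<kappa> j)" unfolding \<kappa>_def by (rule LeastI[of "\<lambda>k. j < S k" j]) (rule S_gt)
    ultimately show "j < S k" using S_mono less_le_trans by blast
  qed (auto simp: \<kappa>_def intro: Least_le)
  have \<alpha>_less: "\<alpha> k < \<alpha> l \<longleftrightarrow> k < l" and \<alpha>_le: "\<alpha> k \<le> \<alpha> l \<longleftrightarrow> k \<le> l" for k l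
    using \<alpha>(1) by (auto simp: strict_mono_less strict_mono_less_eq)
  have \<alpha>_le_1: "\<alpha> k \<le> 1" for k
    using \<alpha>(1,3) by (intro incseq_le) (auto simp: strict_mono_mono)
  \<comment> \<open>A well active from the start has no preceding coupling; any positive number
    below \<open>\<alpha> 0\<close> can open its window.\<close>
  define a where "a j = (if \<kappa> j = 0 then \<alpha> 0 / 2 else \<alpha> (\<kappa> j - 1))" for j
  define b where "b j = \<alpha> (\<kappa> j)" for j
  have a: "0 < a j" "a j < b j" for j
    using \<alpha>(2) \<alpha>_less by (auto simp: a_def b_def)
  have lt: "a j < \<alpha> k \<longleftrightarrow> j < S k" for j k
  proof (cases "\<kappa> j = 0")
    case True
    have "a j < \<alpha> 0" using \<alpha>(2)[of 0] True by (simp add: a_def)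
    also have "\<dots> \<le> \<alpha> k" by (simp add: \<alpha>_le)
    finally show ?thesis using True \<kappa>[of j k] by simp
  next
    case False
    then show ?thesis using \<kappa>[of j k] by (auto simp: a_def \<alpha>_less)
  qed
  obtain V :: "real^2 \<Rightarrow> real" where V: "integrable lebesgue V" "\<forall>x. 0 \<le> V x"
    "\<forall>\<alpha> J. finite J \<longrightarrow> (\<forall>j\<in>J. b j \<le> \<alpha>) \<longrightarrow> enat (card J) \<le> N_minus (\<lambda>x. \<alpha> * V x)"
    "\<forall>\<alpha>. 0 < \<alpha> \<longrightarrow> \<alpha> \<le> 1 \<longrightarrow> finite {j. a j < \<alpha>} \<longrightarrow> a 0 < \<alpha> \<longrightarrow>
      N_minus (\<lambda>x. \<alpha> * V x) \<le> enat (card {j. a j < \<alpha>})"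
    using potential_exists[of a b, OF a] by (elim exE conjE)
  have "N_minus (\<lambda>x. \<alpha> k * V x) = enat (S k)" for k
  proof (rule antisym)
    have eq: "{j. a j < \<alpha> k} = {..<S k}" by (auto simp: lt)
    show "N_minus (\<lambda>x. \<alpha> k * V x) \<le> enat (S k)"
      using V(4)[rule_format, of "\<alpha> k"] \<alpha>(2) \<alpha>_le_1 unfolding eq by (simp add: lt) (simp add: S_def)
    show "enat (S k) \<le> N_minus (\<lambda>x. \<alpha> k * V x)"
      using V(3)[rule_format, of "{..<S k}" "\<alpha> k"] by (auto simp: b_def \<alpha>_le \<kappa>)
  qed
  then show thesis using that V(1,2) by (simp add: S_def)
qed

text \<open>\<open>N\<close> windows end at 1, and all others open at 1 and shrink to it. At
  coupling 1 the latter wells are still inactive, because \<open>a j < 1\<close> fails for them,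
  while every coupling above 1 has passed all but finitely many of their windows.\<close>

lemma threshold_potential_exists:
  assumes "N \<ge> 1"
  obtains V :: "real^2 \<Rightarrow> real" where "integrable lebesgue V" "\<And>x. 0 \<le> V x"
    "N_minus V = enat N" "\<And>\<alpha>. 1 < \<alpha> \<Longrightarrow> N_minus (\<lambda>x. \<alpha> * V x) = \<infinity>"
proof -
  define a :: "nat \<Rightarrow> real" where "a j = (if j < N then 1 / 2 else 1)" for j
  define b :: "nat \<Rightarrow> real" where "b j = (if j < N then 1 else 1 + 1 / real (Suc j))" for j
  have a: "0 < a j" "a j < b j" for j by (auto simp: a_def b_def)
  obtain V :: "real^2 \<Rightarrow> real" where V: "integrable lebesgue V" "\<forall>x. 0 \<le> V x"
    "\<forall>\<alpha> J. finite J \<longrightarrow> (\<forall>j\<in>J. b j \<le> \<alpha>) \<longrightarrow> enat (card J) \<le> N_minus (\<lambda>x. \<alpha> * V x)"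
    "\<forall>\<alpha>. 0 < \<alpha> \<longrightarrow> \<alpha> \<le> 1 \<longrightarrow> finite {j. a j < \<alpha>} \<longrightarrow> a 0 < \<alpha> \<longrightarrow>
      N_minus (\<lambda>x. \<alpha> * V x) \<le> enat (card {j. a j < \<alpha>})"
    using potential_exists[of a b, OF a] by (elim exE conjE)
  have eq: "{j. a j < 1} = {..<N}" by (auto simp: a_def)
  have "N_minus V = enat N"
  proof (rule antisym)
    show "N_minus V \<le> enat N" using V(4)[rule_format, of 1] assms unfolding eq by (simp add: a_def)
    show "enat N \<le> N_minus V" using V(3)[rule_format, of "{..<N}" 1] by (simp add: b_def)
  qed
  moreover have "N_minus (\<lambda>x. \<alpha> * V x) = \<infinity>" if \<alpha>: "1 < \<alpha>" for \<alpha>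
  proof -
    obtain m where m: "inverse (real (Suc m)) < \<alpha> - 1" using reals_Archimedean[of "\<alpha> - 1"] \<alpha> by auto
    have ge: "enat n \<le> N_minus (\<lambda>x. \<alpha> * V x)" for n
    proof -
      have "b j \<le> \<alpha>" if "j \<in> {m..<m + n}" for j
      proof -
        have "1 / real (Suc j) \<le> inverse (real (Suc m))"
          using that by (simp add: inverse_eq_divide frac_le)
        then show ?thesis using m \<alpha> by (simp add: b_def)
      qed
      then show ?thesis using V(3)[rule_format, of "{m..<m + n}" \<alpha>] by simp
    qed
    show ?thesis
    proof (cases "N_minus (\<lambda>x. \<alpha> * V x)")
      case (enat m)
      with ge[of "Suc m"] show ?thesis by simp
    qed
  qed
  ultimately show thesis using that V(1,2) by blast
qed

theorem theorem9p5:
  shows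
    "(\<forall>N::nat. N \<ge> 1 \<longrightarrow>
        (\<exists>V :: real^2 \<Rightarrow> real. integrable lebesgue V \<and> (\<forall>x. 0 \<le> V x) \<and>
           N_minus V = enat N \<and>
           (\<forall>\<alpha>::real. \<alpha> > 1 \<longrightarrow> N_minus (\<lambda>x. \<alpha> * V x) = \<infinity>)))
     \<and>
     (\<forall>(\<alpha> :: nat \<Rightarrow> real) (N :: nat \<Rightarrow> nat).
        strict_mono \<alpha> \<and> (\<forall>k. 0 < \<alpha> k) \<and> \<alpha> \<longlonglongrightarrow> 1 \<and> (\<forall>k. N k \<ge> 1) \<longrightarrow>
        (\<exists>V :: real^2 \<Rightarrow> real. integrable lebesgue V \<and> (\<forall>x. 0 \<le> V x) \<and>
           (\<forall>k. enat (N k) \<le> N_minus (\<lambda>x. \<alpha> (Suc k) * V x) - N_minus (\<lambda>x. \<alpha> k * V x) \<and>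
                N_minus (\<lambda>x. \<alpha> (Suc k) * V x) - N_minus (\<lambda>x. \<alpha> k * V x) < \<infinity>)))
     \<and>
     (\<forall>\<alpha> :: nat \<Rightarrow> real.
        strict_mono \<alpha> \<and> (\<forall>k. 0 < \<alpha> k) \<and> \<alpha> \<longlonglongrightarrow> 1 \<and>
        summable (\<lambda>k. (1 - \<alpha> (Suc k)) / (\<alpha> (Suc k) - \<alpha> k)) \<longrightarrow>
        (\<exists>(V :: real^2 \<Rightarrow> real) (k\<^sub>0 :: nat). integrable lebesgue V \<and> (\<forall>x. 0 \<le> V x) \<and>
           (\<forall>k\<ge>k\<^sub>0. N_minus (\<lambda>x. \<alpha> (Suc k) * V x) - N_minus (\<lambda>x. \<alpha> k * V x) = 1)))"
proof (intro conjI allI impI)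
  fix N :: nat assume "N \<ge> 1"
  then show "\<exists>V :: real^2 \<Rightarrow> real. integrable lebesgue V \<and> (\<forall>x. 0 \<le> V x) \<and>
           N_minus V = enat N \<and> (\<forall>\<alpha>::real. \<alpha> > 1 \<longrightarrow> N_minus (\<lambda>x. \<alpha> * V x) = \<infinity>)"
    by (rule threshold_potential_exists) blast
next
  fix \<alpha> :: "nat \<Rightarrow> real" and N :: "nat \<Rightarrow> nat"
  assume *: "strict_mono \<alpha> \<and> (\<forall>k. 0 < \<alpha> k) \<and> \<alpha> \<longlonglongrightarrow> 1 \<and> (\<forall>k. N k \<ge> 1)"
  obtain V :: "real^2 \<Rightarrow> real" where V: "integrable lebesgue V" "\<And>x. 0 \<le> V x"
    "\<And>k. N_minus (\<lambda>x. \<alpha> k * V x) = enat (Suc (\<Sum>i<k. N i))"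
    by (rule staircase_potential_exists[of \<alpha> N]) (use * in auto)
  show "\<exists>V :: real^2 \<Rightarrow> real. integrable lebesgue V \<and> (\<forall>x. 0 \<le> V x) \<and>
           (\<forall>k. enat (N k) \<le> N_minus (\<lambda>x. \<alpha> (Suc k) * V x) - N_minus (\<lambda>x. \<alpha> k * V x) \<and>
                N_minus (\<lambda>x. \<alpha> (Suc k) * V x) - N_minus (\<lambda>x. \<alpha> k * V x) < \<infinity>)"
    by (rule exI[of _ V]) (simp add: V)
next
  fix \<alpha> :: "nat \<Rightarrow> real"
  assume *: "strict_mono \<alpha> \<and> (\<forall>k. 0 < \<alpha> k) \<and> \<alpha> \<longlonglongrightarrow> 1 \<and>
        summable (\<lambda>k. (1 - \<alpha> (Suc k)) / (\<alpha> (Suc k) - \<alpha> k))"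
  \<comment> \<open>Steps of height one: the index at \<open>\<alpha> k\<close> is
    \<open>k + 1\<close>.\<close>
  obtain V :: "real^2 \<Rightarrow> real" where V: "integrable lebesgue V" "\<And>x. 0 \<le> V x"
    "\<And>k. N_minus (\<lambda>x. \<alpha> k * V x) = enat (Suc (\<Sum>i<k. 1))"
    by (rule staircase_potential_exists[of \<alpha> "\<lambda>_. 1"]) (use * in auto)
  show "\<exists>(V :: real^2 \<Rightarrow> real) (k\<^sub>0 :: nat). integrable lebesgue V \<and> (\<forall>x. 0 \<le> V x) \<and>
           (\<forall>k\<ge>k\<^sub>0. N_minus (\<lambda>x. \<alpha> (Suc k) * V x) - N_minus (\<lambda>x. \<alpha> k * V x) = 1)"
    by (rule exI[of _ V], rule exI[of _ 0]) (simp add: V one_enat_def)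
qed

end
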